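(* Let $p\in[1,2]$ and let $\varepsilon_0(p)$ be the John--Nirenberg constant of $\mathrm{BMO}^p((0,1))$ (defined in the context). If $Q$ is an interval and $\varphi\in\mathrm{BMO}(Q)$, then $$\inf_{f\in L^\infty(Q)}\|\varphi-f\|_{\mathrm{BMO}^p(Q)}\ge \frac{\varepsilon_0(p)}{\min\{\varepsilon_{\varphi},\varepsilon_{-\varphi}\}},\qquad( * )$$ where $\varepsilon_{\pm\varphi}$ are defined with respect to $A_\infty(Q)$. Consequently, if $\varphi\in\mathrm{BMO}(\mathbb R)$, then $$\inf_{f\in L^\infty(\mathbb R)}\|\varphi-f\|_{\mathrm{BMO}^p(\mathbb R)}\ge \frac{\varepsilon_0(p)}{\min\{\varepsilon_{\varphi},\varepsilon_{-\varphi}\}},$$ where $\varepsilon_{\pm\varphi}$ are defined with respect to $A_\infty(\mathbb R)$. Inequality $( * )$ is sharp, i.e., for each $p\in[1,2]$ the constant $\varepsilon_0(p)$ in $( * )$ cannot be replaced by a larger one.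
   Context: For an interval $J$, $\langle\varphi\rangle_J=\frac1{|J|}\int_J\varphi$. Let $X$ be a bounded interval $Q$ or $\mathbb R$. For $p>0$, $\|\varphi\|_{\mathrm{BMO}^p(X)}=\sup_{J\subset X}\langle|\varphi-\langle\varphi\rangle_J|^p\rangle_J^{1/p}$, the supremum being over all bounded intervals $J\subset X$; $\mathrm{BMO}(X)$ is the set of locally integrable $\varphi$ for which this is finite (the set is the same for all $p>0$). An a.e. positive function $w$ is in $A_\infty(X)$ if $w$ and $\log w$ are locally integrable and $[w]_{A_\infty(X)}:=\sup_{J\subset X}\langle w\rangle_Je^{-\langle\log w\rangle_J}<\infty$. For $\varphi\in\mathrm{BMO}(X)$, $\varepsilon_\varphi=\sup\{\varepsilon>0:\ e^{\varepsilon\varphi}\in A_\infty(X)\}\in(0,\infty]$. A quotient with denominator $\infty$ is $0$. For $p>0$ and $\varepsilon\ge0$ let $C(\varepsilon,p)\in[1,\infty]$ be the smallest constant such that $\langle e^\varphi\rangle_J\le C(\varepsilon,p)\,e^{\langle\varphi\rangle_J}$ for every $\varphi\in\mathrm{BMO}((0,1))$ with $\|\varphi\|_{\mathrm{BMO}^p((0,1))}\le\varepsilon$ and every subinterval $J\subset(0,1)$. The John--Nirenberg constant $\varepsilon_0(p)$ is the largest number such that $C(\varepsilon,p)<\infty$ for all $0\le\varepsilon<\varepsilon_0(p)$. *)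

theory Defs
  imports "HOL-Analysis.Analysis"
begin

text \<open>
  Functions on an interval \<open>X\<close> are modelled by total functions \<open>real \<Rightarrow> real\<close> of which only the
  values on \<open>X\<close> matter. Intervals may be open, closed or half-open.
\<close>

definition bounded_interval :: "real set \<Rightarrow> bool" where
  "bounded_interval J \<longleftrightarrow> is_interval J \<and> bounded J \<and> 0 < measure lebesgue J"

definition subintervals :: "real set \<Rightarrow> real set set" where
  "subintervals X = {J. bounded_interval J \<and> J \<subseteq> X}"

definition avg :: "real set \<Rightarrow> (real \<Rightarrow> real) \<Rightarrow> real" where
  "avg J f = set_lebesgue_integral lebesgue J f / measure lebesgue J"

text \<open>
  Average of a nonnegative function that need not be integrable; the value may be \<open>\<infinity>\<close>.
\<close>

definition nn_avg :: "real set \<Rightarrow> (real \<Rightarrow> real) \<Rightarrow> ennreal" where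
  "nn_avg J f = (\<integral>\<^sup>+x\<in>J. ennreal (f x) \<partial>lebesgue) / emeasure lebesgue J"

text \<open>
  Integrability is required on every bounded subinterval of \<open>X\<close>, including those that share an
  endpoint with \<open>X\<close>, because averages over all of them are taken; for bounded \<open>X\<close> this is
  integrability on \<open>X\<close>.
\<close>

definition loc_integrable :: "real set \<Rightarrow> (real \<Rightarrow> real) \<Rightarrow> bool" where
  "loc_integrable X f \<longleftrightarrow> (\<forall>J\<in>subintervals X. set_integrable lebesgue J f)"

definition ennreal_powr :: "ennreal \<Rightarrow> real \<Rightarrow> ennreal" where
  "ennreal_powr x a = (if x = \<infinity> then \<infinity> else ennreal (enn2real x powr a))"

definition bmo_norm :: "real \<Rightarrow> real set \<Rightarrow> (real \<Rightarrow> real) \<Rightarrow> ennreal" where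
  "bmo_norm p X f =
     (SUP J\<in>subintervals X. ennreal_powr (nn_avg J (\<lambda>x. \<bar>f x - avg J f\<bar> powr p)) (1 / p))"

text \<open>
  The finiteness condition does not depend on the exponent; the defining exponent is \<open>1\<close>.
\<close>

definition BMO :: "real set \<Rightarrow> (real \<Rightarrow> real) set" where
  "BMO X = {f. loc_integrable X f \<and> bmo_norm 1 X f < \<infinity>}"

definition Linf :: "real set \<Rightarrow> (real \<Rightarrow> real) set" where
  "Linf X = {f. set_borel_measurable lebesgue X f \<and>
                (\<exists>M. AE x in lebesgue. x \<in> X \<longrightarrow> \<bar>f x\<bar> \<le> M)}"

definition Ainf_const :: "real set \<Rightarrow> (real \<Rightarrow> real) \<Rightarrow> ennreal" where
  "Ainf_const X w =
     (SUP J\<in>subintervals X. ennreal (avg J w * exp (- avg J (\<lambda>x. ln (w x)))))"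

definition Ainf :: "real set \<Rightarrow> (real \<Rightarrow> real) set" where
  "Ainf X = {w. (AE x in lebesgue. x \<in> X \<longrightarrow> 0 < w x) \<and>
                loc_integrable X w \<and> loc_integrable X (\<lambda>x. ln (w x)) \<and>
                Ainf_const X w < \<infinity>}"

definition eps_Ainf :: "real set \<Rightarrow> (real \<Rightarrow> real) \<Rightarrow> ennreal" where
  "eps_Ainf X \<phi> = Sup {ennreal \<epsilon> |\<epsilon>. 0 < \<epsilon> \<and> (\<lambda>x. exp (\<epsilon> * \<phi> x)) \<in> Ainf X}"

definition JN_C :: "real \<Rightarrow> real \<Rightarrow> ennreal" where
  "JN_C \<epsilon> p = Inf {C. \<forall>\<phi>\<in>BMO {0<..<1}. bmo_norm p {0<..<1} \<phi> \<le> ennreal \<epsilon> \<longrightarrow>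
     (\<forall>J\<in>subintervals {0<..<1}.
        nn_avg J (\<lambda>x. exp (\<phi> x)) \<le> C * ennreal (exp (avg J \<phi>)))}"

definition JN_const :: "real \<Rightarrow> ennreal" where
  "JN_const p = Sup {e. \<forall>\<epsilon>\<ge>0. ennreal \<epsilon> < e \<longrightarrow> JN_C \<epsilon> p < \<infinity>}"

end

theory Submission
  imports Defs "HOL-Probability.Probability"
begin

text \<open>
  If \<open>f\<close> is bounded and \<open>\<epsilon> * \<parallel>\<phi> - f\<parallel>\<close> is below the John--Nirenberg constant, then the definition of
  that constant, transported to every interval by affine maps, puts \<open>exp (\<epsilon> * (\<phi> - f))\<close> and hence
  \<open>exp (\<epsilon> * \<phi>)\<close> into \<open>A\<^sub>\<infinity>\<close>; this is the lower bound.

  Sharpness is witnessed by \<open>\<phi> x = - ln (x - a)\<close>, where \<open>a\<close> is the left endpoint of \<open>Q\<close>, whose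
  exponent is \<open>1\<close>. It remains to see that the norm \<open>L\<close> of this function is at most the
  John--Nirenberg constant, that is, that \<open>exp \<psi>\<close> has uniformly bounded averages as soon as
  \<open>\<parallel>\<psi>\<parallel> \<le> \<kappa> * L\<close> for some \<open>\<kappa> < 1\<close>. By the rising sun lemma the decreasing rearrangement of \<open>\<psi>\<close> oscillates
  on every \<open>(0,t)\<close> at most as much as \<open>\<psi>\<close> does. Oscillation is convex and invariant under dilations, so
  averaging a decreasing function over dilations replaces it, up to bounded terms, by a multiple of
  \<open>- ln x\<close> given by its mean growth rate, which therefore cannot exceed \<open>\<kappa>\<close>. Thus the
  rearrangement is at most \<open>\<kappa> * (- ln x) + C\<close>, whose exponential is integrable.
\<close>

section \<open>Averages over intervals\<close>

text \<open>\<open>JN_const\<close> is a supremum without a formula, and the proof never computes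
  it: comparing it with the norm \<open>L\<close> is enough, and both halves together even force
  equality (take \<open>- ln x\<close> and \<open>f = 0\<close> in the lower bound). The obstacle is
  uniformity: one constant has to serve every \<psi> of the given norm, so all errors may depend on
  p and \<kappa> only, while the rearrangement is controlled on intervals (0,t) alone. Two devices
  meet this. The power is replaced by its tangent at \<open>\<kappa> * (- ln x - 1)\<close>, which
  turns the oscillation bound into a bound on a linear functional with the exact factor \<kappa>.
  Dilations by r are averaged with dr / r over (q,1): after y = r x the variable x occurs only in
  the limits of an integral of D y / y. Its lower limit contributes at least D q times the change of
  - ln x, and the contribution of the upper limit is bounded independently of q. One-sided estimates
  suffice, because a decreasing error pairs nonnegatively with a decreasing function of mean
  zero.\<close>

lemma bounded_interval_endpoints:
  assumes "bounded_interval J"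
  obtains a b where "a < b" "{a<..<b} \<subseteq> J" "J \<subseteq> {a..b}"
proof -
  have iv: "is_interval J" and bd: "bounded J" and pos: "0 < measure lebesgue J"
    using assms by (auto simp: bounded_interval_def)
  have ne: "J \<noteq> {}"
    using pos by auto
  have ba: "bdd_above J" and bb: "bdd_below J"
    using bd by (auto simp: bounded_imp_bdd_above bounded_imp_bdd_below)
  have sub: "J \<subseteq> {Inf J..Sup J}"
    using ba bb by (auto intro: cInf_lower cSup_upper)
  have "{Inf J<..<Sup J} \<subseteq> J"
  proof
    fix x assume x: "x \<in> {Inf J<..<Sup J}"
    obtain y where y: "y \<in> J" "y < x"
      using x cInf_less_iff[OF ne bb] by auto
    obtain z where z: "z \<in> J" "x < z"
      using x less_cSup_iff[OF ne ba] by auto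
    show "x \<in> J"
      using iv y z by (meson is_interval_1 less_imp_le)
  qed
  moreover have "Inf J < Sup J"
  proof (rule ccontr)
    assume "\<not> Inf J < Sup J"
    then have "J \<subseteq> {Inf J}"
      using sub by auto
    then have "J = {Inf J}"
      using ne by blast
    then have "measure lebesgue J = measure lebesgue {Inf J}"
      by (rule arg_cong)
    then have "measure lebesgue J = 0"
      by simp
    then show False
      using pos by simp
  qed
  ultimately show ?thesis
    using sub that by blast
qed

lemma bounded_interval_open: "a < b \<Longrightarrow> bounded_interval {a<..<b::real}"
  by (auto simp: bounded_interval_def is_interval_1)

lemma between_open_closed_sets:
  assumes "{a<..<b::real} \<subseteq> J" "J \<subseteq> {a..b}"
  shows "J \<in> sets borel"
proof -
  have "J = {a<..<b} \<union> (J \<inter> {a, b})"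
    using assms by auto
  moreover have "J \<inter> {a, b} \<in> sets borel"
    by (intro finite_imp_closed[THEN borel_closed]) auto
  ultimately show ?thesis
    by (metis borel_open open_greaterThanLessThan sets.Un)
qed

lemma subset_open_closed_ends:
  assumes "{a<..<b::real} \<subseteq> J" "J \<subseteq> {a..b}"
  shows "(J - {a<..<b}) \<union> ({a<..<b} - J) \<subseteq> {a, b}"
  using assms by auto

lemma set_integral_open_ends:
  assumes "{a<..<b::real} \<subseteq> J" "J \<subseteq> {a..b}"
  shows "set_lebesgue_integral lebesgue J f = set_lebesgue_integral lebesgue {a<..<b} (f :: real \<Rightarrow> real)"
  by (rule set_integral_discrete_difference[of "{a, b}"])
    (use subset_open_closed_ends[OF assms] in auto)

lemma set_integrable_open_ends:
  assumes "{a<..<b::real} \<subseteq> J" "J \<subseteq> {a..b}"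
  shows "set_integrable lebesgue J f = set_integrable lebesgue {a<..<b} (f :: real \<Rightarrow> real)"
  by (rule set_integrable_discrete_difference[of "{a, b}"])
    (use subset_open_closed_ends[OF assms] in auto)

lemma AE_open_ends:
  assumes "{a<..<b::real} \<subseteq> J" "J \<subseteq> {a..b}"
  shows "AE x in lebesgue. x \<in> J \<longleftrightarrow> x \<in> {a<..<b}"
proof -
  have "AE x in lebesgue. x \<noteq> a" "AE x in lebesgue. x \<noteq> b"
    by (auto intro: AE_completion AE_lborel_singleton)
  then show ?thesis
    by eventually_elim (use assms in auto)
qed

lemma measure_open_ends:
  assumes "{a<..<b::real} \<subseteq> J" "J \<subseteq> {a..b}" "a < b"
  shows "emeasure lebesgue J = ennreal (b - a)" "measure lebesgue J = b - a"
proof -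
  have J: "J \<in> sets lebesgue"
    using between_open_closed_sets[OF assms(1,2)] by simp
  have "emeasure lebesgue J = emeasure lebesgue {a<..<b}"
    by (rule emeasure_eq_AE) (use AE_open_ends[OF assms(1,2)] J in auto)
  then show 1: "emeasure lebesgue J = ennreal (b - a)"
    using assms by simp
  then show "measure lebesgue J = b - a"
    using assms by (simp add: measure_def)
qed

lemma avg_open_ends:
  assumes "{a<..<b::real} \<subseteq> J" "J \<subseteq> {a..b}" "a < b"
  shows "avg J f = set_lebesgue_integral lebesgue {a<..<b} f / (b - a)"
  unfolding avg_def set_integral_open_ends[OF assms(1,2)] measure_open_ends[OF assms] ..

lemma nn_avg_open_ends:
  assumes "{a<..<b::real} \<subseteq> J" "J \<subseteq> {a..b}" "a < b"
  shows "nn_avg J f = (\<integral>\<^sup>+x\<in>{a<..<b}. ennreal (f x) \<partial>lebesgue) / ennreal (b - a)"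
proof -
  have "(\<integral>\<^sup>+x\<in>J. ennreal (f x) \<partial>lebesgue) = (\<integral>\<^sup>+x\<in>{a<..<b}. ennreal (f x) \<partial>lebesgue)"
    by (rule nn_integral_cong_AE) (use AE_open_ends[OF assms(1,2)] in \<open>eventually_elim; auto simp: indicator_def\<close>)
  then show ?thesis
    by (simp add: nn_avg_def measure_open_ends[OF assms])
qed

text \<open>Endpoints are null sets, so averages and integrability only see the interior of
  \<open>J\<close>. Through this case rule, statements about subintervals are reduced to open
  intervals.\<close>

lemma subintervals_cases:
  assumes "J \<in> subintervals X"
  obtains a b where "a < b" "{a<..<b} \<subseteq> J" "J \<subseteq> {a..b}" "{a<..<b} \<in> subintervals X"
    "\<And>f. avg J f = avg {a<..<b} f" "\<And>f. nn_avg J f = nn_avg {a<..<b} f"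
    "\<And>f. set_integrable lebesgue J f = set_integrable lebesgue {a<..<b} (f :: real \<Rightarrow> real)"
proof -
  obtain a b where ab: "a < b" "{a<..<b} \<subseteq> J" "J \<subseteq> {a..b}"
    using assms bounded_interval_endpoints[of J] by (auto simp: subintervals_def)
  have "{a<..<b} \<in> subintervals X"
    using assms ab bounded_interval_open[of a b] by (auto simp: subintervals_def)
  moreover have "{a<..<b} \<subseteq> {a..b}"
    by auto
  ultimately show ?thesis
    using that[of a b] ab avg_open_ends[of a b J] nn_avg_open_ends[of a b J]
       avg_open_ends[of a b "{a<..<b}"] nn_avg_open_ends[of a b "{a<..<b}"]
       set_integrable_open_ends[of a b J] by auto
qed

lemma loc_integrableI:
  assumes "\<And>a b. a < b \<Longrightarrow> {a<..<b} \<subseteq> X \<Longrightarrow> set_integrable lebesgue {a<..<b} f"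
  shows "loc_integrable X f"
  unfolding loc_integrable_def
proof
  fix J assume "J \<in> subintervals X"
  then show "set_integrable lebesgue J f"
    by (rule subintervals_cases) (use assms in \<open>auto simp: subintervals_def\<close>)
qed

lemma loc_integrableD:
  "loc_integrable X f \<Longrightarrow> a < b \<Longrightarrow> {a<..<b} \<subseteq> X \<Longrightarrow> set_integrable lebesgue {a<..<b} f"
  using bounded_interval_open[of a b] by (auto simp: loc_integrable_def subintervals_def)

section \<open>Affine changes of variable\<close>

lemma indicator_affine_interval:
  "s > 0 \<Longrightarrow> indicator {t + s * c<..<t + s * d} (t + s * x) = indicator {c<..<d::real} x"
  by (auto simp: indicator_def)

lemma set_integrable_affine:
  fixes f :: "real \<Rightarrow> real"
  assumes "s > 0"
  shows "set_integrable lebesgue {t + s * c<..<t + s * d} f \<longleftrightarrow>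
    set_integrable lebesgue {c<..<d} (\<lambda>x. f (t + s * x))"
proof -
  have "integrable lebesgue (\<lambda>x. indicat_real {t + s * c<..<t + s * d} (t + s * x) *\<^sub>R f (t + s * x)) \<longleftrightarrow>
    integrable lebesgue (\<lambda>x. indicat_real {t + s * c<..<t + s * d} x *\<^sub>R f x)"
    by (rule lebesgue_integrable_real_affine_iff) (use assms in simp)
  then show ?thesis
    unfolding set_integrable_def indicator_affine_interval[OF assms] ..
qed

lemma set_integral_affine:
  fixes f :: "real \<Rightarrow> real"
  assumes "s > 0"
  shows "set_lebesgue_integral lebesgue {t + s * c<..<t + s * d} f =
    s * set_lebesgue_integral lebesgue {c<..<d} (\<lambda>x. f (t + s * x))"
  unfolding set_lebesgue_integral_def
  using lebesgue_integral_real_affine[of s "\<lambda>x. indicat_real {t + s * c<..<t + s * d} x *\<^sub>R f x" t] assms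
  by (simp add: indicator_affine_interval)

lemma set_nn_integral_affine:
  fixes f :: "real \<Rightarrow> real"
  assumes "s > 0" and m: "set_borel_measurable lebesgue {t + s * c<..<t + s * d} f"
  shows "(\<integral>\<^sup>+x\<in>{t + s * c<..<t + s * d}. ennreal (f x) \<partial>lebesgue) =
    ennreal s * (\<integral>\<^sup>+x\<in>{c<..<d}. ennreal (f (t + s * x)) \<partial>lebesgue)"
proof -
  have eq: "ennreal (f x) * indicator {t + s * c<..<t + s * d} x =
    ennreal (indicat_real {t + s * c<..<t + s * d} x * f x)" for x
    by (auto simp: indicator_def)
  have "(\<integral>\<^sup>+x. ennreal (f x) * indicator {t + s * c<..<t + s * d} x \<partial>lebesgue) =
    ennreal \<bar>s\<bar> * (\<integral>\<^sup>+x. ennreal (f (t + s * x)) * indicator {t + s * c<..<t + s * d} (t + s * x) \<partial>lebesgue)"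
    by (rule nn_integral_real_affine_lebesgue)
      (use m assms in \<open>auto simp: eq set_borel_measurable_def\<close>)
  then show ?thesis
    using assms by (simp add: indicator_affine_interval)
qed

lemma avg_affine:
  assumes "s > 0" "c < d"
  shows "avg {t + s * c<..<t + s * d} f = avg {c<..<d} (\<lambda>x. f (t + s * x))"
proof -
  have "t + s * c < t + s * d"
    using assms by simp
  then show ?thesis
    using assms unfolding avg_def set_integral_affine[OF assms(1)]
    by (simp add: right_diff_distrib[symmetric])
qed

lemma nn_avg_affine:
  assumes "s > 0" "c < d" and m: "set_borel_measurable lebesgue {t + s * c<..<t + s * d} f"
  shows "nn_avg {t + s * c<..<t + s * d} f = nn_avg {c<..<d} (\<lambda>x. f (t + s * x))"
proof -
  have "t + s * c < t + s * d"
    using assms by simp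
  then have "emeasure lebesgue {t + s * c<..<t + s * d} = ennreal s * emeasure lebesgue {c<..<d}"
    using assms by (simp add: right_diff_distrib[symmetric] ennreal_mult)
  then show ?thesis
    unfolding nn_avg_def set_nn_integral_affine[OF assms(1,3)]
    using assms by (simp add: ennreal_mult_divide_eq divide_ennreal_def ennreal_inverse_mult ennreal_mult_eq_top_iff)
      (metis (no_types, lifting) divide_ennreal_def ennreal_neq_top ennreal_eq_0_iff ennreal_times_divide mult.commute
        mult.left_commute mult_divide_eq_ennreal not_le)
qed

lemma set_borel_measurable_iff_lebesgue_on:
  fixes f :: "real \<Rightarrow> real"
  assumes "A \<in> sets lebesgue"
  shows "set_borel_measurable lebesgue A f \<longleftrightarrow> f \<in> borel_measurable (lebesgue_on A)"
  using borel_measurable_restrict_space_iff[of A lebesgue f] assms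
  by (simp add: set_borel_measurable_def)

lemma set_borel_measurable_compose:
  fixes f :: "real \<Rightarrow> real" and h :: "real \<Rightarrow> real"
  assumes "A \<in> sets lebesgue" "set_borel_measurable lebesgue A f" "h \<in> borel_measurable borel"
  shows "set_borel_measurable lebesgue A (\<lambda>x. h (f x))"
  using assms by (auto simp: set_borel_measurable_iff_lebesgue_on intro: measurable_compose)

lemma set_integrable_measurable:
  "set_integrable lebesgue A f \<Longrightarrow> set_borel_measurable lebesgue A (f :: real \<Rightarrow> real)"
  by (auto simp: set_integrable_def set_borel_measurable_def)

lemma set_integrable_const_interval: "set_integrable lebesgue {a<..<b::real} (\<lambda>_. c :: real)"
  unfolding set_integrable_def by (intro integrable_scaleR_left integrable_real_indicator) (cases "a \<le> b"; auto)+

section \<open>The lower bound for the distance to bounded functions\<close>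

lemma ennreal_powr_le_iff:
  assumes "0 < p" "0 \<le> e"
  shows "ennreal_powr x (1 / p) \<le> ennreal e \<longleftrightarrow> x \<le> ennreal (e powr p)"
proof (cases x)
  case (real r)
  have "r powr (1 / p) \<le> e \<longleftrightarrow> r \<le> e powr p"
  proof
    assume "r powr (1 / p) \<le> e"
    then have "(r powr (1 / p)) powr p \<le> e powr p"
      using assms by (intro powr_mono2) auto
    then show "r \<le> e powr p"
      using assms real by (simp add: powr_powr)
  next
    assume "r \<le> e powr p"
    then have "r powr (1 / p) \<le> (e powr p) powr (1 / p)"
      using assms real by (intro powr_mono2) auto
    then show "r powr (1 / p) \<le> e"
      using assms by (simp add: powr_powr)
  qed
  then show ?thesis
    using real assms by (simp add: ennreal_powr_def)
qed (auto simp: ennreal_powr_def top_unique)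

lemma bmo_norm_le_iff:
  assumes "0 < p" "0 \<le> e"
  shows "bmo_norm p X f \<le> ennreal e \<longleftrightarrow>
    (\<forall>J\<in>subintervals X. nn_avg J (\<lambda>x. \<bar>f x - avg J f\<bar> powr p) \<le> ennreal (e powr p))"
  by (simp add: bmo_norm_def SUP_le_iff ennreal_powr_le_iff[OF assms])

lemma bmo_norm_le_openI:
  assumes "0 < p" "0 \<le> e"
    and "\<And>a b. a < b \<Longrightarrow> {a<..<b} \<subseteq> X \<Longrightarrow>
      nn_avg {a<..<b} (\<lambda>x. \<bar>f x - avg {a<..<b} f\<bar> powr p) \<le> ennreal (e powr p)"
  shows "bmo_norm p X f \<le> ennreal e"
  unfolding bmo_norm_le_iff[OF assms(1,2)]
proof
  fix J assume "J \<in> subintervals X"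
  then show "nn_avg J (\<lambda>x. \<bar>f x - avg J f\<bar> powr p) \<le> ennreal (e powr p)"
    by (rule subintervals_cases) (use assms(3) in \<open>auto simp: subintervals_def\<close>)
qed

lemma loc_integrable_affine:
  assumes f: "loc_integrable X f" and s: "s > 0" and sub: "{t<..<t + s} \<subseteq> X"
  shows "loc_integrable {0<..<1} (\<lambda>x. f (t + s * x))"
proof (rule loc_integrableI)
  fix a b :: real assume ab: "a < b" "{a<..<b} \<subseteq> {0<..<1}"
  then have "0 \<le> a" "b \<le> 1"
    by (auto simp: greaterThanLessThan_subseteq_greaterThanLessThan)
  then have "{t + s * a<..<t + s * b} \<subseteq> {t<..<t + s}"
    using s ab by (auto simp: greaterThanLessThan_subseteq_greaterThanLessThan)
  then show "set_integrable lebesgue {a<..<b} (\<lambda>x. f (t + s * x))"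
    using f s sub ab by (auto simp flip: set_integrable_affine[OF s] intro!: loc_integrableD)
qed

text \<open>An affine map carries subintervals of (0,1) to subintervals of \<open>X\<close> and
  preserves averages, so the left supremum runs over part of the family on the right.\<close>

lemma bmo_norm_affine_le:
  assumes f: "loc_integrable X f" and s: "s > 0" and sub: "{t<..<t + s} \<subseteq> X"
  shows "bmo_norm p {0<..<1} (\<lambda>x. f (t + s * x)) \<le> bmo_norm p X f"
  unfolding bmo_norm_def[of p "{0<..<1}"]
proof (rule SUP_least)
  let ?f = "\<lambda>x. f (t + s * x)"
  fix J :: "real set" assume "J \<in> subintervals {0<..<1}"
  then obtain a b where ab: "a < b" "{a<..<b} \<in> subintervals {0<..<1}"
    and eq: "\<And>f. avg J f = avg {a<..<b} f" "\<And>f. nn_avg J f = nn_avg {a<..<b} f"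
    by (metis subintervals_cases)
  then have "{a<..<b} \<subseteq> {0<..<1}"
    by (simp add: subintervals_def)
  then have "0 \<le> a" "b \<le> 1"
    using ab(1) by (auto simp: greaterThanLessThan_subseteq_greaterThanLessThan)
  define K where "K = {t + s * a<..<t + s * b}"
  have "K \<subseteq> {t<..<t + s}"
    unfolding K_def using s ab \<open>0 \<le> a\<close> \<open>b \<le> 1\<close>
    by (auto simp: greaterThanLessThan_subseteq_greaterThanLessThan)
  then have K: "K \<in> subintervals X"
    using s sub ab bounded_interval_open[of "t + s * a" "t + s * b"] by (auto simp: K_def subintervals_def)
  then have "set_integrable lebesgue K f"
    using f by (simp add: loc_integrable_def)
  then have m: "set_borel_measurable lebesgue K (\<lambda>x. \<bar>f x - avg K f\<bar> powr p)"
    by (intro set_borel_measurable_compose[where h="\<lambda>y. \<bar>y - avg K f\<bar> powr p"] set_integrable_measurable)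
      (auto simp: K_def)
  have "nn_avg J (\<lambda>x. \<bar>?f x - avg J ?f\<bar> powr p) = nn_avg K (\<lambda>x. \<bar>f x - avg K f\<bar> powr p)"
    unfolding eq K_def using nn_avg_affine[OF s ab(1) m[unfolded K_def]]
    by (simp add: avg_affine[OF s ab(1)])
  then show "ennreal_powr (nn_avg J (\<lambda>x. \<bar>?f x - avg J ?f\<bar> powr p)) (1 / p) \<le> bmo_norm p X f"
    unfolding bmo_norm_def by (intro SUP_upper2[OF K]) simp
qed

lemma avg_cmult: "avg J (\<lambda>x. c * f x) = c * avg J f"
  by (simp add: avg_def)

lemma bmo_norm_cmult_le:
  assumes "0 < p" "0 \<le> e" and f: "loc_integrable X f" and le: "bmo_norm p X f \<le> ennreal e"
  shows "bmo_norm p X (\<lambda>x. c * f x) \<le> ennreal (\<bar>c\<bar> * e)"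
proof (rule bmo_norm_le_openI)
  fix a b :: real assume ab: "a < b" "{a<..<b} \<subseteq> X"
  let ?J = "{a<..<b}" and ?g = "\<lambda>x. \<bar>f x - avg {a<..<b} f\<bar> powr p"
  have "set_borel_measurable lebesgue ?J ?g"
    using loc_integrableD[OF f ab]
    by (intro set_borel_measurable_compose[where h="\<lambda>y. \<bar>y - avg ?J f\<bar> powr p"] set_integrable_measurable) auto
  then have m: "(\<lambda>x. ennreal (?g x) * indicator ?J x) \<in> borel_measurable lebesgue"
    unfolding set_borel_measurable_def
    by (subst measurable_cong[where g="\<lambda>x. ennreal (indicator ?J x *\<^sub>R ?g x)"]) (auto simp: indicator_def)
  have "\<bar>c * f x - avg ?J (\<lambda>x. c * f x)\<bar> powr p = \<bar>c\<bar> powr p * ?g x" for x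
    by (simp add: avg_cmult abs_mult powr_mult flip: right_diff_distrib)
  then have "nn_avg ?J (\<lambda>x. \<bar>c * f x - avg ?J (\<lambda>x. c * f x)\<bar> powr p) = ennreal (\<bar>c\<bar> powr p) * nn_avg ?J ?g"
    using m by (simp add: nn_avg_def ennreal_mult mult.assoc nn_integral_cmult ennreal_times_divide)
  also have "\<dots> \<le> ennreal (\<bar>c\<bar> powr p) * ennreal (e powr p)"
    using le ab bounded_interval_open[OF ab(1)] unfolding bmo_norm_le_iff[OF assms(1,2)]
    by (intro mult_left_mono) (auto simp: subintervals_def)
  also have "\<dots> = ennreal ((\<bar>c\<bar> * e) powr p)"
    using assms by (simp add: powr_mult ennreal_mult)
  finally show "nn_avg ?J (\<lambda>x. \<bar>c * f x - avg ?J (\<lambda>x. c * f x)\<bar> powr p) \<le> ennreal ((\<bar>c\<bar> * e) powr p)" .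
qed (use assms in auto)

lemma loc_integrable_cmult: "loc_integrable X f \<Longrightarrow> loc_integrable X (\<lambda>x. c * f x)"
  by (auto simp: loc_integrable_def)

lemma BMO_cmult:
  assumes "f \<in> BMO X"
  shows "(\<lambda>x. c * f x) \<in> BMO X"
proof -
  obtain e where "bmo_norm 1 X f = ennreal e" "0 \<le> e"
    using assms by (cases "bmo_norm 1 X f") (auto simp: BMO_def)
  then show ?thesis
    using assms bmo_norm_cmult_le[of 1 e X f c] loc_integrable_cmult[of X f c]
    by (auto simp: BMO_def intro: order_le_less_trans)
qed

section \<open>Bounded functions and bounded perturbations\<close>

lemma Linf_bound:
  assumes "f \<in> Linf X"
  obtains M where "0 \<le> M" "AE x in lebesgue. x \<in> X \<longrightarrow> \<bar>f x\<bar> \<le> M"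
proof -
  obtain M where "AE x in lebesgue. x \<in> X \<longrightarrow> \<bar>f x\<bar> \<le> M"
    using assms by (auto simp: Linf_def)
  then have "AE x in lebesgue. x \<in> X \<longrightarrow> \<bar>f x\<bar> \<le> max M 0"
    by eventually_elim auto
  then show ?thesis
    using that[of "max M 0"] by auto
qed

lemma Linf_set_integrable:
  assumes "f \<in> Linf X" "{a<..<b} \<subseteq> X"
  shows "set_integrable lebesgue {a<..<b} f"
proof -
  obtain M where M: "0 \<le> M" "AE x in lebesgue. x \<in> X \<longrightarrow> \<bar>f x\<bar> \<le> M"
    using Linf_bound[OF assms(1)] .
  have "(\<lambda>x. indicat_real X x *\<^sub>R f x) \<in> borel_measurable lebesgue"
    using assms(1) unfolding Linf_def set_borel_measurable_def by simp
  then have "(\<lambda>x. indicat_real {a<..<b} x *\<^sub>R (indicat_real X x *\<^sub>R f x)) \<in> borel_measurable lebesgue"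
    by (rule borel_measurable_scaleR[OF borel_measurable_indicator, rotated]) simp
  then have m: "(\<lambda>x. indicat_real {a<..<b} x *\<^sub>R f x) \<in> borel_measurable lebesgue"
    by (rule measurable_cong[THEN iffD1, rotated]) (use assms in \<open>auto simp: indicator_def\<close>)
  show ?thesis
    unfolding set_integrable_def
  proof (rule Bochner_Integration.integrable_bound[OF _ m])
    show "integrable lebesgue (\<lambda>x. indicat_real {a<..<b} x *\<^sub>R M)"
      using set_integrable_const_interval by (simp add: set_integrable_def)
    show "AE x in lebesgue. norm (indicat_real {a<..<b} x *\<^sub>R f x) \<le> norm (indicat_real {a<..<b} x *\<^sub>R M)"
      using M(2) by eventually_elim (use assms M(1) in \<open>auto simp: indicator_def\<close>)
  qed
qed

lemma avg_mono_AE: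
  assumes "a < b" "set_integrable lebesgue {a<..<b} f" "set_integrable lebesgue {a<..<b} g"
    "AE x in lebesgue. x \<in> {a<..<b} \<longrightarrow> f x \<le> g x"
  shows "avg {a<..<b} f \<le> avg {a<..<b} g"
  unfolding avg_def using assms by (intro divide_right_mono set_integral_mono_AE) auto

lemma avg_const: "a < b \<Longrightarrow> avg {a<..<b} (\<lambda>_. c) = c"
  by (simp add: avg_def set_integral_const)

lemma avg_abs_le_AE:
  assumes "a < b" "set_integrable lebesgue {a<..<b} f"
    "AE x in lebesgue. x \<in> {a<..<b} \<longrightarrow> \<bar>f x\<bar> \<le> M"
  shows "\<bar>avg {a<..<b} f\<bar> \<le> M"
proof -
  have c: "set_integrable lebesgue {a<..<b} (\<lambda>_. c :: real)" for c
    by (rule set_integrable_const_interval)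
  have "avg {a<..<b} f \<le> avg {a<..<b} (\<lambda>_. M)"
    by (rule avg_mono_AE[OF assms(1,2) c]) (use assms(3) in \<open>eventually_elim; auto\<close>)
  moreover have "avg {a<..<b} (\<lambda>_. - M) \<le> avg {a<..<b} f"
    by (rule avg_mono_AE[OF assms(1) c assms(2)]) (use assms(3) in \<open>eventually_elim; auto\<close>)
  ultimately show ?thesis
    by (simp add: avg_const[OF assms(1)] abs_le_iff)
qed

lemma avg_diff:
  assumes "set_integrable lebesgue J f" "set_integrable lebesgue J g"
  shows "avg J (\<lambda>x. f x - g x) = avg J f - avg J g"
  unfolding avg_def using assms by (simp add: diff_divide_distrib)

lemma nn_avg_mono_AE:
  assumes "AE x in lebesgue. x \<in> {a<..<b} \<longrightarrow> f x \<le> g x"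
  shows "nn_avg {a<..<b} f \<le> nn_avg {a<..<b} g"
  unfolding nn_avg_def
  by (intro divide_right_mono_ennreal nn_integral_mono_AE)
    (use assms in \<open>eventually_elim; auto simp: indicator_def intro: ennreal_leI\<close>)

lemma BMO_diff_Linf:
  assumes \<phi>: "\<phi> \<in> BMO X" and f: "f \<in> Linf X"
  shows "(\<lambda>x. \<phi> x - f x) \<in> BMO X"
proof -
  have l\<phi>: "loc_integrable X \<phi>"
    using \<phi> by (simp add: BMO_def)
  obtain e where e: "bmo_norm 1 X \<phi> \<le> ennreal e" "0 \<le> e"
    using \<phi> by (cases "bmo_norm 1 X \<phi>") (auto simp: BMO_def)
  obtain M where M: "0 \<le> M" "AE x in lebesgue. x \<in> X \<longrightarrow> \<bar>f x\<bar> \<le> M"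
    using Linf_bound[OF f] .
  \<comment> \<open>In \<open>2 * M\<close>, one \<open>M\<close> bounds \<open>f\<close> itself and
    the other its average over the interval.\<close>
  have "bmo_norm 1 X (\<lambda>x. \<phi> x - f x) \<le> ennreal (e + 2 * M)"
  proof (rule bmo_norm_le_openI)
    fix a b :: real assume ab: "a < b" "{a<..<b} \<subseteq> X"
    let ?J = "{a<..<b}"
    have i: "set_integrable lebesgue ?J \<phi>" "set_integrable lebesgue ?J f"
      using loc_integrableD[OF l\<phi> ab] Linf_set_integrable[OF f ab(2)] by auto
    have AE: "AE x in lebesgue. x \<in> ?J \<longrightarrow> \<bar>f x\<bar> \<le> M"
      using M(2) by eventually_elim (use ab in auto)
    have av: "\<bar>avg ?J f\<bar> \<le> M"
      by (rule avg_abs_le_AE[OF ab(1) i(2) AE])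
    have m: "(\<lambda>x. ennreal (\<bar>\<phi> x - avg ?J \<phi>\<bar>) * indicator ?J x) \<in> borel_measurable lebesgue"
    proof -
      have "set_borel_measurable lebesgue ?J (\<lambda>x. \<bar>\<phi> x - avg ?J \<phi>\<bar>)"
        using i(1)
        by (intro set_borel_measurable_compose[where h="\<lambda>y. \<bar>y - avg ?J \<phi>\<bar>"] set_integrable_measurable) auto
      then show ?thesis
        unfolding set_borel_measurable_def
        by (subst measurable_cong[where g="\<lambda>x. ennreal (indicator ?J x *\<^sub>R \<bar>\<phi> x - avg ?J \<phi>\<bar>)"])
          (auto simp: indicator_def)
    qed
    have "nn_avg ?J (\<lambda>x. \<bar>\<phi> x - f x - avg ?J (\<lambda>x. \<phi> x - f x)\<bar> powr 1) \<le>
      nn_avg ?J (\<lambda>x. \<bar>\<phi> x - avg ?J \<phi>\<bar> + 2 * M)"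
      by (rule nn_avg_mono_AE) (use AE av in \<open>eventually_elim; auto simp: avg_diff[OF i]\<close>)
    also have "\<dots> = nn_avg ?J (\<lambda>x. \<bar>\<phi> x - avg ?J \<phi>\<bar>) + nn_avg ?J (\<lambda>x. 2 * M)"
    proof -
      have "(\<lambda>x. ennreal (2 * M) * indicator ?J x) \<in> borel_measurable lebesgue"
        by (intro borel_measurable_times_ennreal borel_measurable_const borel_measurable_indicator) simp
      then show ?thesis
        unfolding nn_avg_def using M(1) nn_integral_add[OF m]
        by (simp add: distrib_right add_divide_distrib_ennreal)
    qed
    also have "nn_avg ?J (\<lambda>x. 2 * M) = ennreal (2 * M)"
      unfolding nn_avg_def using ab M(1) by (simp add: nn_integral_cmult_indicator ennreal_mult_divide_eq)
    also have "nn_avg ?J (\<lambda>x. \<bar>\<phi> x - avg ?J \<phi>\<bar>) \<le> ennreal e"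
      using e(1) ab bounded_interval_open[OF ab(1)] e(2) unfolding bmo_norm_le_iff[OF zero_less_one e(2)]
      by (auto simp: subintervals_def)
    finally show "nn_avg ?J (\<lambda>x. \<bar>\<phi> x - f x - avg ?J (\<lambda>x. \<phi> x - f x)\<bar> powr 1) \<le> ennreal ((e + 2 * M) powr 1)"
      using e M by (auto simp: add_right_mono)
  qed (use e M in auto)
  moreover have "loc_integrable X (\<lambda>x. \<phi> x - f x)"
    by (rule loc_integrableI) (intro set_integral_diff loc_integrableD[OF l\<phi>] Linf_set_integrable[OF f])
  ultimately show ?thesis
    by (auto simp: BMO_def intro: order_le_less_trans)
qed

text \<open>Up to endpoints \<open>J\<close> is an affine image of (0,1), and the pulled-back
  function has norm at most that of \<psi>. This serves both directions: it makes a finite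
  \<open>JN_C\<close> usable on an arbitrary \<open>X\<close>, and it reduces an estimate of
  \<open>JN_C\<close> to the full unit interval.\<close>

lemma exp_bound_rescale:
  assumes unit: "\<And>\<phi>. \<phi> \<in> BMO {0<..<1} \<Longrightarrow> bmo_norm p {0<..<1} \<phi> \<le> ennreal \<delta> \<Longrightarrow>
      nn_avg {0<..<1} (\<lambda>x. exp (\<phi> x)) \<le> C * ennreal (exp (avg {0<..<1} \<phi>))"
    and \<psi>: "\<psi> \<in> BMO X" "bmo_norm p X \<psi> \<le> ennreal \<delta>" and J: "J \<in> subintervals X"
  shows "nn_avg J (\<lambda>x. exp (\<psi> x)) \<le> C * ennreal (exp (avg J \<psi>))"
proof -
  let ?U = "{0<..<1::real}"
  obtain a b where ab: "a < b" "{a<..<b} \<in> subintervals X"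
    and eq: "\<And>f. avg J f = avg {a<..<b} f" "\<And>f. nn_avg J f = nn_avg {a<..<b} f"
    using J by (metis subintervals_cases)
  let ?s = "b - a"
  let ?f = "\<lambda>x. \<psi> (a + ?s * x)"
  have s: "?s > 0"
    using ab by simp
  have sub: "{a<..<b} \<subseteq> X"
    using ab by (simp add: subintervals_def)
  have l: "loc_integrable X \<psi>"
    using \<psi> by (simp add: BMO_def)
  have "loc_integrable ?U ?f"
    using loc_integrable_affine[OF l s, of a] sub by simp
  moreover have le: "bmo_norm q ?U ?f \<le> bmo_norm q X \<psi>" for q
    using bmo_norm_affine_le[OF l s, of a] sub by simp
  ultimately have "?f \<in> BMO ?U"
    using \<psi>(1) by (auto simp: BMO_def intro: order_le_less_trans)
  then have "nn_avg ?U (\<lambda>x. exp (?f x)) \<le> C * ennreal (exp (avg ?U ?f))"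
    using unit le[of p] \<psi>(2) by (meson order_trans)
  moreover have "set_borel_measurable lebesgue {a<..<b} (\<lambda>x. exp (\<psi> x))"
    using loc_integrableD[OF l ab(1) sub]
    by (intro set_borel_measurable_compose[where h="exp"] set_integrable_measurable) auto
  ultimately show ?thesis
    using nn_avg_affine[OF s, of 0 1 a "\<lambda>x. exp (\<psi> x)"] avg_affine[OF s, of 0 1 a \<psi>]
    unfolding eq by simp
qed

text \<open>The infimum need not be attained, but any finite admissible value will do. As
  \<open>C\<close> is fixed before \<open>X\<close>, bounded intervals and the whole line are
  treated alike.\<close>

lemma JN_C_finite_bound:
  assumes fin: "JN_C \<delta> p < \<infinity>"
  obtains C where "0 \<le> C"
    "\<And>X \<psi> J. \<psi> \<in> BMO X \<Longrightarrow> bmo_norm p X \<psi> \<le> ennreal \<delta> \<Longrightarrow> J \<in> subintervals X \<Longrightarrow>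
      nn_avg J (\<lambda>x. exp (\<psi> x)) \<le> ennreal (C * exp (avg J \<psi>))"
proof -
  let ?U = "{0<..<1::real}"
  obtain C' where C': "C' < \<infinity>" and C'_le: "\<And>\<phi> J. \<phi> \<in> BMO ?U \<Longrightarrow> bmo_norm p ?U \<phi> \<le> ennreal \<delta> \<Longrightarrow> J \<in> subintervals ?U \<Longrightarrow>
      nn_avg J (\<lambda>x. exp (\<phi> x)) \<le> C' * ennreal (exp (avg J \<phi>))"
    using fin unfolding JN_C_def Inf_less_iff by blast
  have "?U \<in> subintervals ?U"
    using bounded_interval_open[of 0 1] by (simp add: subintervals_def)
  note rescale = exp_bound_rescale[OF C'_le[OF _ _ this]]
  obtain C where C: "C' = ennreal C" "0 \<le> C"
    using C' by (cases C') auto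
  show ?thesis
    using that[OF C(2)] rescale C by (simp add: ennreal_mult)
qed

text \<open>A bounded summand costs a factor \<open>exp M\<close> in the average of the weight and
  another in the average of its logarithm, hence \<open>C * exp (2 * M)\<close>. The assumed bound
  also supplies the local integrability of \<open>exp (\<psi> x)\<close>.\<close>

lemma exp_add_Linf_in_Ainf:
  assumes l: "loc_integrable X \<psi>" and f: "f \<in> Linf X" and C: "0 \<le> C"
    and le: "\<And>J. J \<in> subintervals X \<Longrightarrow> nn_avg J (\<lambda>x. exp (\<psi> x)) \<le> ennreal (C * exp (avg J \<psi>))"
  shows "(\<lambda>x. exp (\<psi> x + f x)) \<in> Ainf X"
proof -
  obtain M where M: "0 \<le> M" "AE x in lebesgue. x \<in> X \<longrightarrow> \<bar>f x\<bar> \<le> M"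
    using Linf_bound[OF f] .
  have e\<psi>: "set_integrable lebesgue {a<..<b} (\<lambda>x. exp (\<psi> x))
      \<and> avg {a<..<b} (\<lambda>x. exp (\<psi> x)) \<le> C * exp (avg {a<..<b} \<psi>)"
    if ab: "a < b" "{a<..<b} \<subseteq> X" for a b
  proof -
    let ?J = "{a<..<b}"
    have J: "?J \<in> subintervals X"
      using ab bounded_interval_open[OF ab(1)] by (simp add: subintervals_def)
    have m: "(\<lambda>x. indicat_real ?J x *\<^sub>R exp (\<psi> x)) \<in> borel_measurable lebesgue"
      using set_borel_measurable_compose[where h=exp, OF _ set_integrable_measurable[OF loc_integrableD[OF l ab]]]
      by (auto simp: set_borel_measurable_def)
    have eq: "(\<integral>\<^sup>+x\<in>?J. ennreal (exp (\<psi> x)) \<partial>lebesgue) = (\<integral>\<^sup>+x. ennreal (indicat_real ?J x *\<^sub>R exp (\<psi> x)) \<partial>lebesgue)"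
      by (intro nn_integral_cong) (auto simp: indicator_def)
    have "(\<integral>\<^sup>+x\<in>?J. ennreal (exp (\<psi> x)) \<partial>lebesgue) = nn_avg ?J (\<lambda>x. exp (\<psi> x)) * ennreal (b - a)"
      using ab unfolding nn_avg_def
      by (simp add: ennreal_divide_times ennreal_times_divide[symmetric] mult_divide_eq_ennreal)
    also have "\<dots> \<le> ennreal (C * exp (avg ?J \<psi>)) * ennreal (b - a)"
      by (rule mult_right_mono[OF le[OF J]]) simp
    finally have fin: "(\<integral>\<^sup>+x. ennreal (indicat_real ?J x *\<^sub>R exp (\<psi> x)) \<partial>lebesgue) \<le> ennreal (C * exp (avg ?J \<psi>) * (b - a))"
      using ab C unfolding eq by (simp add: ennreal_mult)
    have int: "integrable lebesgue (\<lambda>x. indicat_real ?J x *\<^sub>R exp (\<psi> x))"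
      by (rule integrableI_bounded[OF m]) (use fin in \<open>auto simp: top_unique less_top[symmetric]\<close>)
    have "(LINT x|lebesgue. indicat_real ?J x *\<^sub>R exp (\<psi> x)) \<le> C * exp (avg ?J \<psi>) * (b - a)"
      using fin ab C unfolding nn_integral_eq_integral[OF int AE_I2[OF mult_nonneg_nonneg[OF indicator_pos_le exp_ge_zero], unfolded real_scaleR_def[symmetric]]]
      by (simp add: ennreal_le_iff)
    then show ?thesis
      using int ab by (simp add: avg_def set_integrable_def set_lebesgue_integral_def divide_le_eq)
  qed
  have sum_int: "set_integrable lebesgue {a<..<b} (\<lambda>x. \<psi> x + f x)" if "a < b" "{a<..<b} \<subseteq> X" for a b
    using that by (intro set_integral_add loc_integrableD[OF l] Linf_set_integrable[OF f])
  have w: "set_integrable lebesgue {a<..<b} (\<lambda>x. exp (\<psi> x + f x))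
      \<and> avg {a<..<b} (\<lambda>x. exp (\<psi> x + f x)) \<le> exp M * avg {a<..<b} (\<lambda>x. exp (\<psi> x))"
    if ab: "a < b" "{a<..<b} \<subseteq> X" for a b
  proof -
    let ?J = "{a<..<b}"
    have AE: "AE x in lebesgue. x \<in> ?J \<longrightarrow> exp (\<psi> x + f x) \<le> exp M * exp (\<psi> x)"
      using M(2) by eventually_elim (use ab in \<open>auto simp: exp_add[symmetric]\<close>)
    have i: "set_integrable lebesgue ?J (\<lambda>x. exp M * exp (\<psi> x))"
      using e\<psi>[OF ab] by simp
    have m: "set_borel_measurable lebesgue ?J (\<lambda>x. exp (\<psi> x + f x))"
      using set_borel_measurable_compose[where h=exp, OF _ set_integrable_measurable[OF sum_int[OF ab]]]
      by auto
    have iw: "set_integrable lebesgue ?J (\<lambda>x. exp (\<psi> x + f x))"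
      by (rule set_integrable_bound[OF i m]) (use AE in \<open>eventually_elim; auto\<close>)
    then show ?thesis
      using avg_mono_AE[OF ab(1) iw i AE] by (simp add: avg_cmult)
  qed
  have "Ainf_const X (\<lambda>x. exp (\<psi> x + f x)) \<le> ennreal (C * exp (2 * M))"
    unfolding Ainf_const_def
  proof (rule SUP_least)
    fix J assume "J \<in> subintervals X"
    then obtain a b where ab: "a < b" "{a<..<b} \<in> subintervals X"
      and eq: "\<And>f. avg J f = avg {a<..<b} f"
      by (metis subintervals_cases)
    let ?J = "{a<..<b}"
    have sub: "?J \<subseteq> X"
      using ab by (simp add: subintervals_def)
    have AE: "AE x in lebesgue. x \<in> ?J \<longrightarrow> \<bar>f x\<bar> \<le> M"
      using M(2) by eventually_elim (use sub in auto)
    have av: "\<bar>avg ?J f\<bar> \<le> M"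
      by (rule avg_abs_le_AE[OF ab(1) Linf_set_integrable[OF f sub] AE])
    have "avg ?J (\<lambda>x. \<psi> x + f x) = avg ?J \<psi> + avg ?J f"
      unfolding avg_def using loc_integrableD[OF l ab(1) sub] Linf_set_integrable[OF f sub]
      by (simp add: add_divide_distrib)
    then have "exp (- avg ?J (\<lambda>x. \<psi> x + f x)) \<le> exp (M - avg ?J \<psi>)"
      using av by simp
    moreover have "avg ?J (\<lambda>x. exp (\<psi> x + f x)) \<le> exp M * (C * exp (avg ?J \<psi>))"
      using w[OF ab(1) sub] e\<psi>[OF ab(1) sub] by (meson exp_ge_zero mult_left_mono order_trans)
    ultimately have "avg ?J (\<lambda>x. exp (\<psi> x + f x)) * exp (- avg ?J (\<lambda>x. \<psi> x + f x)) \<le>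
      (exp M * (C * exp (avg ?J \<psi>))) * exp (M - avg ?J \<psi>)"
      using C by (intro mult_mono) auto
    also have "\<dots> = C * exp (2 * M)"
      by (simp add: exp_diff field_simps exp_add[symmetric])
    finally show "ennreal (avg J (\<lambda>x. exp (\<psi> x + f x)) * exp (- avg J (\<lambda>x. ln (exp (\<psi> x + f x))))) \<le> ennreal (C * exp (2 * M))"
      by (simp add: eq ennreal_leI)
  qed
  then show ?thesis
    using w sum_int by (auto simp: Ainf_def intro!: loc_integrableI intro: order_le_less_trans)
qed

lemma Linf_cmult: "f \<in> Linf X \<Longrightarrow> (\<lambda>x. c * f x) \<in> Linf X"
proof -
  assume f: "f \<in> Linf X"
  obtain M where M: "0 \<le> M" "AE x in lebesgue. x \<in> X \<longrightarrow> \<bar>f x\<bar> \<le> M"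
    using Linf_bound[OF f] .
  have "AE x in lebesgue. x \<in> X \<longrightarrow> \<bar>c * f x\<bar> \<le> \<bar>c\<bar> * M"
    using M(2) by eventually_elim (auto simp: abs_mult intro: mult_left_mono)
  moreover have "(\<lambda>x. c * (indicat_real X x *\<^sub>R f x)) \<in> borel_measurable lebesgue"
    using f unfolding Linf_def set_borel_measurable_def by (intro borel_measurable_times) auto
  then have "set_borel_measurable lebesgue X (\<lambda>x. c * f x)"
    by (simp add: set_borel_measurable_def algebra_simps)
  ultimately show ?thesis
    by (auto simp: Linf_def)
qed

text \<open>If the inequality failed, some exponent above the minimum would still have a product
  with the norm below \<open>JN_const p\<close>. For such an exponent the exponentials with both
  signs lie in \<open>Ainf X\<close>, so it cannot exceed the minimum.\<close>

theorem distance_to_Linf_ge: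
  assumes p: "0 < p" and \<phi>: "\<phi> \<in> BMO X" and f: "f \<in> Linf X"
  shows "JN_const p / min (eps_Ainf X \<phi>) (eps_Ainf X (\<lambda>x. - \<phi> x)) \<le> bmo_norm p X (\<lambda>x. \<phi> x - f x)"
    (is "_ / ?m \<le> ?N")
proof (cases ?N)
  case (real n)
  have psi: "(\<lambda>x. \<phi> x - f x) \<in> BMO X"
    by (rule BMO_diff_Linf[OF \<phi> f])
  \<comment> \<open>\<epsilon> may be negative: the norm only sees
    \<open>\<bar>\<epsilon>\<bar>\<close>, and negative values provide the exponents of
    \<open>- \<phi>\<close>. This is where the minimum of both exponents comes from.\<close>
  have Ainf: "(\<lambda>x. exp (\<epsilon> * \<phi> x)) \<in> Ainf X" if lt: "ennreal (\<bar>\<epsilon>\<bar> * n) < JN_const p" for \<epsilon>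
  proof -
    have "JN_C (\<bar>\<epsilon>\<bar> * n) p < \<infinity>"
      using lt real(1) unfolding JN_const_def less_Sup_iff by auto
    then obtain C where C: "0 \<le> C" "\<And>X \<psi> J. \<psi> \<in> BMO X \<Longrightarrow> bmo_norm p X \<psi> \<le> ennreal (\<bar>\<epsilon>\<bar> * n) \<Longrightarrow> J \<in> subintervals X \<Longrightarrow>
      nn_avg J (\<lambda>x. exp (\<psi> x)) \<le> ennreal (C * exp (avg J \<psi>))"
      using JN_C_finite_bound[of "\<bar>\<epsilon>\<bar> * n" p] by blast
    let ?\<psi> = "\<lambda>x. \<epsilon> * (\<phi> x - f x)"
    have l: "loc_integrable X (\<lambda>x. \<phi> x - f x)"
      using psi by (simp add: BMO_def)
    have "?\<psi> \<in> BMO X"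
      by (rule BMO_cmult[OF psi])
    moreover have "bmo_norm p X ?\<psi> \<le> ennreal (\<bar>\<epsilon>\<bar> * n)"
      by (rule bmo_norm_cmult_le[OF p real(1) l]) (simp add: real(2))
    ultimately have "(\<lambda>x. exp (?\<psi> x + \<epsilon> * f x)) \<in> Ainf X"
      by (intro exp_add_Linf_in_Ainf[OF _ Linf_cmult[OF f] C(1)] C(2) loc_integrable_cmult l)
    then show ?thesis
      by (simp add: algebra_simps)
  qed
  have eps: "ennreal \<epsilon> \<le> ?m" if "0 < \<epsilon>" "ennreal (\<epsilon> * n) < JN_const p" for \<epsilon>
    using that Ainf[of \<epsilon>] Ainf[of "- \<epsilon>"] unfolding eps_Ainf_def
    by (auto intro!: Sup_upper)
  show ?thesis
  proof (rule ccontr)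
    assume "\<not> JN_const p / ?m \<le> ?N"
    then have n: "ennreal n < JN_const p / ?m"
      using real(2) by (simp add: not_le)
    \<comment> \<open>An infinite minimum would make the quotient \<open>0\<close>, which is not
      above \<open>n\<close>.\<close>
    then obtain \<mu> where \<mu>: "?m = ennreal \<mu>" "0 \<le> \<mu>"
      by (cases ?m) auto
    have "ennreal (n * \<mu>) < JN_const p"
    proof (cases "\<mu> = 0")
      case True
      then show ?thesis
        using n \<mu>(1) by (cases "JN_const p = 0") (auto simp: zero_less_iff_neq_zero)
    next
      case False
      have "\<not> JN_const p \<le> ennreal (n * \<mu>)"
      proof
        assume "JN_const p \<le> ennreal (n * \<mu>)"
        then have "JN_const p / ?m \<le> ennreal (n * \<mu>) / ennreal \<mu>"
          unfolding \<mu>(1) by (rule divide_right_mono_ennreal)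
        also have "\<dots> = ennreal n"
          using \<mu> False real(1) by (simp add: divide_ennreal)
        finally show False
          using n by simp
      qed
      then show ?thesis
        by simp
    qed
    then obtain j' where j': "ennreal (n * \<mu>) < j'" "j' < JN_const p"
      using dense by blast
    then obtain j where j: "j' = ennreal j" "0 \<le> j"
      by (cases j') auto
    have nj: "n * \<mu> < j"
      using j'(1) j by (simp add: ennreal_less_iff \<mu> real(1))
    \<comment> \<open>For \<open>n = 0\<close> any exponent beyond \<open>\<mu>\<close> works;
      otherwise \<open>j / n\<close> exceeds \<open>\<mu>\<close> because
      \<open>n * \<mu> < j\<close>. Working with the real number \<open>j\<close> covers an infinite
      \<open>JN_const p\<close> as well.\<close>
    define \<epsilon> where "\<epsilon> = (if n = 0 then \<mu> + 1 else j / n)"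
    have "\<mu> < \<epsilon>"
      using nj real(1) by (auto simp: \<epsilon>_def field_simps)
    moreover have "\<epsilon> * n \<le> j"
      using nj j by (auto simp: \<epsilon>_def)
    then have "ennreal (\<epsilon> * n) < JN_const p"
      using j'(2) j by (metis ennreal_leI order_le_less_trans)
    ultimately show False
      using eps[of \<epsilon>] \<mu> by (auto simp: ennreal_le_iff)
  qed
qed auto

section \<open>The rising sun lemma\<close>

text \<open>An endpoint lying in \<open>E\<close> could be added to \<open>C\<close> without losing
  connectedness, against the maximality of a component.\<close>

lemma open_interval_of_component:
  fixes E :: "real set"
  assumes "open E" "C \<in> components E" "bounded E"
  obtains a b where "a < b" "C = {a<..<b}" "a \<notin> E" "b \<notin> E"
proof -
  have C: "open C" "connected C" "C \<noteq> {}" "C \<subseteq> E"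
    using assms open_components in_components_connected in_components_nonempty in_components_subset by metis+
  have bd: "bounded C"
    using assms(3) C(4) bounded_subset by blast
  then have ba: "bdd_above C" and bb: "bdd_below C"
    by (auto simp: bounded_imp_bdd_above bounded_imp_bdd_below)
  let ?a = "Inf C" and ?b = "Sup C"
  have a: "?a \<notin> C"
  proof
    assume "?a \<in> C"
    then obtain e where "e > 0" "ball ?a e \<subseteq> C"
      using C(1) openE by blast
    then have "?a - e / 2 \<in> C"
      by (auto simp: subset_iff dist_real_def)
    then show False
      using cInf_lower[OF _ bb, of "?a - e / 2"] \<open>e > 0\<close> by simp
  qed
  have b: "?b \<notin> C"
  proof
    assume "?b \<in> C"
    then obtain e where "e > 0" "ball ?b e \<subseteq> C"
      using C(1) openE by blast
    then have "?b + e / 2 \<in> C"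
      by (auto simp: subset_iff dist_real_def)
    then show False
      using cSup_upper[OF _ ba, of "?b + e / 2"] \<open>e > 0\<close> by simp
  qed
  have iv: "is_interval C"
    using C(2) by (simp add: is_interval_connected_1)
  have eq: "C = {?a<..<?b}"
  proof (intro equalityI subsetI)
    fix x assume x: "x \<in> C"
    then show "x \<in> {?a<..<?b}"
      using cInf_lower[OF x bb] cSup_upper[OF x ba] a b by (auto simp: less_le)
  next
    fix x assume x: "x \<in> {?a<..<?b}"
    obtain y where y: "y \<in> C" "y < x"
      using x cInf_less_iff[OF C(3) bb] by auto
    obtain z where z: "z \<in> C" "x < z"
      using x less_cSup_iff[OF C(3) ba] by auto
    show "x \<in> C"
      using iv y z by (meson is_interval_1 less_imp_le)
  qed
  then have ab: "?a < ?b"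
    using C(3) by (metis greaterThanLessThan_empty_iff not_le)
  have clos: "x \<notin> E" if "x \<in> {?a..?b}" "x \<notin> C" for x
  proof
    assume "x \<in> E"
    have "connected (insert x C)"
    proof (rule connected_intermediate_closure[OF C(2)])
      have "closure C = {?a..?b}"
        using eq ab closure_greaterThanLessThan[of ?a ?b] by simp
      then show "insert x C \<subseteq> closure C"
        using that(1) closure_subset[of C] by simp
    qed auto
    moreover have "insert x C \<subseteq> E"
      using C(4) \<open>x \<in> E\<close> by simp
    ultimately have "insert x C \<subseteq> C"
      using components_maximal[OF assms(2), of "insert x C"] C(3) by auto
    then show False
      using that by simp
  qed
  show ?thesis
    using that[OF ab eq] clos[of ?a] clos[of ?b] a b ab by auto
qed

text \<open>For x in (a,b), a maximum of \<open>F\<close> over [x,1] is not attained before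
  \<open>b\<close>, as points of \<open>E\<close> see larger values to their right. Hence
  \<open>F b < F x\<close> would put \<open>b\<close> itself into \<open>E\<close>; so
  \<open>F\<close> is at most \<open>F b\<close> on (a,b) and, by continuity, at \<open>a\<close>.
  Conversely \<open>a\<close> sees nothing larger to its right, being outside \<open>E\<close> or
  equal to \<open>\<beta>\<close>.\<close>

lemma rising_sun_component:
  fixes F :: "real \<Rightarrow> real"
  assumes cont: "continuous_on {0..1} F" and \<beta>: "0 \<le> \<beta>" "\<And>x. \<beta> < x \<Longrightarrow> x \<le> 1 \<Longrightarrow> F x \<le> F \<beta>"
    and E_def: "E = {x\<in>{\<beta><..<1}. \<exists>y>x. y \<le> 1 \<and> F x < F y}"
    and ab: "a < b" "{a<..<b} \<subseteq> E" "a \<notin> E" "b \<notin> E"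
  shows "\<beta> \<le> a" "b \<le> 1" "F a = F b"
proof -
  have "{a<..<b} \<subseteq> {\<beta><..<1}"
    using ab E_def by auto
  then show ends: "\<beta> \<le> a" "b \<le> 1"
    using ab by (auto simp: greaterThanLessThan_subseteq_greaterThanLessThan)
  have "F x \<le> F b" if x: "x \<in> {a<..<b}" for x
  proof (rule ccontr)
    assume "\<not> F x \<le> F b"
    then have gt: "F b < F x"
      by simp
    have "continuous_on {x..1} F"
      by (rule continuous_on_subset[OF cont]) (use x ends \<beta> in auto)
    then obtain m where m: "m \<in> {x..1}" "\<And>y. y \<in> {x..1} \<Longrightarrow> F y \<le> F m"
      using continuous_attains_sup[of "{x..1}" F] x ends by force
    have "x \<in> E"
      using x ab by auto
    then obtain y where "y > x" "y \<le> 1" "F x < F y"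
      unfolding E_def by auto
    then have Fm: "F x < F m"
      using m(2)[of y] by auto
    have "b \<le> m"
    proof (rule ccontr)
      assume "\<not> b \<le> m"
      then have "m \<in> E"
        using m(1) x ab by auto
      then obtain z where "z > m" "z \<le> 1" "F m < F z"
        unfolding E_def by auto
      then show False
        using m(2)[of z] m(1) by auto
    qed
    then have "b < m"
      using gt Fm by (cases "b = m") auto
    then have "b \<in> E"
      unfolding E_def using gt Fm m(1) x ends by (auto intro!: exI[of _ m])
    then show False
      using ab by simp
  qed
  then have "F a \<le> F b"
    using continuous_le_on_closure[of "{a<..<b}" F a "F b"] continuous_on_subset[OF cont, of "{a..b}"] ab ends \<beta>
    by (auto simp: closure_greaterThanLessThan)
  moreover have "F b \<le> F a"
  proof (cases "a = \<beta>")
    case True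
    then show ?thesis
      using \<beta> ab ends by auto
  next
    case False
    then have "a \<in> {\<beta><..<1}"
      using ends ab by auto
    then show ?thesis
      using ab(1,3) ends unfolding E_def by force
  qed
  ultimately show "F a = F b"
    by simp
qed

lemma open_rising_set:
  fixes F :: "real \<Rightarrow> real"
  assumes cont: "continuous_on {0..1} F" and \<beta>: "0 \<le> \<beta>"
  shows "open {x\<in>{\<beta><..<1}. \<exists>y>x. y \<le> 1 \<and> F x < F y}"
proof -
  have "{x\<in>{\<beta><..<1}. \<exists>y>x. y \<le> 1 \<and> F x < F y} = (\<Union>y\<in>{\<beta>..1}. {x\<in>{\<beta><..<y}. F x < F y})"
    by force
  moreover have "open {x\<in>{\<beta><..<y}. F x < F y}" if "y \<in> {\<beta>..1}" for y
  proof -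
    have "continuous_on {\<beta><..<y} F"
      by (rule continuous_on_subset[OF cont]) (use that \<beta> in auto)
    then have "open ({\<beta><..<y} \<inter> F -` {..<F y})"
      by (rule continuous_open_preimage) auto
    moreover have "{\<beta><..<y} \<inter> F -` {..<F y} = {x\<in>{\<beta><..<y}. F x < F y}"
      by auto
    ultimately show ?thesis
      by simp
  qed
  ultimately show ?thesis
    by auto
qed

text \<open>Injectivity of \<open>to_nat_on\<close> makes each \<open>A n\<close> a single member of
  the family or empty, so finite families need no separate treatment.\<close>

lemma countable_disjoint_enumeration:
  fixes \<A> :: "'a set set"
  assumes "countable \<A>" "pairwise disjnt \<A>"
  obtains A :: "nat \<Rightarrow> 'a set" where "disjoint_family A" "range A \<subseteq> insert {} \<A>" "(\<Union>n. A n) = \<Union>\<A>"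
proof -
  define A where "A = (\<lambda>n. \<Union>{S\<in>\<A>. to_nat_on \<A> S = n})"
  have inj: "inj_on (to_nat_on \<A>) \<A>"
    by (rule inj_on_to_nat_on[OF assms(1)])
  have "A n \<in> insert {} \<A>" for n
  proof (cases "\<exists>S\<in>\<A>. to_nat_on \<A> S = n")
    case True
    then obtain S where S: "S \<in> \<A>" "to_nat_on \<A> S = n"
      by auto
    then have "{S\<in>\<A>. to_nat_on \<A> S = n} = {S}"
      using inj by (auto dest: inj_onD)
    then show ?thesis
      using S by (simp add: A_def)
  qed (auto simp: A_def)
  moreover have "disjoint_family A"
    unfolding disjoint_family_on_def
  proof (intro ballI impI equals0I)
    fix m n x assume "m \<noteq> n" "x \<in> A m \<inter> A n"
    then obtain S T where "S \<in> \<A>" "T \<in> \<A>" "S \<noteq> T" "x \<in> S" "x \<in> T"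
      by (auto simp: A_def)
    then show False
      using pairwiseD[OF assms(2), of S T] by (auto simp: disjnt_def)
  qed
  moreover have "(\<Union>n. A n) = \<Union>\<A>"
    by (auto simp: A_def)
  ultimately show ?thesis
    using that[of A] by auto
qed

text \<open>For the primitive \<open>F\<close> of \<open>f - c\<close>, an interval has average
  exactly \<open>c\<close> when \<open>F\<close> agrees at its two ends, which holds on the rising
  components. A point outside them has no larger value of \<open>F\<close> to its right, so
  differentiation from the right gives \<open>f x \<le> c\<close> there.\<close>

lemma rising_sun:
  fixes f :: "real \<Rightarrow> real"
  assumes int: "set_integrable lebesgue {0<..<1} f" and mean: "(LINT x:{0<..<1}|lebesgue. f x) \<le> c"
  obtains A :: "nat \<Rightarrow> real set"
  where "disjoint_family A"
    "\<And>n. A n = {} \<or> (\<exists>a b. 0 \<le> a \<and> a < b \<and> b \<le> 1 \<and> A n = {a<..<b} \<and>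
      (LINT x:{a<..<b}|lebesgue. f x) = c * (b - a))"
    "AE x in lebesgue. x \<in> {0<..<1} \<longrightarrow> x \<notin> (\<Union>n. A n) \<longrightarrow> f x \<le> c"
proof -
  \<comment> \<open>Extension by zero, so that the differentiation theorem for functions integrable
    over every interval applies.\<close>
  define h where "h = (\<lambda>x. indicator {0<..<1} x * (f x - c))"
  have fc: "set_integrable lebesgue {0<..<1} (\<lambda>x. f x - c)"
    by (intro set_integral_diff(1)[OF int] set_integrable_const_interval)
  then have hint: "integrable lebesgue h"
    by (simp add: set_integrable_def h_def)
  have h_on: "set_integrable lebesgue S h" if "S \<in> sets lebesgue" for S
    using integrable_mult_indicator[OF that hint] by (simp add: set_integrable_def)
  have hk: "h integrable_on {a..b}" for a b
    using h_on[of "{a..b}"] by (simp add: set_lebesgue_integral_eq_integral)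
  define F where "F = (\<lambda>x. integral {0..x} h)"
  have cont: "continuous_on {0..1} F"
    unfolding F_def by (rule indefinite_integral_continuous_1[OF hk])
  have diff: "integral {a..b} h = F b - F a" if "0 \<le> a" "a \<le> b" for a b
    using Henstock_Kurzweil_Integration.integral_combine[OF that hk] by (simp add: F_def)
  have Fab: "F b - F a = (LINT x:{a<..<b}|lebesgue. f x) - c * (b - a)" if ab: "0 \<le> a" "a < b" "b \<le> 1" for a b
  proof -
    have sub: "{a<..<b} \<subseteq> {0<..<1}"
      using ab by auto
    have "F b - F a = (LINT x:{a..b}|lebesgue. h x)"
      using diff ab h_on[of "{a..b}"] by (simp add: set_lebesgue_integral_eq_integral)
    also have "\<dots> = (LINT x:{a<..<b}|lebesgue. h x)"
      by (rule set_integral_open_ends) auto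
    also have "\<dots> = (LINT x:{a<..<b}|lebesgue. f x - c)"
      by (rule set_lebesgue_integral_cong) (use sub in \<open>auto simp: h_def\<close>)
    also have "\<dots> = (LINT x:{a<..<b}|lebesgue. f x) - (LINT x:{a<..<b}|lebesgue. c)"
      by (intro set_integral_diff(2) set_integrable_subset[OF int _ sub] set_integrable_const_interval) auto
    finally show ?thesis
      using ab by (simp add: set_integral_const mult.commute)
  qed
  have F0: "F 0 = 0"
    by (simp add: F_def)
  have F1: "F 1 \<le> 0"
    using Fab[of 0 1] F0 mean by simp
  \<comment> \<open>Cutting at the last zero \<open>\<beta>\<close> of \<open>F\<close> keeps the leftmost rising component from having average above \<open>c\<close>.\<close>
  define Z where "Z = {x\<in>{0..1}. 0 \<le> F x}"
  have "closed Z"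
    using continuous_closed_preimage[OF cont, of "{0..}"] by (simp add: Z_def vimage_def Int_def conj_commute)
  then have "compact Z"
    by (simp add: compact_eq_bounded_closed Z_def bounded_subset[of "{0..1}"] subset_iff)
  moreover have "0 \<in> Z"
    by (simp add: Z_def F0)
  ultimately obtain \<beta> where \<beta>Z: "\<beta> \<in> Z" and \<beta>max: "\<And>x. x \<in> Z \<Longrightarrow> x \<le> \<beta>"
    using compact_attains_sup[of Z] by auto
  have \<beta>: "0 \<le> \<beta>" "\<beta> \<le> 1" "0 \<le> F \<beta>"
    using \<beta>Z by (auto simp: Z_def)
  have neg: "F x < 0" if "\<beta> < x" "x \<le> 1" for x
    using \<beta>max[of x] that \<beta> by (force simp: Z_def)
  have F\<beta>: "F \<beta> = 0"
  proof -
    obtain z where z: "z \<ge> \<beta>" "z \<le> 1" "F z = 0"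
      using IVT2'[of F 1 0 \<beta>] F1 \<beta> continuous_on_subset[OF cont, of "{\<beta>..1}"] by auto
    then have "z = \<beta>"
      using neg[of z] by (cases "z = \<beta>") auto
    then show ?thesis
      using z by simp
  qed
  define E where "E = {x\<in>{\<beta><..<1}. \<exists>y>x. y \<le> 1 \<and> F x < F y}"
  have opE: "open E"
    unfolding E_def by (rule open_rising_set[OF cont \<beta>(1)])
  have bdE: "bounded E"
    by (rule bounded_subset[of "{\<beta><..<1}"]) (auto simp: E_def)
  \<comment> \<open>The interval from \<open>0\<close> to \<open>\<beta>\<close> has average
    \<open>c\<close> because \<open>F\<close> vanishes at both of its ends; it is empty when
    \<open>\<beta> = 0\<close>.\<close>
  define \<A> where "\<A> = insert {0<..<\<beta>} (components E)"
  have good: "S = {} \<or> (\<exists>a b. 0 \<le> a \<and> a < b \<and> b \<le> 1 \<and> S = {a<..<b} \<and>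
      (LINT x:{a<..<b}|lebesgue. f x) = c * (b - a))" if S: "S \<in> \<A>" for S
  proof (cases "S \<in> components E")
    case True
    then obtain a b where ab: "a < b" "S = {a<..<b}" "a \<notin> E" "b \<notin> E"
      using open_interval_of_component[OF opE _ bdE] by metis
    have sub: "{a<..<b} \<subseteq> E"
      using ab True in_components_subset by blast
    have dom: "F x \<le> F \<beta>" if "\<beta> < x" "x \<le> 1" for x
      using neg[OF that] F\<beta> by simp
    note comp = rising_sun_component[OF cont \<beta>(1) dom E_def ab(1) sub ab(3,4)]
    have "(LINT x:{a<..<b}|lebesgue. f x) = c * (b - a)"
      using Fab[of a b] comp \<beta> ab by simp
    then show ?thesis
      using comp \<beta> ab by (intro disjI2 exI[of _ a] exI[of _ b]) auto
  next
    case False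
    then have S: "S = {0<..<\<beta>}"
      using S by (simp add: \<A>_def)
    show ?thesis
    proof (cases "\<beta> = 0")
      case False
      then have "(LINT x:{0<..<\<beta>}|lebesgue. f x) = c * (\<beta> - 0)"
        using Fab[of 0 \<beta>] F0 F\<beta> \<beta> by simp
      then show ?thesis
        using False \<beta> S by (intro disjI2 exI[of _ 0] exI[of _ \<beta>]) auto
    qed (use S in auto)
  qed
  have disj: "pairwise disjnt \<A>"
  proof -
    have "disjnt {0<..<\<beta>} S" if "S \<in> components E" for S
      using in_components_subset[OF that] by (auto simp: disjnt_def E_def)
    then show ?thesis
      using pairwise_disjoint_components[of E] unfolding \<A>_def pairwise_insert
      by (auto simp: disjnt_def pairwise_def)
  qed
  have "countable \<A>"
    by (rule countable_disjoint_open_subsets[OF _ disj]) (use opE in \<open>auto simp: \<A>_def open_components\<close>)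
  then obtain A :: "nat \<Rightarrow> real set" where A: "disjoint_family A" "range A \<subseteq> insert {} \<A>" "(\<Union>n. A n) = \<Union>\<A>"
    using countable_disjoint_enumeration[OF _ disj] by metis
  have UA: "(\<Union>n. A n) = {0<..<\<beta>} \<union> E"
    by (simp add: A(3) \<A>_def)
  \<comment> \<open>Lebesgue differentiation along intervals to the right of x, the side on which
    points outside the family see no increase of \<open>F\<close>.\<close>
  obtain N where N: "negligible N" "\<And>x e. \<lbrakk>x \<notin> N; 0 < e\<rbrakk> \<Longrightarrow>
      \<exists>d>0. \<forall>k. 0 < k \<and> k < d \<longrightarrow>
         norm (integral (cbox x (x + k *\<^sub>R One)) h /\<^sub>R k ^ DIM(real) - h x) < e"
    using integrable_ccontinuous_explicit[of h] hk by (metis box_real(2))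
  have "AE x in lebesgue. x \<notin> N"
    using N(1) by (simp add: AE_not_in negligible_iff_null_sets)
  moreover have "AE x in lebesgue. x \<noteq> \<beta>"
    by (auto intro: AE_completion AE_lborel_singleton)
  ultimately have "AE x in lebesgue. x \<in> {0<..<1} \<longrightarrow> x \<notin> (\<Union>n. A n) \<longrightarrow> f x \<le> c"
  proof eventually_elim
    case (elim x)
    show ?case
    proof (intro impI)
      assume x: "x \<in> {0<..<1}" "x \<notin> (\<Union>n. A n)"
      then have xb: "\<beta> < x" "x < 1"
        using elim UA by auto
      then have le: "F y \<le> F x" if "x < y" "y \<le> 1" for y
        using x that UA by (auto simp: E_def not_less)
      have "h x \<le> 0"
      proof (rule field_le_epsilon)
        fix e :: real assume "0 < e"
        then obtain d where d: "d > 0" "\<And>k. 0 < k \<Longrightarrow> k < d \<Longrightarrow> \<bar>integral {x..x + k} h / k - h x\<bar> < e"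
          using N(2)[OF elim(1) \<open>0 < e\<close>] by (auto simp: divide_inverse_commute)
        define k where "k = min (d / 2) (1 - x)"
        have k: "0 < k" "k < d" "x + k \<le> 1"
          using d xb by (auto simp: k_def)
        have "integral {x..x + k} h \<le> 0"
          using diff[of x "x + k"] le[of "x + k"] k xb \<beta> by simp
        then have "integral {x..x + k} h / k \<le> 0"
          using k by (simp add: divide_nonpos_pos)
        then show "h x \<le> 0 + e"
          using d(2)[OF k(1,2)] by simp
      qed
      then show "f x \<le> c"
        using x(1) by (simp add: h_def)
    qed
  qed
  moreover have "A n = {} \<or> (\<exists>a b. 0 \<le> a \<and> a < b \<and> b \<le> 1 \<and> A n = {a<..<b} \<and>
      (LINT x:{a<..<b}|lebesgue. f x) = c * (b - a))" for n
  proof (cases "A n \<in> \<A>")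
    case True
    then show ?thesis
      by (rule good)
  next
    case False
    then show ?thesis
      using A(2) by auto
  qed
  ultimately show ?thesis
    using that A(1) by blast
qed

text \<open>All intervals of the rising sun family share the mean \<open>c\<close>, so their
  oscillation bounds have a common centre and add up over the union with the same
  \<open>K\<close>.\<close>

lemma rising_sun_oscillation:
  fixes f :: "real \<Rightarrow> real"
  assumes int: "set_integrable lebesgue {0<..<1} f" and mean: "(LINT x:{0<..<1}|lebesgue. f x) \<le> c"
    and osc: "\<And>a b. 0 \<le> a \<Longrightarrow> a < b \<Longrightarrow> b \<le> 1 \<Longrightarrow>
      (\<integral>\<^sup>+x\<in>{a<..<b}. ennreal (\<bar>f x - (LINT x:{a<..<b}|lebesgue. f x) / (b - a)\<bar> powr p) \<partial>lebesgue)
        \<le> K * ennreal (b - a)"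
  obtains E where "E \<in> sets borel" "E \<subseteq> {0<..<1}"
    "AE x in lebesgue. x \<in> {0<..<1} \<longrightarrow> x \<notin> E \<longrightarrow> f x \<le> c"
    "(LINT x:E|lebesgue. f x - c) = 0"
    "(\<integral>\<^sup>+x\<in>E. ennreal (\<bar>f x - c\<bar> powr p) \<partial>lebesgue) \<le> K * emeasure lebesgue E"
proof -
  obtain A :: "nat \<Rightarrow> real set" where A: "disjoint_family A"
    "\<And>n. A n = {} \<or> (\<exists>a b. 0 \<le> a \<and> a < b \<and> b \<le> 1 \<and> A n = {a<..<b} \<and>
      (LINT x:{a<..<b}|lebesgue. f x) = c * (b - a))"
    "AE x in lebesgue. x \<in> {0<..<1} \<longrightarrow> x \<notin> (\<Union>n. A n) \<longrightarrow> f x \<le> c"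
    using rising_sun[OF int mean] by blast
  let ?E = "\<Union>n. A n"
  have bA: "A n \<in> sets borel" for n
    using A(2)[of n] by auto
  then have bE: "?E \<in> sets borel"
    by auto
  have sub: "A n \<subseteq> {0<..<1}" for n
    using A(2)[of n] by auto
  then have subE: "?E \<subseteq> {0<..<1}"
    by auto
  have fc: "set_integrable lebesgue {0<..<1} (\<lambda>x. f x - c)"
    by (intro set_integral_diff(1)[OF int] set_integrable_const_interval)
  have z: "(LINT x:A n|lebesgue. f x - c) = 0" for n
    using A(2)[of n]
  proof (elim disjE exE conjE)
    fix a b assume ab: "0 \<le> a" "a < b" "b \<le> 1" "A n = {a<..<b}" "(LINT x:{a<..<b}|lebesgue. f x) = c * (b - a)"
    have "(LINT x:{a<..<b}|lebesgue. f x - c) = (LINT x:{a<..<b}|lebesgue. f x) - (LINT x:{a<..<b}|lebesgue. c)"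
      by (intro set_integral_diff(2) set_integrable_subset[OF int] set_integrable_const_interval)
        (use ab in auto)
    then show ?thesis
      using ab by (simp add: set_integral_const mult.commute)
  qed (simp add: set_lebesgue_integral_def)
  have zero: "(LINT x:?E|lebesgue. f x - c) = 0"
  proof (subst lebesgue_integral_countable_add)
    show "set_integrable lebesgue ?E (\<lambda>x. f x - c)"
      by (rule set_integrable_subset[OF fc _ subE]) (use bE in auto)
  qed (use bA A(1) z in \<open>auto simp: disjoint_family_on_def\<close>)
  let ?g = "\<lambda>x. ennreal (indicator {0<..<1} x * \<bar>f x - c\<bar> powr p)"
  have "set_borel_measurable lebesgue {0<..<1} (\<lambda>x. \<bar>f x - c\<bar> powr p)"
    by (intro set_borel_measurable_compose[where h="\<lambda>y. \<bar>y - c\<bar> powr p"] set_integrable_measurable int) auto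
  then have m: "?g \<in> borel_measurable lebesgue"
    by (simp add: set_borel_measurable_def)
  have gA: "(\<integral>\<^sup>+x\<in>S. ennreal (\<bar>f x - c\<bar> powr p) \<partial>lebesgue) = emeasure (density lebesgue ?g) S"
    if "S \<in> sets borel" "S \<subseteq> {0<..<1}" for S
    using that by (subst emeasure_density[OF m]) (auto intro!: nn_integral_cong simp: indicator_def)
  have An: "emeasure (density lebesgue ?g) (A n) \<le> K * emeasure lebesgue (A n)" for n
    using A(2)[of n]
  proof (elim disjE exE conjE)
    fix a b assume ab: "0 \<le> a" "a < b" "b \<le> 1" "A n = {a<..<b}" "(LINT x:{a<..<b}|lebesgue. f x) = c * (b - a)"
    have "emeasure lebesgue (A n) = ennreal (b - a)"
      using ab by simp
    then show ?thesis
      using osc[OF ab(1-3)] ab(2,4,5) gA[OF bA sub, of n] by simp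
  qed simp
  have "(\<integral>\<^sup>+x\<in>?E. ennreal (\<bar>f x - c\<bar> powr p) \<partial>lebesgue) = emeasure (density lebesgue ?g) ?E"
    by (rule gA[OF bE subE])
  also have "\<dots> = (\<Sum>n. emeasure (density lebesgue ?g) (A n))"
    by (rule suminf_emeasure[symmetric]) (use bA A(1) in auto)
  also have "\<dots> \<le> (\<Sum>n. K * emeasure lebesgue (A n))"
    by (intro suminf_le An) auto
  also have "\<dots> = K * (\<Sum>n. emeasure lebesgue (A n))"
    by simp
  also have "(\<Sum>n. emeasure lebesgue (A n)) = emeasure lebesgue ?E"
    by (rule suminf_emeasure) (use bA A(1) in auto)
  finally show ?thesis
    using that[OF bE subE A(3) zero] by blast
qed

section \<open>Decreasing rearrangement\<close>

text \<open>The negated quantile function of \<open>- f\<close> is decreasing, and under the uniform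
  distribution it has the law of \<open>f\<close>. The indicator makes it Borel on the whole
  line.\<close>

lemma exists_decreasing_rearrangement:
  fixes f :: "real \<Rightarrow> real"
  assumes f: "f \<in> borel_measurable (lebesgue_on {0<..<1})"
  obtains g :: "real \<Rightarrow> real"
  where "g \<in> borel_measurable borel" "antimono_on {0<..<1} g"
    "distr (restrict_space lborel {0<..<1}) borel g = distr (lebesgue_on {0<..<1}) borel f"
proof -
  let ?U = "{0<..<1::real}" and ?nf = "\<lambda>x. - f x"
  define M where "M = distr (lebesgue_on ?U) borel ?nf"
  interpret L: prob_space "lebesgue_on ?U"
    by (rule prob_spaceI) (simp add: emeasure_restrict_space)
  have nf: "?nf \<in> borel_measurable (lebesgue_on ?U)"
    using f by simp
  interpret M: cdf_distribution M
    unfolding cdf_distribution_def M_def by (rule L.real_distribution_distr[OF nf])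
  define g where "g = (\<lambda>x. indicat_real ?U x *\<^sub>R (- M.I x))"
  have I: "M.I \<in> borel_measurable (restrict_space borel ?U)"
    by (rule M.measurable_CI)
  then have "(\<lambda>x. - M.I x) \<in> borel_measurable (restrict_space borel ?U)"
    by simp
  then have g: "g \<in> borel_measurable borel"
    unfolding g_def by (subst (asm) borel_measurable_restrict_space_iff) auto
  have anti: "antimono_on ?U g"
    using M.mono_I by (auto simp: monotone_on_def g_def)
  have I': "M.I \<in> borel_measurable (restrict_space lborel ?U)"
    using I by (subst measurable_cong_sets[of _ "restrict_space borel ?U"]) (auto simp: sets_restrict_space)
  have "distr (restrict_space lborel ?U) borel g = distr (restrict_space lborel ?U) borel (\<lambda>x. - M.I x)"
    by (rule distr_cong) (auto simp: g_def)
  also have "\<dots> = distr (distr (restrict_space lborel ?U) borel M.I) borel uminus"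
    using I' by (subst distr_distr) (auto simp: comp_def)
  also have "\<dots> = distr M borel uminus"
    by (simp add: M.distr_I_eq_M)
  also have "\<dots> = distr (lebesgue_on ?U) borel f"
    unfolding M_def using nf by (subst distr_distr) (auto simp: comp_def)
  finally show ?thesis
    using that[OF g anti] by blast
qed

lemma
  fixes f g :: "real \<Rightarrow> real"
  assumes f: "f \<in> borel_measurable (lebesgue_on {0<..<1})" and g: "g \<in> borel_measurable borel"
    and eq: "distr (restrict_space lborel {0<..<1}) borel g = distr (lebesgue_on {0<..<1}) borel f"
  shows equimeasurable_nn_integral: "h1 \<in> borel_measurable borel \<Longrightarrow>
      (\<integral>\<^sup>+x\<in>{0<..<1}. h1 (g x) \<partial>lborel) = (\<integral>\<^sup>+x\<in>{0<..<1}. h1 (f x) \<partial>lebesgue)"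
    and equimeasurable_integrable: "h \<in> borel_measurable borel \<Longrightarrow>
      set_integrable lborel {0<..<1} (\<lambda>x. h (g x) :: real) \<longleftrightarrow> set_integrable lebesgue {0<..<1} (\<lambda>x. h (f x))"
    and equimeasurable_integral: "h \<in> borel_measurable borel \<Longrightarrow>
      (LINT x:{0<..<1}|lborel. h (g x)) = (LINT x:{0<..<1}|lebesgue. h (f x))"
proof -
  let ?U = "{0<..<1::real}"
  have g': "g \<in> borel_measurable (restrict_space lborel ?U)"
    using g by (simp add: measurable_restrict_space1)
  show "(\<integral>\<^sup>+x\<in>?U. h1 (g x) \<partial>lborel) = (\<integral>\<^sup>+x\<in>?U. h1 (f x) \<partial>lebesgue)"
    if h: "h1 \<in> borel_measurable borel"
    using nn_integral_distr[OF g', of h1] nn_integral_distr[OF f, of h1] h unfolding eq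
    by (simp add: nn_integral_restrict_space)
  assume h: "h \<in> borel_measurable borel"
  show "set_integrable lborel ?U (\<lambda>x. h (g x)) \<longleftrightarrow> set_integrable lebesgue ?U (\<lambda>x. h (f x))"
    using integrable_distr_eq[OF g' h] integrable_distr_eq[OF f h] unfolding eq
    by (simp add: integrable_restrict_space set_integrable_def)
  show "(LINT x:?U|lborel. h (g x)) = (LINT x:?U|lebesgue. h (f x))"
    using integral_distr[OF g' h] integral_distr[OF f h] unfolding eq
    by (simp add: integral_restrict_space set_lebesgue_integral_def)
qed

text \<open>The slope \<open>m powr (p - 1)\<close> is chosen so that the tilted power, which
  vanishes at \<open>c\<close>, vanishes at \<open>c - m\<close> too. For \<open>y \<le> c\<close>
  the expression is \<open>c - y\<close> times
  \<open>\<bar>y - c\<bar> powr (p - 1) - m powr (p - 1)\<close>, whose sign follows from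
  monotonicity of the power.\<close>

lemma tilted_power_sign:
  fixes m p y c :: real
  assumes "m > 0" "1 \<le> p"
  shows "y \<ge> c \<Longrightarrow> 0 \<le> \<bar>y - c\<bar> powr p + m powr (p - 1) * (y - c)"
    and "y \<le> c - m \<Longrightarrow> 0 \<le> \<bar>y - c\<bar> powr p + m powr (p - 1) * (y - c)"
    and "c - m \<le> y \<Longrightarrow> y \<le> c \<Longrightarrow> \<bar>y - c\<bar> powr p + m powr (p - 1) * (y - c) \<le> 0"
proof -
  have split: "\<bar>z\<bar> powr p = \<bar>z\<bar> powr (p - 1) * \<bar>z\<bar>" for z :: real
    by (cases "z = 0") (auto simp: powr_diff)
  show "y \<ge> c \<Longrightarrow> 0 \<le> \<bar>y - c\<bar> powr p + m powr (p - 1) * (y - c)"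
    by simp
  show "0 \<le> \<bar>y - c\<bar> powr p + m powr (p - 1) * (y - c)" if "y \<le> c - m"
  proof -
    have "m powr (p - 1) * (c - y) \<le> \<bar>y - c\<bar> powr (p - 1) * (c - y)"
      using that assms by (intro mult_right_mono powr_mono2) auto
    then show ?thesis
      unfolding split using that assms by (simp add: algebra_simps)
  qed
  show "\<bar>y - c\<bar> powr p + m powr (p - 1) * (y - c) \<le> 0" if "c - m \<le> y" "y \<le> c"
  proof -
    have "\<bar>y - c\<bar> powr (p - 1) * (c - y) \<le> m powr (p - 1) * (c - y)"
      using that assms by (intro mult_right_mono powr_mono2) auto
    then show ?thesis
      unfolding split using that assms by (simp add: algebra_simps)
  qed
qed

lemma set_integrable_const_Ioo: "set_integrable lborel {a<..<b::real} (\<lambda>_. c :: real)"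
  unfolding set_integrable_def by (intro integrable_scaleR_left integrable_real_indicator) (cases "a \<le> b"; auto)+

text \<open>Let \<open>E\<close> be the rising sun set of \<open>f\<close> at height
  \<open>c\<close>. It is no larger than (0,t): \<open>m\<close> times its measure is the integral
  of \<open>f - v\<close> over \<open>E\<close>, which is at most the integral of the positive part
  of \<open>f - v\<close>, and equimeasurability turns the latter into the integral of
  \<open>g - v\<close> over (0,t), that is \<open>t * m\<close>. Hence the oscillation of
  \<open>f\<close> about \<open>c\<close> on \<open>E\<close> is at most \<open>K * t\<close>, and
  \<open>g\<close> on (0,t) remains to be compared with \<open>f\<close> on
  \<open>E\<close>.\<close>

lemma rearrangement_oscillation:
  fixes f g :: "real \<Rightarrow> real"
  assumes p: "1 \<le> p" and K: "0 \<le> K" and int: "set_integrable lebesgue {0<..<1} f"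
    and osc: "\<And>a b. 0 \<le> a \<Longrightarrow> a < b \<Longrightarrow> b \<le> 1 \<Longrightarrow>
      (\<integral>\<^sup>+x\<in>{a<..<b}. ennreal (\<bar>f x - (LINT x:{a<..<b}|lebesgue. f x) / (b - a)\<bar> powr p) \<partial>lebesgue)
        \<le> ennreal K * ennreal (b - a)"
    and g: "g \<in> borel_measurable borel" and anti: "antimono_on {0<..<1} g"
    and eq: "distr (restrict_space lborel {0<..<1}) borel g = distr (lebesgue_on {0<..<1}) borel f"
    and t: "0 < t" "t < 1" and c: "c = (LINT x:{0<..<t}|lborel. g x) / t"
  shows "set_integrable lborel {0<..<t} (\<lambda>x. \<bar>g x - c\<bar> powr p)"
    and "(LINT x:{0<..<t}|lborel. \<bar>g x - c\<bar> powr p) \<le> K * t"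
proof -
  let ?U = "{0<..<1::real}" and ?T = "{0<..<t}"
  have f: "f \<in> borel_measurable (lebesgue_on ?U)"
    using set_integrable_measurable[OF int] by (simp add: set_borel_measurable_iff_lebesgue_on)
  note equi_int = equimeasurable_integrable[OF f g eq] and equi = equimeasurable_integral[OF f g eq]
  have gU: "set_integrable lborel ?U g"
    using equi_int[of "\<lambda>y. y"] int by simp
  have TU: "?T \<subseteq> ?U"
    using t by auto
  have gT: "set_integrable lborel ?T g"
    by (rule set_integrable_subset[OF gU _ TU]) simp
  have gcT: "set_integrable lborel ?T (\<lambda>x. g x - c)" and gc0: "(LINT x:?T|lborel. g x - c) = 0"
  proof -
    show "set_integrable lborel ?T (\<lambda>x. g x - c)"
      by (intro set_integral_diff(1) gT set_integrable_const_Ioo)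
    show "(LINT x:?T|lborel. g x - c) = 0"
      using t c by (subst set_integral_diff(2)[OF gT set_integrable_const_Ioo]) (simp add: set_integral_const)
  qed
  define v where "v = g t"
  define m where "m = c - v"
  have ge: "v \<le> g x" if "x \<in> ?T" for x
    unfolding v_def using that t by (intro monotone_onD[OF anti]) auto
  have le: "g x \<le> v" if "x \<in> {t..<1}" for x
    unfolding v_def using that t by (intro monotone_onD[OF anti]) auto
  have tm: "(LINT x:?T|lborel. g x - v) = t * m"
    using t c by (subst set_integral_diff(2)[OF gT set_integrable_const_Ioo])
      (simp add: set_integral_const m_def field_simps)
  have m0: "0 \<le> m"
  proof -
    have "0 \<le> (LINT x:?T|lborel. g x - v)"
      unfolding set_lebesgue_integral_def using ge by (intro integral_nonneg_AE AE_I2) (auto simp: indicator_def)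
    then show ?thesis
      using tm t by (simp add: zero_le_mult_iff)
  qed
  show "set_integrable lborel ?T (\<lambda>x. \<bar>g x - c\<bar> powr p)"
    and "(LINT x:?T|lborel. \<bar>g x - c\<bar> powr p) \<le> K * t"
  proof -
    consider "m = 0" | "m > 0"
      using m0 by linarith
    then have "set_integrable lborel ?T (\<lambda>x. \<bar>g x - c\<bar> powr p) \<and>
      (LINT x:?T|lborel. \<bar>g x - c\<bar> powr p) \<le> K * t"
    proof cases
      \<comment> \<open>Here \<open>g\<close> is at least its own mean on (0,t), hence equal to it
        almost everywhere.\<close>
      case 1
      then have "v = c"
        by (simp add: m_def)
      have "AE x in lborel. indicat_real ?T x *\<^sub>R (g x - c) = 0"
        using gc0 gcT ge unfolding set_lebesgue_integral_def set_integrable_def \<open>v = c\<close>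
        by (subst integral_nonneg_eq_0_iff_AE[symmetric]) (auto simp: indicator_def)
      then have AE: "AE x in lborel. indicat_real ?T x *\<^sub>R \<bar>g x - c\<bar> powr p = 0"
        by eventually_elim (auto simp: indicator_def)
      have "integrable lborel (\<lambda>x. indicat_real ?T x *\<^sub>R \<bar>g x - c\<bar> powr p)"
        by (subst integrable_cong_AE[where g="\<lambda>_. 0"]) (use AE g in auto)
      moreover have "(LINT x|lborel. indicat_real ?T x *\<^sub>R \<bar>g x - c\<bar> powr p) = 0"
        by (subst integral_cong_AE[where g="\<lambda>_. 0"]) (use AE g in auto)
      ultimately show ?thesis
        using K t by (simp add: set_integrable_def set_lebesgue_integral_def)
    next
      case 2
      \<comment> \<open>Beyond \<open>t\<close> the values of \<open>g\<close> are at most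
        \<open>v \<le> c\<close>, so the mean over the whole interval does not exceed
        \<open>c\<close>.\<close>
      have mean: "(LINT x:?U|lebesgue. f x) \<le> c"
      proof -
        have "(LINT x:?U|lebesgue. f x) = (LINT x:?U|lborel. g x)"
          using equi[of "\<lambda>y. y"] by simp
        also have "\<dots> = (LINT x:?T \<union> {t..<1}|lborel. g x)"
          by (rule arg_cong[where f="\<lambda>S. set_lebesgue_integral lborel S g"]) (use t in auto)
        also have "\<dots> = (LINT x:?T|lborel. g x) + (LINT x:{t..<1}|lborel. g x)"
          by (rule set_integral_Un) (use t gT in \<open>auto intro: set_integrable_subset[OF gU]\<close>)
        also have "(LINT x:{t..<1}|lborel. g x) \<le> (LINT x:{t..<1}|lborel. c)"
        proof (rule set_integral_mono)
          show "set_integrable lborel {t..<1} g"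
            by (rule set_integrable_subset[OF gU]) (use t in auto)
          show "set_integrable lborel {t..<1} (\<lambda>_. c)"
            by (rule set_integrable_subset[OF set_integrable_const_Ioo[of 0 1]]) (use t in auto)
          show "g x \<le> c" if "x \<in> {t..<1}" for x
            using le[OF that] m0 by (simp add: m_def)
        qed
        also have "(LINT x:{t..<1}|lborel. c) = (1 - t) * c"
          using t by (simp add: set_integral_const)
        also have "(LINT x:?T|lborel. g x) = t * c"
          using c t by simp
        finally show ?thesis
          by (simp add: algebra_simps)
      qed
      obtain E where E: "E \<in> sets borel" "E \<subseteq> ?U"
        "AE x in lebesgue. x \<in> ?U \<longrightarrow> x \<notin> E \<longrightarrow> f x \<le> c"
        "(LINT x:E|lebesgue. f x - c) = 0"
        "(\<integral>\<^sup>+x\<in>E. ennreal (\<bar>f x - c\<bar> powr p) \<partial>lebesgue) \<le> ennreal K * emeasure lebesgue E"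
        using rising_sun_oscillation[OF int mean osc] by blast
      have EL: "E \<in> sets lebesgue"
        using E(1) by simp
      have "emeasure lebesgue E \<le> emeasure lebesgue ?U"
        by (rule emeasure_mono[OF E(2)]) simp
      then have "emeasure lebesgue E < \<infinity>"
        by (auto intro: order_le_less_trans)
      then have emE: "emeasure lebesgue E = ennreal (measure lebesgue E)"
        by (simp add: emeasure_eq_ennreal_measure)
      have fcU: "set_integrable lebesgue ?U (\<lambda>x. f x - r)" for r
        by (intro set_integral_diff(1) int set_integrable_const_interval)
      have fcE: "set_integrable lebesgue E (\<lambda>x. f x - r)" for r
        by (rule set_integrable_subset[OF fcU EL E(2)])
      have posv: "set_integrable lebesgue ?U (\<lambda>x. max 0 (f x - v))"
        using fcU[of v] unfolding set_integrable_def
        by (rule Bochner_Integration.integrable_bound)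
          (use set_borel_measurable_compose[OF _ set_integrable_measurable[OF int], where h="\<lambda>y. max 0 (y - v)"]
            in \<open>auto simp: set_borel_measurable_def indicator_def\<close>)
      have tm': "(LINT x:?U|lebesgue. max 0 (f x - v)) = t * m"
      proof -
        have "(LINT x:?U|lebesgue. max 0 (f x - v)) = (LINT x:?U|lborel. max 0 (g x - v))"
          using equi[of "\<lambda>y. max 0 (y - v)"] by simp
        also have "\<dots> = (LINT x:?T|lborel. g x - v)"
        proof -
          have "indicat_real ?U x *\<^sub>R max 0 (g x - v) = indicat_real ?T x *\<^sub>R (g x - v)" for x
            using ge[of x] le[of x] t by (cases "x < t") (auto simp: indicator_def)
          then show ?thesis
            by (simp add: set_lebesgue_integral_def)
        qed
        finally show ?thesis
          using tm by simp
      qed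
      have Et: "measure lebesgue E \<le> t"
      proof -
        have "m * measure lebesgue E = (LINT x:E|lebesgue. f x - c) + (LINT x:E|lebesgue. m)"
          using E(4) EL emE by (simp add: set_integral_const)
        also have "\<dots> = (LINT x:E|lebesgue. (f x - c) + m)"
          by (rule set_integral_add(2)[OF fcE set_integrable_subset[OF set_integrable_const_interval EL E(2)], symmetric])
        also have "\<dots> = (LINT x:E|lebesgue. f x - v)"
          by (simp add: m_def)
        also have "\<dots> \<le> (LINT x:?U|lebesgue. max 0 (f x - v))"
          unfolding set_lebesgue_integral_def
          by (rule integral_mono) (use fcE posv E(2) in \<open>auto simp: set_integrable_def indicator_def\<close>)
        finally have "m * measure lebesgue E \<le> m * t"
          unfolding tm' by (simp add: mult.commute)
        then show ?thesis
          using 2 by simp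
      qed
      \<comment> \<open>The tilt changes neither integral, since \<open>g - c\<close> and \<open>f - c\<close> have mean zero on \<open>(0,t)\<close> and \<open>E\<close>;
        it makes the integrand vanish at \<open>v\<close> and be nonpositive between \<open>v\<close> and \<open>c\<close>.\<close>
      define k where "k = (\<lambda>y. \<bar>y - c\<bar> powr p + m powr (p - 1) * (y - c))"
      \<comment> \<open>The cut at level \<open>v\<close> turns the integral over (0,t) into an
        integral over the unit interval of a function of \<open>g\<close> alone, to which
        equimeasurability applies; ties at level \<open>v\<close> are harmless because
        \<open>k v = 0\<close>.\<close>
      define kv where "kv = (\<lambda>y. if v < y then k y else 0)"
      have km: "k \<in> borel_measurable borel" "kv \<in> borel_measurable borel"
        unfolding kv_def k_def by measurable
      have kv0: "k v = 0"
        using tilted_power_sign(2)[OF 2 p, of v c] tilted_power_sign(3)[OF 2 p, of c v] m0 by (auto simp: k_def m_def intro: antisym)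
      have pE: "set_integrable lebesgue E (\<lambda>x. \<bar>f x - c\<bar> powr p)"
        and pEle: "(LINT x:E|lebesgue. \<bar>f x - c\<bar> powr p) \<le> K * t"
      proof -
        have eqn: "(\<integral>\<^sup>+x. ennreal (indicat_real E x *\<^sub>R \<bar>f x - c\<bar> powr p) \<partial>lebesgue) =
          (\<integral>\<^sup>+x\<in>E. ennreal (\<bar>f x - c\<bar> powr p) \<partial>lebesgue)"
          by (intro nn_integral_cong) (auto simp: indicator_def)
        have le: "(\<integral>\<^sup>+x. ennreal (indicat_real E x *\<^sub>R \<bar>f x - c\<bar> powr p) \<partial>lebesgue) \<le> ennreal (K * t)"
          unfolding eqn using E(5) emE Et K t
          by (auto simp: ennreal_mult[symmetric] intro!: order_trans[OF E(5)] ennreal_leI mult_left_mono)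
        have meas: "set_borel_measurable lebesgue E (\<lambda>x. \<bar>f x - c\<bar> powr p)"
          using set_borel_measurable_compose[OF EL set_integrable_measurable[OF fcE[of 0]], where h="\<lambda>y. \<bar>y - c\<bar> powr p"]
          by simp
        have int: "integrable lebesgue (\<lambda>x. indicat_real E x *\<^sub>R \<bar>f x - c\<bar> powr p)"
          by (rule integrableI_bounded)
            (use meas le in \<open>auto simp: set_borel_measurable_def less_top[symmetric] top_unique\<close>)
        then show "set_integrable lebesgue E (\<lambda>x. \<bar>f x - c\<bar> powr p)"
          by (simp add: set_integrable_def)
        have "ennreal (LINT x|lebesgue. indicat_real E x *\<^sub>R \<bar>f x - c\<bar> powr p) \<le> ennreal (K * t)"
          using le by (subst nn_integral_eq_integral[OF int, symmetric]) auto
        then show "(LINT x:E|lebesgue. \<bar>f x - c\<bar> powr p) \<le> K * t"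
          using K t by (simp add: set_lebesgue_integral_def)
      qed
      have kE: "set_integrable lebesgue E (\<lambda>x. k (f x))"
        unfolding k_def by (intro set_integral_add(1) pE set_integrable_mult_right fcE)
      have kEle: "(LINT x:E|lebesgue. k (f x)) \<le> K * t"
        unfolding k_def using pEle E(4) by (subst set_integral_add(2)[OF pE]) (auto simp: fcE)
      have kvU: "set_integrable lebesgue ?U (\<lambda>x. kv (f x))"
        unfolding set_integrable_def
      proof (rule Bochner_Integration.integrable_bound)
        let ?B = "\<lambda>x. indicat_real E x *\<^sub>R \<bar>k (f x)\<bar> + indicat_real ?U x *\<^sub>R (2 * m powr p)"
        show "integrable lebesgue ?B"
          using set_integrable_abs[OF kE] set_integrable_const_interval[of 0 1 "2 * m powr p"]
          by (intro Bochner_Integration.integrable_add) (auto simp: set_integrable_def)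
        show "(\<lambda>x. indicat_real ?U x *\<^sub>R kv (f x)) \<in> borel_measurable lebesgue"
          using set_borel_measurable_compose[OF _ set_integrable_measurable[OF int] km(2)]
          by (simp add: set_borel_measurable_def)
        show "AE x in lebesgue. norm (indicat_real ?U x *\<^sub>R kv (f x)) \<le> norm (?B x)"
          using E(3)
        proof eventually_elim
          case (elim x)
          have "\<bar>k (f x)\<bar> \<le> 2 * m powr p" if x: "x \<in> ?U" "x \<notin> E" "v < f x"
          proof -
            have z: "\<bar>f x - c\<bar> \<le> m"
              using elim x by (auto simp: m_def)
            have "\<bar>k (f x)\<bar> \<le> \<bar>f x - c\<bar> powr p + m powr (p - 1) * \<bar>f x - c\<bar>"
              unfolding k_def by (rule order_trans[OF abs_triangle_ineq]) (simp add: abs_mult)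
            also have "\<dots> \<le> m powr p + m powr (p - 1) * m"
              using z p by (intro add_mono mult_left_mono powr_mono2) auto
            also have "\<dots> = 2 * m powr p"
              using 2 by (simp add: powr_diff)
            finally show ?thesis .
          qed
          then show ?case
            using E(2) by (auto simp: indicator_def kv_def)
        qed
      qed
      \<comment> \<open>The cut discards only values at or below \<open>v\<close>, where
        \<open>k\<close> is nonnegative; outside \<open>E\<close>, where \<open>f x \<le> c\<close>
        almost everywhere, \<open>kv (f x)\<close> is nonpositive.\<close>
      have "(LINT x:?U|lebesgue. kv (f x)) \<le> (LINT x:E|lebesgue. k (f x))"
        unfolding set_lebesgue_integral_def
      proof (rule integral_mono_AE)
        show "AE x in lebesgue. indicat_real ?U x *\<^sub>R kv (f x) \<le> indicat_real E x *\<^sub>R k (f x)"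
          using E(3)
        proof eventually_elim
          case (elim x)
          have "kv (f x) \<le> k (f x)"
            using tilted_power_sign(2)[OF 2 p, of "f x" c] by (auto simp: kv_def k_def m_def)
          moreover have "kv (f x) \<le> 0" if "x \<in> ?U" "x \<notin> E"
            using elim that tilted_power_sign(3)[OF 2 p, of c "f x"] by (auto simp: kv_def k_def m_def)
          ultimately show ?case
            using E(2) by (auto simp: indicator_def)
        qed
      qed (use kvU kE in \<open>auto simp: set_integrable_def\<close>)
      then have kvle: "(LINT x:?U|lborel. kv (g x)) \<le> K * t"
        using kEle equi[OF km(2)] by simp
      have kvg: "set_integrable lborel ?U (\<lambda>x. kv (g x))"
        using equi_int[OF km(2)] kvU by simp
      have pt: "indicat_real ?U x *\<^sub>R kv (g x) = indicat_real ?T x *\<^sub>R k (g x)" for x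
        using ge[of x] le[of x] t kv0 by (cases "g x = v") (auto simp: indicator_def kv_def)
      have kT: "set_integrable lborel ?T (\<lambda>x. k (g x))" "(LINT x:?T|lborel. k (g x)) \<le> K * t"
        using kvg kvle unfolding set_integrable_def set_lebesgue_integral_def pt by auto
      have id: "\<bar>g x - c\<bar> powr p = k (g x) - m powr (p - 1) * (g x - c)" for x
        by (simp add: k_def)
      have "(LINT x:?T|lborel. \<bar>g x - c\<bar> powr p) = (LINT x:?T|lborel. k (g x)) - (LINT x:?T|lborel. m powr (p - 1) * (g x - c))"
        unfolding id by (rule set_integral_diff(2)[OF kT(1)]) (simp add: gcT)
      then show ?thesis
        using kT gc0 gcT unfolding id by (auto intro!: set_integral_diff(1))
    qed
    then show "set_integrable lborel ?T (\<lambda>x. \<bar>g x - c\<bar> powr p)"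
      and "(LINT x:?T|lborel. \<bar>g x - c\<bar> powr p) \<le> K * t"
      by auto
  qed
qed

section \<open>The logarithm\<close>

lemma set_integrable_scale_lborel:
  fixes f :: "real \<Rightarrow> real"
  assumes "s > 0"
  shows "set_integrable lborel {s * c<..<s * d} f \<longleftrightarrow> set_integrable lborel {c<..<d} (\<lambda>x. f (s * x))"
proof -
  have "integrable lborel (\<lambda>x. indicat_real {0 + s * c<..<0 + s * d} (0 + s * x) *\<^sub>R f (0 + s * x)) \<longleftrightarrow>
    integrable lborel (\<lambda>x. indicat_real {0 + s * c<..<0 + s * d} x *\<^sub>R f x)"
    by (rule lborel_integrable_real_affine_iff) (use assms in simp)
  then show ?thesis
    unfolding set_integrable_def indicator_affine_interval[OF assms] by simp
qed

lemma set_integral_scale_lborel: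
  fixes f :: "real \<Rightarrow> real"
  assumes "s > 0"
  shows "(LINT x:{s * c<..<s * d}|lborel. f x) = s * (LINT x:{c<..<d}|lborel. f (s * x))"
proof -
  have "(LINT x|lborel. indicat_real {0 + s * c<..<0 + s * d} x *\<^sub>R f x) =
    \<bar>s\<bar> *\<^sub>R (LINT x|lborel. indicat_real {0 + s * c<..<0 + s * d} (0 + s * x) *\<^sub>R f (0 + s * x))"
    by (rule lborel_integral_real_affine) (use assms in simp)
  then show ?thesis
    using assms unfolding set_lebesgue_integral_def indicator_affine_interval[OF assms] by simp
qed

text \<open>If \<open>f (\<alpha> * x)\<close> is expressed through \<open>f x\<close>, this becomes
  a linear equation for the integral over (0,1), so no limit at 0 has to be taken.\<close>

lemma set_integral_self_similar:
  fixes f :: "real \<Rightarrow> real"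
  assumes f: "set_integrable lborel {0<..<1} f" and \<alpha>: "0 < \<alpha>" "\<alpha> < 1"
  shows "(LINT x:{0<..<1}|lborel. f x) = (LINT x:{\<alpha><..<1}|lborel. f x) + \<alpha> * (LINT x:{0<..<1}|lborel. f (\<alpha> * x))"
proof -
  have "(LINT x:{0<..<1}|lborel. f x) = (LINT x:{0<..<\<alpha>} \<union> {\<alpha>..<1}|lborel. f x)"
    by (rule arg_cong[where f="\<lambda>S. set_lebesgue_integral lborel S f"]) (use \<alpha> in auto)
  also have "\<dots> = (LINT x:{0<..<\<alpha>}|lborel. f x) + (LINT x:{\<alpha>..<1}|lborel. f x)"
    by (rule set_integral_Un) (use \<alpha> in \<open>auto intro: set_integrable_subset[OF f]\<close>)
  also have "(LINT x:{0<..<\<alpha>}|lborel. f x) = \<alpha> * (LINT x:{0<..<1}|lborel. f (\<alpha> * x))"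
    using set_integral_scale_lborel[OF \<alpha>(1), of 0 1 f] by simp
  also have "(LINT x:{\<alpha>..<1}|lborel. f x) = (LINT x:{\<alpha><..<1}|lborel. f x)"
    by (rule set_integral_discrete_difference[of "{\<alpha>}"]) auto
  finally show ?thesis
    by simp
qed

text \<open>The tangent line of the convex power at \<open>b\<close>. For
  \<open>y \<le> 0 < b\<close> the line is nonpositive; at \<open>b = 0\<close> the convention
  \<open>sgn 0 = 0\<close> selects the horizontal line.\<close>

lemma powr_tangent_le:
  fixes y b p :: real
  assumes p: "1 \<le> p"
  shows "\<bar>b\<bar> powr p + p * sgn b * \<bar>b\<bar> powr (p - 1) * (y - b) \<le> \<bar>y\<bar> powr p"
proof -
  have pos: "b powr p + p * b powr (p - 1) * (y - b) \<le> \<bar>y\<bar> powr p" if b: "b > 0" for b y :: real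
  proof (cases "y > 0")
    case True
    have "p * b powr (p - 1) * (y - b) \<le> y powr p - b powr p"
    proof (rule convex_on_imp_above_tangent[where A="{0<..}"])
      show "convex_on {0<..} (\<lambda>x. x powr p)"
        by (rule powr_convex[OF p])
      show "((\<lambda>x. x powr p) has_field_derivative p * b powr (p - 1)) (at b within {0<..})"
        using b by (auto intro!: derivative_eq_intros)
    qed (use b True in \<open>auto simp: interior_open\<close>)
    then show ?thesis
      using True by simp
  next
    case False
    have "b powr (p - 1) * b = b powr p"
      using b by (simp add: powr_diff)
    then have "b powr p + p * b powr (p - 1) * (y - b) = (1 - p) * b powr p + p * b powr (p - 1) * y"
      by (simp add: algebra_simps)
    also have "\<dots> \<le> 0"
      using p False b by (intro add_nonpos_nonpos mult_nonpos_nonneg mult_nonneg_nonpos) auto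
    finally show ?thesis
      by (rule order_trans) simp
  qed
  consider "b > 0" | "b = 0" | "b < 0"
    by linarith
  then show ?thesis
  proof cases
    case 1
    then show ?thesis
      using pos[of b y] by simp
  next
    case 3
    then show ?thesis
      using pos[of "- b" "- y"] by (simp add: algebra_simps)
  qed auto
qed

lemma set_integrable_lebesgue_iff_lborel:
  fixes f :: "real \<Rightarrow> real"
  assumes "S \<in> sets borel" "f \<in> borel_measurable borel"
  shows "set_integrable lebesgue S f \<longleftrightarrow> set_integrable lborel S f"
  unfolding set_integrable_def by (rule integrable_completion) (use assms in measurable)

lemma set_integral_lebesgue_eq_lborel:
  fixes f :: "real \<Rightarrow> real"
  assumes "S \<in> sets borel" "f \<in> borel_measurable borel"
  shows "(LINT x:S|lebesgue. f x) = (LINT x:S|lborel. f x)"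
  unfolding set_lebesgue_integral_def by (rule integral_completion) (use assms in measurable)

section \<open>Integrability of powers of the logarithm\<close>

lemma set_integrable_powr:
  fixes a :: real
  assumes "a > -1"
  shows "set_integrable lborel {0<..<1} (\<lambda>x. x powr a)"
proof -
  have "(\<lambda>x. x powr a) integrable_on {0..1}"
    using assms by (intro integrable_on_powr_from_0) auto
  then have "set_integrable lebesgue {0..1} (\<lambda>x. x powr a)"
    by (intro nonnegative_absolutely_integrable_1) auto
  then have "set_integrable lborel {0..1} (\<lambda>x. x powr a)"
    by (subst (asm) set_integrable_lebesgue_iff_lborel) auto
  then show ?thesis
    by (rule set_integrable_subset) auto
qed

text \<open>This is \<open>ln z \<le> z\<close> for \<open>z = x powr (- 1 / (2 * n))\<close>; the
  exponent is chosen so that the n-th power leaves \<open>x powr (- 1 / 2)\<close>, which is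
  integrable at 0.\<close>

lemma minus_ln_power_le:
  fixes x :: real
  assumes x: "0 < x" "x < 1" and n: "n > 0"
  shows "(- ln x) ^ n \<le> (2 * real n) ^ n * x powr (- 1 / 2)"
proof -
  let ?d = "1 / (2 * real n)"
  have "- ln x = 2 * real n * ln (x powr (- ?d))"
    using x n by (simp add: ln_powr)
  also have "\<dots> \<le> 2 * real n * x powr (- ?d)"
    using x n ln_bound[of "x powr (- ?d)"] by (intro mult_left_mono) auto
  finally have "(- ln x) ^ n \<le> (2 * real n * x powr (- ?d)) ^ n"
    using x by (intro power_mono) auto
  also have "\<dots> = (2 * real n) ^ n * x powr (- ?d * n)"
    using x n by (simp add: power_mult_distrib powr_power)
  also have "- ?d * n = - 1 / 2"
    using n by simp
  finally show ?thesis .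
qed

lemma set_integrable_minus_ln_power: "set_integrable lborel {0<..<1::real} (\<lambda>x. (- ln x) ^ n)"
proof (cases "n = 0")
  case False
  have "set_integrable lborel {0<..<1} (\<lambda>x. (2 * real n) ^ n * x powr (- 1 / 2))"
    by (intro set_integrable_mult_right set_integrable_powr) simp
  then show ?thesis
    unfolding set_integrable_def
    by (rule Bochner_Integration.integrable_bound)
      (use minus_ln_power_le False in \<open>auto simp: indicator_def power_abs\<close>)
qed (simp add: set_integrable_const_Ioo)

lemma set_integral_minus_ln_Ioo:
  fixes \<alpha> :: real
  assumes \<alpha>: "0 < \<alpha>" "\<alpha> < 1"
  shows "(LINT x:{\<alpha><..<1}|lborel. - ln x) = 1 - \<alpha> + \<alpha> * ln \<alpha>"
proof -
  have i: "set_integrable lborel {\<alpha>..1} (\<lambda>x. - ln x)"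
    by (rule borel_integrable_atLeastAtMost') (use \<alpha> in \<open>auto intro!: continuous_intros\<close>)
  have "((\<lambda>x. - ln x) has_integral (1 - 1 * ln 1) - (\<alpha> - \<alpha> * ln \<alpha>)) {\<alpha>..1}"
    by (rule fundamental_theorem_of_calculus)
      (use \<alpha> in \<open>auto intro!: derivative_eq_intros simp: has_real_derivative_iff_has_vector_derivative[symmetric]\<close>)
  then have "(LINT x:{\<alpha>..1}|lborel. - ln x) = (1 - 1 * ln 1) - (\<alpha> - \<alpha> * ln \<alpha>)"
    unfolding set_borel_integral_eq_integral(2)[OF i] by (rule integral_unique)
  moreover have "(LINT x:{\<alpha><..<1}|lborel. - ln x) = (LINT x:{\<alpha>..1}|lborel. - ln x)"
    by (rule set_integral_discrete_difference[of "{\<alpha>, 1}"]) auto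
  ultimately show ?thesis
    by simp
qed

lemma set_integral_minus_ln: "(LINT x:{0<..<1::real}|lborel. - ln x) = 1"
proof -
  let ?U = "{0<..<1::real}"
  have i: "set_integrable lborel ?U (\<lambda>x. - ln x)"
    using set_integrable_minus_ln_power[of 1] by simp
  have "(LINT x:?U|lborel. - ln (1/2 * x)) = (LINT x:?U|lborel. - ln x + ln 2)"
    by (rule set_lebesgue_integral_cong) (auto simp: ln_mult ln_div)
  also have "\<dots> = (LINT x:?U|lborel. - ln x) + ln 2"
    using i by (subst set_integral_add(2)[OF i set_integrable_const_Ioo]) (simp add: set_integral_const)
  finally have "(LINT x:?U|lborel. - ln (1/2 * x)) = (LINT x:?U|lborel. - ln x) + ln 2" .
  moreover have "(LINT x:{1/2<..<1::real}|lborel. - ln x) = 1/2 - ln 2 / 2"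
    by (subst set_integral_minus_ln_Ioo) (auto simp: ln_div)
  moreover have "(LINT x:?U|lborel. - ln x) =
    (LINT x:{1/2<..<1::real}|lborel. - ln x) + 1/2 * (LINT x:?U|lborel. - ln (1/2 * x))"
    by (rule set_integral_self_similar[OF i]) auto
  ultimately show ?thesis
    by linarith
qed

text \<open>As \<open>- ln x\<close> has mean 1 on the unit interval, this is the p-th power of its
  oscillation there; the number \<open>L\<close> of the overview is bounded by
  \<open>log_osc p powr (1 / p)\<close>, which is what the proof compares with
  \<open>JN_const p\<close>.\<close>

definition log_osc :: "real \<Rightarrow> real" where
  "log_osc p = (LINT x:{0<..<1::real}|lborel. \<bar>- ln x - 1\<bar> powr p)"

lemma abs_powr_le_quadratic:
  fixes z p :: real
  assumes "0 \<le> p" "p \<le> 2"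
  shows "\<bar>z\<bar> powr p \<le> 1 + z\<^sup>2"
proof (cases "\<bar>z\<bar> \<le> 1")
  case True
  then have "\<bar>z\<bar> powr p \<le> 1"
    using assms by (intro powr_le1) auto
  then show ?thesis
    by (simp add: add_increasing2)
next
  case False
  then have "\<bar>z\<bar> powr p \<le> \<bar>z\<bar> powr 2"
    using assms by (intro powr_mono) auto
  then show ?thesis
    using False by (simp add: powr_numeral)
qed

lemma log_osc_integrable:
  assumes "0 \<le> p" "p \<le> 2"
  shows "set_integrable lborel {0<..<1::real} (\<lambda>x. \<bar>- ln x - 1\<bar> powr p)"
proof -
  have "set_integrable lborel {0<..<1::real} (\<lambda>x. 2 + (- ln x) ^ 2)"
    by (intro set_integral_add(1) set_integrable_const_Ioo set_integrable_minus_ln_power)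
  then show ?thesis
    unfolding set_integrable_def
  proof (rule Bochner_Integration.integrable_bound)
    have "\<bar>- ln x - 1\<bar> powr p \<le> 2 + (- ln x) ^ 2" if x: "0 < x" "x < 1" for x
    proof -
      have "\<bar>- ln x - 1\<bar> powr p \<le> 1 + (- ln x - 1)\<^sup>2"
        by (rule abs_powr_le_quadratic[OF assms])
      also have "\<dots> \<le> 2 + (- ln x) ^ 2"
        using ln_less_zero[OF x] by (simp add: power2_eq_square algebra_simps)
      finally show ?thesis .
    qed
    then show "AE x in lborel. norm (indicat_real {0<..<1} x *\<^sub>R \<bar>- ln x - 1\<bar> powr p) \<le>
      norm (indicat_real {0<..<1} x *\<^sub>R (2 + (- ln x) ^ 2))"
      by (auto simp: indicator_def)
  qed simp
qed

lemma log_osc_nonneg: "0 \<le> log_osc p"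
  unfolding log_osc_def set_lebesgue_integral_def by (rule integral_nonneg_AE) (auto simp: indicator_def)

text \<open>
  If \<open>x\<close> is uniform on \<open>(0,1)\<close>, then \<open>- ln x\<close> is exponentially distributed, and its residue
  modulo \<open>- ln \<alpha>\<close> is independent of its integer part and distributed like \<open>- ln x\<close>
  on \<open>(\<alpha>,1)\<close>. Conditioning on the residue therefore does not increase the oscillation.
\<close>

lemma log_osc_ge_Ioo:
  assumes p: "1 \<le> p" "p \<le> 2" and \<alpha>: "0 < \<alpha>" "\<alpha> < 1"
    and c: "c = (LINT x:{\<alpha><..<1}|lborel. - ln x) / (1 - \<alpha>)"
  shows "(LINT x:{\<alpha><..<1}|lborel. \<bar>- ln x - c\<bar> powr p) \<le> (1 - \<alpha>) * log_osc p"
proof -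
  let ?U = "{0<..<1::real}"
  define A where "A = - ln \<alpha>"
  have A: "A > 0"
    using \<alpha> by (simp add: A_def)
  have c': "(c - 1) * (1 - \<alpha>) = - \<alpha> * A"
    using \<alpha> by (simp add: c set_integral_minus_ln_Ioo A_def left_diff_distrib)
  \<comment> \<open>\<open>A * n x\<close> is the largest multiple of \<open>A\<close> up to
    \<open>- ln x\<close>. The residue minus its mean \<open>c\<close> is \<open>b x\<close>,
    \<open>h x\<close> is the slope of the power at \<open>b x\<close>, and
    \<open>b x + k x = - ln x - 1\<close>.\<close>
  define n where "n = (\<lambda>x. real_of_int \<lfloor>- ln x / A\<rfloor>)"
  define b where "b = (\<lambda>x. - ln x - A * n x - c)"
  define h where "h = (\<lambda>x. p * sgn (b x) * \<bar>b x\<bar> powr (p - 1))"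
  define k where "k = (\<lambda>x. A * n x + c - 1)"
  have n_step: "n (\<alpha> * x) = n x + 1" if "0 < x" for x
  proof -
    have "- ln (\<alpha> * x) / A = - ln x / A + 1"
      using that \<alpha> A by (simp add: ln_mult A_def field_simps)
    then have "n (\<alpha> * x) = real_of_int \<lfloor>- ln x / A + 1\<rfloor>"
      by (simp only: n_def)
    also have "\<lfloor>- ln x / A + 1\<rfloor> = \<lfloor>- ln x / A\<rfloor> + 1"
      by (rule one_add_floor[symmetric])
    finally show ?thesis
      by (simp add: n_def)
  qed
  have b_step: "b (\<alpha> * x) = b x" if "0 < x" for x
    using that \<alpha> by (simp add: b_def n_step ln_mult A_def algebra_simps)
  have h_step: "h (\<alpha> * x) = h x" if "0 < x" for x
    using that by (simp add: h_def b_step)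
  have k_step: "k (\<alpha> * x) = k x + A" if "0 < x" for x
    using that by (simp add: k_def n_step algebra_simps)
  have n0: "n x = 0" if "x \<in> {\<alpha><..<1}" for x
  proof -
    have "ln \<alpha> < ln x" "ln x < 0"
      using that \<alpha> by auto
    then have "0 \<le> - ln x / A" "- ln x / A < 1"
      using A divide_nonneg_pos[of "- ln x" A] pos_divide_less_eq[of A "- ln x" 1] by (auto simp: A_def)
    then show ?thesis
      by (simp add: n_def floor_eq_iff)
  qed
  have n_bd: "0 \<le> n x" "A * n x \<le> - ln x" "- ln x < A * n x + A" if "x \<in> ?U" for x
  proof -
    have "ln x < 0"
      using that by simp
    then show "0 \<le> n x"
      using A by (simp add: n_def divide_nonpos_pos)
    have "n x \<le> - ln x / A" "- ln x / A < n x + 1"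
      unfolding n_def by linarith+
    then show "A * n x \<le> - ln x" "- ln x < A * n x + A"
      using A by (auto simp: field_simps)
  qed
  have b_bd: "\<bar>b x\<bar> \<le> A + \<bar>c\<bar>" if "x \<in> ?U" for x
    using n_bd[OF that] by (auto simp: b_def)
  have meas: "b \<in> borel_measurable borel" "h \<in> borel_measurable borel" "k \<in> borel_measurable borel"
    unfolding h_def b_def k_def n_def by measurable
  have bp: "set_integrable lborel ?U (\<lambda>x. \<bar>b x\<bar> powr p)"
    unfolding set_integrable_def
    by (rule Bochner_Integration.integrable_bound[OF set_integrable_const_Ioo[of 0 1 "(A + \<bar>c\<bar>) powr p", unfolded set_integrable_def]])
      (use meas b_bd p in \<open>auto simp: indicator_def intro!: powr_mono2\<close>)
  let ?H = "p * (A + \<bar>c\<bar>) powr (p - 1)"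
  have h_bd: "\<bar>h x\<bar> \<le> ?H" if "x \<in> ?U" for x
  proof -
    have "\<bar>h x\<bar> = p * \<bar>sgn (b x)\<bar> * \<bar>b x\<bar> powr (p - 1)"
      using p by (simp add: h_def abs_mult)
    also have "\<dots> \<le> p * 1 * (A + \<bar>c\<bar>) powr (p - 1)"
      using p b_bd[OF that] by (intro mult_mono powr_mono2) (auto simp: abs_sgn_eq)
    finally show ?thesis
      by simp
  qed
  have hi: "set_integrable lborel ?U h"
    unfolding set_integrable_def
    by (rule Bochner_Integration.integrable_bound[OF set_integrable_const_Ioo[of 0 1 ?H, unfolded set_integrable_def]])
      (use meas h_bd p in \<open>fastforce simp: indicator_def\<close>)+
  have hk: "set_integrable lborel ?U (\<lambda>x. h x * k x)"
  proof -
    have "set_integrable lborel ?U (\<lambda>x. ?H * ((- ln x) ^ 1 + (\<bar>c\<bar> + 1)))"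
      by (intro set_integrable_mult_right set_integral_add(1) set_integrable_const_Ioo set_integrable_minus_ln_power)
    then show ?thesis
      unfolding set_integrable_def
    proof (rule Bochner_Integration.integrable_bound)
      have "\<bar>h x * k x\<bar> \<le> ?H * (- ln x + (\<bar>c\<bar> + 1))" if "x \<in> ?U" for x
      proof -
        have "0 \<le> A * n x"
          using A n_bd(1)[OF that] by simp
        then have "\<bar>k x\<bar> \<le> - ln x + (\<bar>c\<bar> + 1)"
          unfolding k_def using n_bd(2)[OF that] by linarith
        then show ?thesis
          unfolding abs_mult using h_bd[OF that] p by (intro mult_mono) auto
      qed
      moreover have "0 \<le> ?H * (- ln x + (\<bar>c\<bar> + 1))" if "x \<in> ?U" for x
      proof -
        have "ln x < 0"
          using that by simp
        then have "0 \<le> - ln x + (\<bar>c\<bar> + 1)"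
          by linarith
        then show ?thesis
          using p by (intro mult_nonneg_nonneg) auto
      qed
      ultimately show "AE x in lborel. norm (indicat_real ?U x *\<^sub>R (h x * k x)) \<le>
        norm (indicat_real ?U x *\<^sub>R (?H * ((- ln x) ^ 1 + (\<bar>c\<bar> + 1))))"
        by (auto simp: indicator_def abs_of_nonneg)
    qed (use meas in measurable)
  qed
  define S where "S = (LINT x:?U|lborel. \<bar>b x\<bar> powr p)"
  define G where "G = (LINT x:?U|lborel. h x)"
  define R where "R = (LINT x:?U|lborel. h x * k x)"
  have "(LINT x:?U|lborel. \<bar>b (\<alpha> * x)\<bar> powr p) = S"
    unfolding S_def by (rule set_lebesgue_integral_cong) (auto simp: b_step)
  moreover have "(LINT x:{\<alpha><..<1}|lborel. \<bar>b x\<bar> powr p) = (LINT x:{\<alpha><..<1}|lborel. \<bar>- ln x - c\<bar> powr p)"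
    by (rule set_lebesgue_integral_cong) (auto simp: b_def n0)
  ultimately have S: "(1 - \<alpha>) * S = (LINT x:{\<alpha><..<1}|lborel. \<bar>- ln x - c\<bar> powr p)"
    using set_integral_self_similar[OF bp \<alpha>] by (simp add: S_def algebra_simps)
  have "(LINT x:?U|lborel. h (\<alpha> * x)) = G"
    unfolding G_def by (rule set_lebesgue_integral_cong) (auto simp: h_step)
  then have G: "(1 - \<alpha>) * G = (LINT x:{\<alpha><..<1}|lborel. h x)"
    using set_integral_self_similar[OF hi \<alpha>] by (simp add: G_def algebra_simps)
  have "(LINT x:?U|lborel. h (\<alpha> * x) * k (\<alpha> * x)) = (LINT x:?U|lborel. h x * k x + A * h x)"
    by (rule set_lebesgue_integral_cong) (auto simp: h_step k_step distrib_left)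
  also have "\<dots> = R + A * G"
    unfolding R_def G_def using hk hi by (subst set_integral_add(2)) auto
  finally have "(LINT x:?U|lborel. h (\<alpha> * x) * k (\<alpha> * x)) = R + A * G" .
  moreover have "(LINT x:{\<alpha><..<1}|lborel. h x * k x) = (LINT x:{\<alpha><..<1}|lborel. (c - 1) * h x)"
    by (rule set_lebesgue_integral_cong) (auto simp: k_def n0)
  ultimately have "R = (c - 1) * ((1 - \<alpha>) * G) + \<alpha> * (R + A * G)"
    using set_integral_self_similar[OF hk \<alpha>] by (simp add: R_def G)
  also have "\<dots> = ((c - 1) * (1 - \<alpha>) + \<alpha> * A) * G + \<alpha> * R"
    by (simp add: algebra_simps)
  \<comment> \<open>The first-order term vanishes: by \<open>c'\<close>, the jump \<open>A\<close>
    of \<open>k\<close> from one scale to the next balances its value \<open>c - 1\<close> on the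
    first scale.\<close>
  finally have "(1 - \<alpha>) * R = 0"
    unfolding c' by (simp add: algebra_simps)
  then have R: "R = 0"
    using \<alpha> by simp
  have "S + R = (LINT x:?U|lborel. \<bar>b x\<bar> powr p + h x * k x)"
    unfolding S_def R_def by (rule set_integral_add(2)[OF bp hk, symmetric])
  also have "\<dots> \<le> log_osc p"
    unfolding log_osc_def
  proof (rule set_integral_mono)
    show "set_integrable lborel ?U (\<lambda>x. \<bar>b x\<bar> powr p + h x * k x)"
      by (intro set_integral_add(1) bp hk)
    show "set_integrable lborel ?U (\<lambda>x. \<bar>- ln x - 1\<bar> powr p)"
      using p by (intro log_osc_integrable) auto
    show "\<bar>b x\<bar> powr p + h x * k x \<le> \<bar>- ln x - 1\<bar> powr p" for x
      using powr_tangent_le[OF p(1), of "b x" "- ln x - 1"] by (simp add: h_def k_def b_def)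
  qed
  finally have "S \<le> log_osc p"
    using R by simp
  then have "(1 - \<alpha>) * S \<le> (1 - \<alpha>) * log_osc p"
    using \<alpha> by (intro mult_left_mono) auto
  then show ?thesis
    unfolding S .
qed

lemma minus_ln_oscillation:
  assumes p: "1 \<le> p" "p \<le> 2" and \<alpha>: "0 \<le> \<alpha>" "\<alpha> < 1"
  shows "nn_avg {\<alpha><..<1} (\<lambda>x. \<bar>- ln x - avg {\<alpha><..<1} (\<lambda>x. - ln x)\<bar> powr p) \<le> ennreal (log_osc p)"
proof -
  let ?J = "{\<alpha><..<1}"
  define c where "c = (LINT x:?J|lborel. - ln x) / (1 - \<alpha>)"
  have avg: "avg ?J (\<lambda>x. - ln x) = c"
    unfolding avg_def c_def using \<alpha> by (subst set_integral_lebesgue_eq_lborel) auto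
  have le: "(LINT x:?J|lborel. \<bar>- ln x - c\<bar> powr p) \<le> (1 - \<alpha>) * log_osc p"
  proof (cases "\<alpha> = 0")
    case True
    then have "c = 1"
      by (simp add: c_def set_integral_minus_ln)
    then show ?thesis
      using True by (simp add: log_osc_def)
  next
    case False
    then show ?thesis
      using p \<alpha> by (intro log_osc_ge_Ioo c_def) auto
  qed
  have int: "integrable lborel (\<lambda>x. indicat_real ?J x *\<^sub>R \<bar>- ln x - c\<bar> powr p)"
  proof -
    have "set_integrable lborel {0<..<1} (\<lambda>x. (1 + 2 * c\<^sup>2) + 2 * (- ln x) ^ 2)"
      by (intro set_integral_add(1) set_integrable_mult_right set_integrable_const_Ioo set_integrable_minus_ln_power)
    then have "set_integrable lborel {0<..<1} (\<lambda>x. \<bar>- ln x - c\<bar> powr p)"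
      unfolding set_integrable_def
    proof (rule Bochner_Integration.integrable_bound)
      have "\<bar>- ln x - c\<bar> powr p \<le> \<bar>(1 + 2 * c\<^sup>2) + 2 * (- ln x) ^ 2\<bar>" for x
      proof -
        have "\<bar>- ln x - c\<bar> powr p \<le> 1 + (- ln x - c)\<^sup>2"
          using p by (intro abs_powr_le_quadratic) auto
        also have "\<dots> \<le> (1 + 2 * c\<^sup>2) + 2 * (- ln x) ^ 2"
          using zero_le_power2[of "- ln x + c"] by (simp add: power2_eq_square algebra_simps)
        finally show ?thesis
          by simp
      qed
      then show "AE x in lborel. norm (indicat_real {0<..<1} x *\<^sub>R \<bar>- ln x - c\<bar> powr p) \<le>
        norm (indicat_real {0<..<1} x *\<^sub>R ((1 + 2 * c\<^sup>2) + 2 * (- ln x) ^ 2))"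
        by (auto simp: indicator_def)
    qed simp
    then have "set_integrable lborel ?J (\<lambda>x. \<bar>- ln x - c\<bar> powr p)"
      by (rule set_integrable_subset) (use \<alpha> in auto)
    then show ?thesis
      by (simp add: set_integrable_def)
  qed
  have "(\<integral>\<^sup>+x\<in>?J. ennreal (\<bar>- ln x - c\<bar> powr p) \<partial>lebesgue) =
    (\<integral>\<^sup>+x. ennreal (indicat_real ?J x *\<^sub>R \<bar>- ln x - c\<bar> powr p) \<partial>lborel)"
    unfolding nn_integral_completion by (intro nn_integral_cong) (auto simp: indicator_def)
  also have "\<dots> = ennreal (LINT x:?J|lborel. \<bar>- ln x - c\<bar> powr p)"
    unfolding set_lebesgue_integral_def by (rule nn_integral_eq_integral[OF int]) auto
  also have "\<dots> \<le> ennreal ((1 - \<alpha>) * log_osc p)"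
    by (rule ennreal_leI[OF le])
  finally have "nn_avg ?J (\<lambda>x. \<bar>- ln x - c\<bar> powr p) \<le> ennreal ((1 - \<alpha>) * log_osc p) / ennreal (1 - \<alpha>)"
    unfolding nn_avg_def using \<alpha> by (simp add: divide_right_mono_ennreal)
  also have "\<dots> = ennreal (log_osc p)"
    using \<alpha> log_osc_nonneg[of p] by (simp add: divide_ennreal)
  finally show ?thesis
    unfolding avg .
qed

section \<open>The logarithm on an arbitrary interval\<close>

lemma loc_integrable_minus_ln:
  assumes "Q \<subseteq> {a..}"
  shows "loc_integrable Q (\<lambda>x. - ln (x - a))"
proof (rule loc_integrableI)
  fix \<alpha> \<beta> :: real assume ab: "\<alpha> < \<beta>" "{\<alpha><..<\<beta>} \<subseteq> Q"
  then have a: "a \<le> \<alpha>"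
    using assms dense[of \<alpha> "min a \<beta>"] by (force simp: subset_iff not_le[symmetric])
  define s where "s = \<beta> - a"
  have s: "s > 0"
    using a ab by (simp add: s_def)
  have "set_integrable lborel {0<..<1} (\<lambda>x. - ln s + (- ln x) ^ 1)"
    by (intro set_integral_add(1) set_integrable_const_Ioo set_integrable_minus_ln_power)
  also have "?this \<longleftrightarrow> set_integrable lborel {0<..<1} (\<lambda>x. - ln (a + s * x - a))"
    by (rule set_integrable_cong) (use s in \<open>auto simp: ln_mult\<close>)
  finally have "set_integrable lebesgue {0<..<1} (\<lambda>x. - ln (a + s * x - a))"
    by (subst set_integrable_lebesgue_iff_lborel) auto
  then have "set_integrable lebesgue {a + s * 0<..<a + s * 1} (\<lambda>x. - ln (x - a))"
    by (subst set_integrable_affine[OF s])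
  then show "set_integrable lebesgue {\<alpha><..<\<beta>} (\<lambda>x. - ln (x - a))"
    by (rule set_integrable_subset) (use a in \<open>auto simp: s_def\<close>)
qed

text \<open>Dilating about \<open>a\<close> changes the function only by the constant
  \<open>ln s\<close>, which does not affect oscillation. The right end can thus be moved to 1,
  leaving the intervals (\<gamma>,1).\<close>

lemma bmo_norm_minus_ln_le:
  assumes p: "1 \<le> p" "p \<le> 2" and Q: "Q \<subseteq> {a..}"
  shows "bmo_norm p Q (\<lambda>x. - ln (x - a)) \<le> ennreal (log_osc p powr (1 / p))"
proof (rule bmo_norm_le_openI)
  fix \<alpha> \<beta> :: real assume ab: "\<alpha> < \<beta>" "{\<alpha><..<\<beta>} \<subseteq> Q"
  then have a: "a \<le> \<alpha>"
    using Q dense[of \<alpha> "min a \<beta>"] by (force simp: subset_iff not_le[symmetric])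
  let ?f = "\<lambda>x. - ln (x - a)"
  define s where "s = \<beta> - a"
  define \<gamma> where "\<gamma> = (\<alpha> - a) / s"
  have s: "s > 0"
    using a ab by (simp add: s_def)
  have \<gamma>: "0 \<le> \<gamma>" "\<gamma> < 1"
    using a ab s by (auto simp: \<gamma>_def s_def)
  have J: "{\<alpha><..<\<beta>} = {a + s * \<gamma><..<a + s * 1}"
    using s by (simp add: \<gamma>_def) (simp add: s_def)
  have f: "?f (a + s * x) = - ln x - ln s" if "x \<in> {\<gamma><..<1}" for x
    using that \<gamma> s by (simp add: ln_mult)
  have i: "set_integrable lebesgue {\<gamma><..<1} (\<lambda>x. - ln x)"
    using loc_integrableD[OF loc_integrable_minus_ln[of "{0..}" 0], of \<gamma> 1] \<gamma> by (simp add: subset_iff)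
  have "avg {\<alpha><..<\<beta>} ?f = avg {\<gamma><..<1} (\<lambda>x. ?f (a + s * x))"
    unfolding J by (rule avg_affine[OF s \<gamma>(2)])
  also have "\<dots> = avg {\<gamma><..<1} (\<lambda>x. - ln x - ln s)"
    unfolding avg_def by (rule arg_cong[where f="\<lambda>y. y / _"], rule set_lebesgue_integral_cong) (use f in auto)
  also have "\<dots> = avg {\<gamma><..<1} (\<lambda>x. - ln x) - ln s"
    using avg_diff[OF i set_integrable_const_interval[of \<gamma> 1 "ln s"]] avg_const[OF \<gamma>(2), of "ln s"] by simp
  finally have av: "avg {\<alpha><..<\<beta>} ?f = avg {\<gamma><..<1} (\<lambda>x. - ln x) - ln s" .
  have "nn_avg {\<alpha><..<\<beta>} (\<lambda>x. \<bar>?f x - avg {\<alpha><..<\<beta>} ?f\<bar> powr p) =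
    nn_avg {\<gamma><..<1} (\<lambda>x. \<bar>?f (a + s * x) - avg {\<alpha><..<\<beta>} ?f\<bar> powr p)"
  proof -
    let ?h = "\<lambda>x. \<bar>?f x - avg {\<alpha><..<\<beta>} ?f\<bar> powr p"
    have "(\<lambda>x. indicat_real {a + s * \<gamma><..<a + s * 1} x *\<^sub>R ?h x) \<in> borel_measurable borel"
      by measurable
    then have "set_borel_measurable lebesgue {a + s * \<gamma><..<a + s * 1} ?h"
      unfolding set_borel_measurable_def by (intro measurable_completion) simp
    from nn_avg_affine[OF s \<gamma>(2) this] show ?thesis
      unfolding J[symmetric] .
  qed
  also have "\<dots> = nn_avg {\<gamma><..<1} (\<lambda>x. \<bar>- ln x - avg {\<gamma><..<1} (\<lambda>x. - ln x)\<bar> powr p)"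
    unfolding nn_avg_def
    by (rule arg_cong[where f="\<lambda>y. y / _"], rule nn_integral_cong) (use f in \<open>auto simp: indicator_def av\<close>)
  also have "\<dots> \<le> ennreal (log_osc p)"
    by (rule minus_ln_oscillation[OF p \<gamma>])
  finally show "nn_avg {\<alpha><..<\<beta>} (\<lambda>x. \<bar>?f x - avg {\<alpha><..<\<beta>} ?f\<bar> powr p) \<le> ennreal ((log_osc p powr (1 / p)) powr p)"
    using p log_osc_nonneg[of p] by (simp add: powr_powr)
qed (use p in auto)

lemma minus_ln_in_BMO: "Q \<subseteq> {a..} \<Longrightarrow> (\<lambda>x. - ln (x - a)) \<in> BMO Q"
  using bmo_norm_minus_ln_le[of 1 Q a] loc_integrable_minus_ln[of Q a]
  by (auto simp: BMO_def intro: order_le_less_trans)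

text \<open>For an exponent \<epsilon> of at least 1, a finite integral \<open>I\<close> would
  satisfy \<open>I \<ge> 1/2 + 2 powr \<epsilon> / 2 * I \<ge> 1/2 + I\<close> by self-similarity.
  So the weight is not even locally integrable.\<close>

lemma eps_Ainf_minus_ln_le_1:
  assumes Q: "bounded_interval Q" "{a<..<b} \<subseteq> Q" "a < b"
  shows "eps_Ainf Q (\<lambda>x. - ln (x - a)) \<le> 1"
  unfolding eps_Ainf_def
proof (rule Sup_least, clarify)
  fix \<epsilon> :: real assume "\<epsilon> > 0" and "(\<lambda>x. exp (\<epsilon> * - ln (x - a))) \<in> Ainf Q"
  then have li: "loc_integrable Q (\<lambda>x. exp (\<epsilon> * - ln (x - a)))"
    by (simp add: Ainf_def)
  have "\<epsilon> < 1"
  proof (rule ccontr)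
    assume "\<not> \<epsilon> < 1"
    then have \<epsilon>: "1 \<le> \<epsilon>"
      by simp
    let ?U = "{0<..<1::real}" and ?f = "\<lambda>x. exp (\<epsilon> * - ln x)"
    define s where "s = b - a"
    have s: "s > 0"
      using Q by (simp add: s_def)
    have "set_integrable lebesgue {a + s * 0<..<a + s * 1} (\<lambda>x. exp (\<epsilon> * - ln (x - a)))"
      using loc_integrableD[OF li Q(3,2)] by (simp add: s_def)
    then have "set_integrable lebesgue ?U (\<lambda>x. exp (\<epsilon> * - ln (a + s * x - a)))"
      unfolding set_integrable_affine[OF s] .
    also have "?this \<longleftrightarrow> set_integrable lebesgue ?U (\<lambda>x. exp (\<epsilon> * - ln s) * ?f x)"
      by (rule set_integrable_cong) (use s in \<open>auto simp: ln_mult exp_add[symmetric] algebra_simps\<close>)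
    finally have "set_integrable lebesgue ?U ?f"
      by simp
    then have i: "set_integrable lborel ?U ?f"
      by (subst (asm) set_integrable_lebesgue_iff_lborel) auto
    define I where "I = (LINT x:?U|lborel. ?f x)"
    have "(LINT x:?U|lborel. ?f (1/2 * x)) = (LINT x:?U|lborel. 2 powr \<epsilon> * ?f x)"
      by (rule set_lebesgue_integral_cong) (auto simp: ln_mult ln_div powr_def exp_add[symmetric] algebra_simps)
    then have "I = (LINT x:{1/2<..<1::real}|lborel. ?f x) + 1/2 * (2 powr \<epsilon> * I)"
      using set_integral_self_similar[OF i, of "1/2"] by (simp add: I_def)
    moreover have "(LINT x:{1/2<..<1::real}|lborel. 1) \<le> (LINT x:{1/2<..<1::real}|lborel. ?f x)"
      by (intro set_integral_mono set_integrable_const_Ioo set_integrable_subset[OF i])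
        (use \<epsilon> in \<open>auto simp: mult_nonneg_nonpos\<close>)
    then have "1/2 \<le> (LINT x:{1/2<..<1::real}|lborel. ?f x)"
      by (simp add: set_integral_const)
    moreover have "2 * I \<le> 2 powr \<epsilon> * I"
    proof (rule mult_right_mono)
      show "2 \<le> 2 powr \<epsilon>"
        using powr_mono[OF \<epsilon>, of 2] by simp
      show "0 \<le> I"
        unfolding I_def set_lebesgue_integral_def by (rule integral_nonneg_AE) (auto simp: indicator_def)
    qed
    ultimately show False
      by linarith
  qed
  then show "ennreal \<epsilon> \<le> 1"
    by (simp add: ennreal_le_1)
qed

section \<open>Logarithmic growth of decreasing functions\<close>

text \<open>At a point \<open>x0\<close> where \<open>f\<close> changes sign, \<open>f x\<close> and
  \<open>h x - h x0\<close> have the same sign for every x. Subtracting the constant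
  \<open>h x0\<close> is free because \<open>f\<close> has mean zero.\<close>

lemma chebyshev_integral_nonneg:
  fixes f h :: "real \<Rightarrow> real"
  assumes f: "antimono_on {0<..<1} f" and h: "antimono_on {0<..<1} h"
    and fi: "set_integrable lborel {0<..<1} f" and fhi: "set_integrable lborel {0<..<1} (\<lambda>x. f x * h x)"
    and zero: "(LINT x:{0<..<1}|lborel. f x) = 0"
  shows "0 \<le> (LINT x:{0<..<1}|lborel. f x * h x)"
proof -
  let ?U = "{0<..<1::real}"
  have AE0: "(LINT x:?U|lborel. f x * h x) = 0" if "AE x in lborel. indicat_real ?U x *\<^sub>R f x = 0"
  proof -
    have "AE x in lborel. indicat_real ?U x *\<^sub>R (f x * h x) = 0"
      using that by eventually_elim (auto simp: indicator_def)
    then have "(LINT x|lborel. indicat_real ?U x *\<^sub>R (f x * h x)) = (LINT x|(lborel::real measure). 0)"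
      using fhi by (intro integral_cong_AE) (auto simp: set_integrable_def)
    then show ?thesis
      by (simp add: set_lebesgue_integral_def)
  qed
  consider "\<forall>x\<in>?U. f x \<le> 0" | "\<forall>x\<in>?U. 0 \<le> f x" | w z where "w \<in> ?U" "0 < f w" "z \<in> ?U" "f z < 0"
    by (meson not_le)
  then show ?thesis
  proof cases
    case 1
    then have "AE x in lborel. - (indicat_real ?U x *\<^sub>R f x) = 0"
      using fi zero unfolding set_integrable_def set_lebesgue_integral_def
      by (subst integral_nonneg_eq_0_iff_AE[symmetric]) (auto simp: indicator_def)
    then show ?thesis
      using AE0 by simp
  next
    case 2
    then have "AE x in lborel. indicat_real ?U x *\<^sub>R f x = 0"
      using fi zero unfolding set_integrable_def set_lebesgue_integral_def
      by (subst integral_nonneg_eq_0_iff_AE[symmetric]) (auto simp: indicator_def)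
    then show ?thesis
      using AE0 by simp
  next
    case (3 w z)
    let ?S = "{x\<in>?U. 0 \<le> f x}"
    have ub: "x \<le> z" if "x \<in> ?S" for x
    proof (rule ccontr)
      assume "\<not> x \<le> z"
      then have "f x \<le> f z"
        using that 3 by (intro monotone_onD[OF f]) auto
      then show False
        using that 3 by auto
    qed
    have wS: "w \<in> ?S"
      using 3 by auto
    have bdd: "bdd_above ?S"
      using ub by (intro bdd_aboveI[of _ z]) auto
    define x0 where "x0 = Sup ?S"
    have "w \<le> x0"
      unfolding x0_def by (rule cSup_upper[OF wS bdd])
    moreover have "x0 \<le> z"
      unfolding x0_def using wS ub by (intro cSup_least) auto
    ultimately have x0: "x0 \<in> ?U"
      using 3 by auto
    have pt: "0 \<le> f x * (h x - h x0)" if x: "x \<in> ?U" for x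
    proof -
      consider "x < x0" | "x = x0" | "x0 < x"
        by linarith
      then show ?thesis
      proof cases
        case 1
        then obtain s where s: "s \<in> ?S" "x < s"
          unfolding x0_def using less_cSup_iff[OF _ bdd] wS by auto
        have "f s \<le> f x"
          using s x by (intro monotone_onD[OF f]) auto
        moreover have "h x0 \<le> h x"
          using 1 x x0 by (intro monotone_onD[OF h]) auto
        ultimately show ?thesis
          using s by auto
      next
        case 3
        then have "x \<notin> ?S"
          unfolding x0_def using cSup_upper[OF _ bdd, of x] by auto
        moreover have "h x \<le> h x0"
          using 3 x x0 by (intro monotone_onD[OF h]) auto
        ultimately show ?thesis
          using x by (intro mult_nonpos_nonpos) auto
      qed simp
    qed
    have "0 \<le> (LINT x:?U|lborel. f x * (h x - h x0))"
      unfolding set_lebesgue_integral_def by (rule integral_nonneg_AE) (use pt in \<open>auto simp: indicator_def\<close>)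
    also have "\<dots> = (LINT x:?U|lborel. f x * h x - h x0 * f x)"
      by (simp add: algebra_simps)
    also have "\<dots> = (LINT x:?U|lborel. f x * h x)"
      using zero fi by (subst set_integral_diff(2)[OF fhi]) auto
    finally show ?thesis .
  qed
qed

lemma set_integrable_Ioo_bound:
  fixes f g :: "real \<Rightarrow> real"
  assumes g: "set_integrable lborel {a<..<b} g" and f: "f \<in> borel_measurable borel"
    and le: "\<And>x. x \<in> {a<..<b} \<Longrightarrow> \<bar>f x\<bar> \<le> g x"
  shows "set_integrable lborel {a<..<b} f"
  using g unfolding set_integrable_def
  by (rule Bochner_Integration.integrable_bound)
    (use f order_trans[OF le abs_ge_self] in \<open>auto simp: indicator_def intro!: AE_I2\<close>)

text \<open>
  Up to the factor \<open>p\<close>, this is the gradient of \<open>u \<mapsto> \<integral> \<bar>u\<bar>\<^sup>p\<close> at \<open>u = - ln x - 1\<close>. Pairing with it linearises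
  the oscillation, so that averaging over dilations becomes an application of Fubini's theorem.
\<close>

definition log_dual :: "real \<Rightarrow> real \<Rightarrow> real" where
  "log_dual p x = sgn (- ln x - 1) * \<bar>- ln x - 1\<bar> powr (p - 1)"

text \<open>Removing the mean makes the pairing blind to additive constants such as
  \<open>T r\<close>, and provides the mean-zero factor for Chebyshev's inequality.\<close>

definition log_dual0 :: "real \<Rightarrow> real \<Rightarrow> real" where
  "log_dual0 p x = log_dual p x - (LINT x:{0<..<1}|lborel. log_dual p x)"

lemma log_dual_measurable [measurable]: "log_dual p \<in> borel_measurable borel"
  unfolding log_dual_def by measurable

lemma log_dual0_measurable [measurable]: "log_dual0 p \<in> borel_measurable borel"
  unfolding log_dual0_def by measurable

lemma abs_powr_le_linear:
  fixes z q :: real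
  assumes "0 \<le> q" "q \<le> 1"
  shows "\<bar>z\<bar> powr q \<le> 1 + \<bar>z\<bar>"
proof (cases "\<bar>z\<bar> \<le> 1")
  case True
  then have "\<bar>z\<bar> powr q \<le> 1"
    using assms by (intro powr_le1) auto
  then show ?thesis
    by simp
next
  case False
  then have "\<bar>z\<bar> powr q \<le> \<bar>z\<bar> powr 1"
    using assms by (intro powr_mono) auto
  then show ?thesis
    using False by simp
qed

context
  fixes p :: real
  assumes p: "1 \<le> p" "p \<le> 2"
begin

lemma log_dual_bound:
  assumes "x \<in> {0<..<1}"
  shows "\<bar>log_dual p x\<bar> \<le> 2 - ln x"
proof -
  have "\<bar>log_dual p x\<bar> = \<bar>sgn (- ln x - 1)\<bar> * \<bar>- ln x - 1\<bar> powr (p - 1)"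
    by (simp add: log_dual_def abs_mult)
  also have "\<dots> \<le> 1 * (1 + \<bar>- ln x - 1\<bar>)"
    using p by (intro mult_mono abs_powr_le_linear) (auto simp: abs_sgn_eq)
  also have "\<dots> \<le> 2 - ln x"
  proof -
    have "ln x < 0"
      using assms by simp
    then have "\<bar>- ln x - 1\<bar> \<le> - ln x + 1"
      by (intro abs_leI) auto
    then show ?thesis
      by simp
  qed
  finally show ?thesis .
qed

lemma log_dual_integrable: "set_integrable lborel {0<..<1} (log_dual p)"
proof (rule set_integrable_Ioo_bound)
  show "set_integrable lborel {0<..<1::real} (\<lambda>x. 2 + (- ln x) ^ 1)"
    by (intro set_integral_add(1) set_integrable_const_Ioo set_integrable_minus_ln_power)
qed (use log_dual_bound in auto)

lemma log_dual0_bound: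
  obtains M where "0 \<le> M" "\<And>x. x \<in> {0<..<1} \<Longrightarrow> \<bar>log_dual0 p x\<bar> \<le> M - ln x"
proof -
  let ?m = "LINT x:{0<..<1}|lborel. log_dual p x"
  show ?thesis
  proof (rule that[of "2 + \<bar>?m\<bar>"])
    show "\<bar>log_dual0 p x\<bar> \<le> 2 + \<bar>?m\<bar> - ln x" if "x \<in> {0<..<1}" for x
      using log_dual_bound[OF that] abs_triangle_ineq4[of "log_dual p x" ?m] by (simp add: log_dual0_def)
  qed simp
qed

lemma log_dual0_integrable: "set_integrable lborel {0<..<1} (log_dual0 p)"
  unfolding log_dual0_def by (intro set_integral_diff(1) log_dual_integrable set_integrable_const_Ioo)

lemma log_dual0_integral: "(LINT x:{0<..<1}|lborel. log_dual0 p x) = 0"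
  unfolding log_dual0_def
  by (subst set_integral_diff(2)[OF log_dual_integrable set_integrable_const_Ioo]) (simp add: set_integral_const)

lemma log_dual0_antimono: "antimono_on {0<..<1} (log_dual0 p)"
proof (rule monotone_onI)
  fix x y :: real assume xy: "x \<in> {0<..<1}" "y \<in> {0<..<1}" "x \<le> y"
  have mono: "sgn a * \<bar>a\<bar> powr (p - 1) \<le> sgn b * \<bar>b\<bar> powr (p - 1)" if "a \<le> b" for a b :: real
  proof -
    consider "0 < a" | "a \<le> 0" "0 \<le> b" | "b < 0"
      by linarith
    then show ?thesis
    proof cases
      case 1
      then show ?thesis
        using that p by (auto intro!: powr_mono2)
    next
      case 2
      have "sgn a * \<bar>a\<bar> powr (p - 1) \<le> 0" "0 \<le> sgn b * \<bar>b\<bar> powr (p - 1)"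
        using 2 by (auto simp: sgn_if)
      then show ?thesis
        by linarith
    next
      case 3
      then show ?thesis
        using that p by (auto intro!: powr_mono2)
    qed
  qed
  have "ln x \<le> ln y"
    using xy by auto
  then show "log_dual0 p y \<le> log_dual0 p x"
    by (simp add: log_dual0_def log_dual_def mono)
qed

text \<open>Degree two is what is needed later: in \<open>- ln x\<close>, the function
  \<open>D\<close> grows at most linearly and its logarithmic primitive \<open>H\<close> at most
  quadratically.\<close>

lemma log_dual_times_integrable:
  "set_integrable lborel {0<..<1} (\<lambda>x. log_dual0 p x * (a + b * (- ln x) + d * (- ln x) ^ 2))"
proof -
  obtain M where M: "0 \<le> M" "\<And>x. x \<in> {0<..<1} \<Longrightarrow> \<bar>log_dual0 p x\<bar> \<le> M - ln x"
    using log_dual0_bound by blast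
  show ?thesis
  proof (rule set_integrable_Ioo_bound)
    show "set_integrable lborel {0<..<1::real} (\<lambda>x. M * \<bar>a\<bar> + (M * \<bar>b\<bar> + \<bar>a\<bar>) * (- ln x) ^ 1 + (M * \<bar>d\<bar> + \<bar>b\<bar>) * (- ln x) ^ 2 + \<bar>d\<bar> * (- ln x) ^ 3)"
      by (intro set_integral_add(1) set_integrable_mult_right set_integrable_const_Ioo set_integrable_minus_ln_power)
    fix x :: real assume x: "x \<in> {0<..<1}"
    define l where "l = - ln x"
    have l: "0 \<le> l"
      using x by (auto simp: l_def)
    have "\<bar>a + b * l + d * l\<^sup>2\<bar> \<le> \<bar>a\<bar> + \<bar>b\<bar> * l + \<bar>d\<bar> * l\<^sup>2"
      using abs_triangle_ineq[of "a + b * l" "d * l\<^sup>2"] abs_triangle_ineq[of a "b * l"] l by (simp add: abs_mult)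
    then have "\<bar>log_dual0 p x * (a + b * l + d * l\<^sup>2)\<bar> \<le> (M + l) * (\<bar>a\<bar> + \<bar>b\<bar> * l + \<bar>d\<bar> * l\<^sup>2)"
      unfolding abs_mult using M(1) M(2)[OF x] l by (intro mult_mono) (auto simp: l_def)
    also have "\<dots> = M * \<bar>a\<bar> + (M * \<bar>b\<bar> + \<bar>a\<bar>) * l ^ 1 + (M * \<bar>d\<bar> + \<bar>b\<bar>) * l ^ 2 + \<bar>d\<bar> * l ^ 3"
      by (simp add: algebra_simps power2_eq_square power3_eq_cube)
    finally show "\<bar>log_dual0 p x * (a + b * (- ln x) + d * (- ln x) ^ 2)\<bar> \<le> M * \<bar>a\<bar> + (M * \<bar>b\<bar> + \<bar>a\<bar>) * (- ln x) ^ 1 + (M * \<bar>d\<bar> + \<bar>b\<bar>) * (- ln x) ^ 2 + \<bar>d\<bar> * (- ln x) ^ 3"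
      by (simp add: l_def)
  qed simp
qed

text \<open>For \<open>z = - ln x - 1\<close> the product of
  \<open>sgn z * \<bar>z\<bar> powr (p - 1)\<close> with \<open>z\<close> is
  \<open>\<bar>z\<bar> powr p\<close>; the remaining terms have mean zero.\<close>

lemma log_dual0_ln_integral: "(LINT x:{0<..<1}|lborel. log_dual0 p x * (- ln x)) = log_osc p"
proof -
  let ?U = "{0<..<1::real}"
  define m where "m = (LINT x:?U|lborel. log_dual p x)"
  have i1: "set_integrable lborel ?U (\<lambda>x. log_dual0 p x * (- ln x))"
    using log_dual_times_integrable[of 0 1 0] by simp
  have i2: "set_integrable lborel ?U (\<lambda>x. \<bar>- ln x - 1\<bar> powr p)"
    using p by (intro log_osc_integrable) auto
  have i3: "set_integrable lborel ?U (\<lambda>x. (- ln x) - 1)"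
    using set_integrable_minus_ln_power[of 1] by (intro set_integral_diff(1) set_integrable_const_Ioo) simp
  have i3': "(LINT x:?U|lborel. (- ln x) - 1) = 0"
    using set_integrable_minus_ln_power[of 1] set_integral_minus_ln
    by (subst set_integral_diff(2)[OF _ set_integrable_const_Ioo]) (auto simp: set_integral_const)
  have "log_dual0 p x * (- ln x) = \<bar>- ln x - 1\<bar> powr p - m * (- ln x - 1) + log_dual0 p x" for x
  proof -
    have "sgn z * \<bar>z\<bar> powr (p - 1) * z = \<bar>z\<bar> powr p" for z :: real
      by (cases "z = 0") (auto simp: powr_diff sgn_if)
    from this[of "- ln x - 1"] show ?thesis
      unfolding log_dual0_def log_dual_def m_def[symmetric, unfolded log_dual_def] by (simp add: algebra_simps)
  qed
  then have "(LINT x:?U|lborel. log_dual0 p x * (- ln x)) =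
    (LINT x:?U|lborel. \<bar>- ln x - 1\<bar> powr p - m * (- ln x - 1) + log_dual0 p x)"
    by simp
  also have "\<dots> = log_osc p"
    unfolding log_osc_def using i2 i3 i3' log_dual0_integrable log_dual0_integral
    by (simp add: set_integral_add(2) set_integral_diff set_integrable_mult_right del: set_integrable_mult_right_iff)
  finally show ?thesis .
qed

end

section \<open>Scaled integrals and the integral of 1 / x\<close>

lemma set_integrable_unit_scale:
  fixes f :: "real \<Rightarrow> real"
  assumes f: "set_integrable lborel {0<..<1} f" and r: "0 < r" "r \<le> 1"
  shows "set_integrable lborel {0<..<1} (\<lambda>x. f (r * x))"
proof -
  have "set_integrable lborel {r * 0<..<r * 1} f"
    by (rule set_integrable_subset[OF f]) (use r in auto)
  then show ?thesis
    unfolding set_integrable_scale_lborel[OF r(1)] .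
qed

lemma set_integral_Ioo_split:
  fixes f :: "real \<Rightarrow> real"
  assumes "a < b" "b < c" and f: "set_integrable lborel {a<..<c} f"
  shows "(LINT x:{a<..<c}|lborel. f x) = (LINT x:{a<..<b}|lborel. f x) + (LINT x:{b<..<c}|lborel. f x)"
proof -
  have "(LINT x:{a<..<c}|lborel. f x) = (LINT x:{a<..<b} \<union> {b..<c}|lborel. f x)"
    by (rule arg_cong[where f="\<lambda>S. set_lebesgue_integral lborel S f"]) (use assms in auto)
  also have "\<dots> = (LINT x:{a<..<b}|lborel. f x) + (LINT x:{b..<c}|lborel. f x)"
    by (rule set_integral_Un) (use assms in \<open>auto intro: set_integrable_subset[OF f]\<close>)
  also have "(LINT x:{b..<c}|lborel. f x) = (LINT x:{b<..<c}|lborel. f x)"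
    by (rule set_integral_discrete_difference[of "{b}"]) auto
  finally show ?thesis .
qed

lemma set_integral_inverse:
  fixes a b :: real
  assumes "0 < a" "a < b"
  shows "set_integrable lborel {a<..<b} (\<lambda>x. 1 / x)" "(LINT x:{a<..<b}|lborel. 1 / x) = ln b - ln a"
proof -
  have i: "set_integrable lborel {a..b} (\<lambda>x. 1 / x)"
    by (rule borel_integrable_atLeastAtMost') (use assms in \<open>auto intro!: continuous_intros\<close>)
  then show "set_integrable lborel {a<..<b} (\<lambda>x. 1 / x)"
    by (rule set_integrable_subset) auto
  have "((\<lambda>x. 1 / x) has_integral ln b - ln a) {a..b}"
    by (rule fundamental_theorem_of_calculus)
      (use assms in \<open>auto intro!: derivative_eq_intros simp: has_real_derivative_iff_has_vector_derivative[symmetric]\<close>)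
  then have "(LINT x:{a..b}|lborel. 1 / x) = ln b - ln a"
    unfolding set_borel_integral_eq_integral(2)[OF i] by (rule integral_unique)
  moreover have "(LINT x:{a<..<b}|lborel. 1 / x) = (LINT x:{a..b}|lborel. 1 / x)"
    by (rule set_integral_discrete_difference[of "{a, b}"]) auto
  ultimately show "(LINT x:{a<..<b}|lborel. 1 / x) = ln b - ln a"
    by simp
qed

lemma set_integral_nonneg_real:
  fixes f :: "real \<Rightarrow> real"
  shows "(\<And>x. x \<in> S \<Longrightarrow> 0 \<le> f x) \<Longrightarrow> 0 \<le> (LINT x:S|lborel. f x)"
  unfolding set_lebesgue_integral_def by (rule integral_nonneg_AE) (auto simp: indicator_def)

text \<open>\<open>D\<close> stands for a rescaled rearrangement shifted to mean zero. The mean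
  \<open>T r\<close> and the oscillation over (0,r) are written after rescaling to the unit
  interval, so that dilations act on the argument of \<open>D\<close> alone.\<close>

locale log_growth =
  fixes p \<kappa> :: real and D :: "real \<Rightarrow> real" and T :: "real \<Rightarrow> real"
  assumes p: "1 \<le> p" "p \<le> 2" and \<kappa>: "0 < \<kappa>"
    and D [measurable]: "D \<in> borel_measurable borel" and anti: "antimono_on {0<..1} D"
    and D_int: "set_integrable lborel {0<..<1} D"
    and T_def: "\<And>r. T r = (LINT x:{0<..<1}|lborel. D (r * x))" and T1: "T 1 = 0"
    and osc_int: "\<And>r. 0 < r \<Longrightarrow> r \<le> 1 \<Longrightarrow> set_integrable lborel {0<..<1} (\<lambda>x. \<bar>D (r * x) - T r\<bar> powr p)"
    and osc: "\<And>r. 0 < r \<Longrightarrow> r \<le> 1 \<Longrightarrow>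
      (LINT x:{0<..<1}|lborel. \<bar>D (r * x) - T r\<bar> powr p) \<le> \<kappa> powr p * log_osc p"
begin

definition B :: real where "B = 2 * (1 + \<kappa> powr p * log_osc p)"

lemma B_nonneg: "0 \<le> B"
  using log_osc_nonneg[of p] by (simp add: B_def)

lemma D_scale_int: "0 < r \<Longrightarrow> r \<le> 1 \<Longrightarrow> set_integrable lborel {0<..<1} (\<lambda>x. D (r * x))"
  by (rule set_integrable_unit_scale[OF D_int])

text \<open>The mean over the left half exceeds \<open>T r\<close> by twice an integral of the
  deviation over that half, and \<open>z \<le> 1 + \<bar>z\<bar> powr p\<close> bounds it by the
  oscillation. \<open>B\<close> involves only p and \<kappa>, which keeps later constants uniform in
  \<open>D\<close>.\<close>

lemma T_half_le:
  assumes r: "0 < r" "r \<le> 1"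
  shows "T (r / 2) \<le> T r + B"
proof -
  let ?U = "{0<..<1::real}" and ?H = "{0<..<1/2::real}" and ?y = "\<lambda>x. D (r * x) - T r"
  have i: "set_integrable lborel ?U (\<lambda>x. D (r * x))"
    by (rule D_scale_int[OF r])
  have yU: "set_integrable lborel ?U ?y"
    by (intro set_integral_diff(1) i set_integrable_const_Ioo)
  have iH: "set_integrable lborel ?H (\<lambda>x. D (r * x))"
    by (rule set_integrable_subset[OF i]) auto
  have "(LINT x:{1/2 * 0<..<1/2 * 1}|lborel. D (r * x)) = 1/2 * (LINT x:?U|lborel. D (r * (1/2 * x)))"
    by (rule set_integral_scale_lborel) simp
  then have "T (r / 2) = 2 * (LINT x:?H|lborel. D (r * x))"
    by (simp add: T_def)
  also have "\<dots> = T r + 2 * (LINT x:?H|lborel. ?y x)"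
    by (subst set_integral_diff(2)[OF iH set_integrable_const_Ioo]) (simp add: set_integral_const)
  also have "(LINT x:?H|lborel. ?y x) \<le> (LINT x:?U|lborel. 1 + \<bar>?y x\<bar> powr p)"
    unfolding set_lebesgue_integral_def
  proof (rule integral_mono)
    show "integrable lborel (\<lambda>x. indicat_real ?H x *\<^sub>R ?y x)"
      using set_integrable_subset[OF yU, of ?H] by (simp add: set_integrable_def subset_iff)
    show "integrable lborel (\<lambda>x. indicat_real ?U x *\<^sub>R (1 + \<bar>?y x\<bar> powr p))"
      using set_integral_add(1)[OF set_integrable_const_Ioo osc_int[OF r]] by (simp add: set_integrable_def)
    have "z \<le> 1 + \<bar>z\<bar> powr p" for z :: real
    proof (cases "z \<le> 1")
      case False
      then have "z powr 1 \<le> z powr p"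
        using p by (intro powr_mono) auto
      then show ?thesis
        using False by simp
    qed (simp add: add_increasing2)
    then show "indicat_real ?H x *\<^sub>R ?y x \<le> indicat_real ?U x *\<^sub>R (1 + \<bar>?y x\<bar> powr p)" for x
      by (auto simp: indicator_def)
  qed
  also have "(LINT x:?U|lborel. 1 + \<bar>?y x\<bar> powr p) = 1 + (LINT x:?U|lborel. \<bar>?y x\<bar> powr p)"
    by (subst set_integral_add(2)[OF set_integrable_const_Ioo osc_int[OF r]]) (simp add: set_integral_const)
  finally show ?thesis
    using osc[OF r] by (simp add: B_def)
qed

lemma T_power_le: "T ((1 / 2) ^ n) \<le> real n * B"
proof (induction n)
  case (Suc n)
  have "T ((1 / 2) ^ n / 2) \<le> T ((1 / 2) ^ n) + B"
    by (rule T_half_le) (auto simp: power_le_one)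
  then show ?case
    using Suc by (simp add: algebra_simps)
qed (simp add: T1)

lemma D_le_T:
  assumes r: "0 < r" "r \<le> 1"
  shows "D r \<le> T r"
proof -
  have "(LINT x:{0<..<1::real}|lborel. D r) \<le> (LINT x:{0<..<1}|lborel. D (r * x))"
  proof (intro set_integral_mono set_integrable_const_Ioo D_scale_int r)
    fix x :: real assume "x \<in> {0<..<1}"
    then have x: "0 < x" "x < 1"
      by auto
    then have "0 < r * x" "r * x \<le> r"
      using r by (auto simp: mult_le_cancel_left1)
    then have "0 < r * x" "r * x \<le> r" "r * x \<le> 1"
      using r by linarith+
    then show "D r \<le> D (r * x)"
      using r by (intro monotone_onD[OF anti]) (auto simp del: mult_le_cancel_left1)
  qed
  then show ?thesis
    by (simp add: T_def set_integral_const)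
qed

text \<open>A crude bound by repeated halving. Its rate \<open>2 * B\<close> is not meant to be
  sharp; it provides integrability and error terms that are uniform in \<open>D\<close>.\<close>

lemma D_le_log:
  assumes y: "0 < y" "y \<le> 1"
  shows "D y \<le> B * (1 + 2 * (- ln y))"
proof -
  have l: "0 \<le> - ln y"
    using y by simp
  have ln2: "0 < ln (2::real)"
    by simp
  \<comment> \<open>Then \<open>(1 / 2) ^ (Suc n)\<close> lies at or below \<open>y\<close>, and
    monotonicity compares \<open>D y\<close> with that dyadic point. The factor 2 in the claim comes
    from \<open>ln 2 \<ge> 1/2\<close>.\<close>
  define n where "n = nat \<lfloor>- ln y / ln 2\<rfloor>"
  have n: "real n \<le> - ln y / ln 2" "- ln y / ln 2 < real n + 1"
  proof -
    have "0 \<le> - ln y / ln 2"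
      using l by (intro divide_nonneg_pos) auto
    then have "real n = real_of_int \<lfloor>- ln y / ln 2\<rfloor>"
      by (simp add: n_def)
    then show "real n \<le> - ln y / ln 2" "- ln y / ln 2 < real n + 1"
      by linarith+
  qed
  have "- ln y < (real n + 1) * ln 2"
    using n(2) unfolding pos_divide_less_eq[OF ln2] .
  then have "ln ((1 / 2) ^ (Suc n)) < ln y"
    by (simp add: ln_realpow ln_div ln_mult algebra_simps)
  then have lt: "(1 / 2) ^ (Suc n) \<le> y"
    using y by (simp add: ln_less_cancel_iff less_imp_le)
  have "real n \<le> 2 * (- ln y)"
  proof -
    have "real n * (1 / 2) \<le> real n * ln 2"
      using ln2_ge_two_thirds by (intro mult_left_mono) auto
    also have "\<dots> \<le> - ln y"
      using n(1) unfolding pos_le_divide_eq[OF ln2] .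
    finally show ?thesis
      by simp
  qed
  have "D y \<le> D ((1 / 2) ^ (Suc n))"
    by (rule monotone_onD[OF anti]) (use y lt in \<open>auto simp: power_le_one\<close>)
  also have "\<dots> \<le> T ((1 / 2) ^ (Suc n))"
    by (rule D_le_T) (auto simp del: power_Suc simp: power_le_one)
  also have "\<dots> \<le> real (Suc n) * B"
    by (rule T_power_le)
  also have "\<dots> \<le> (1 + 2 * (- ln y)) * B"
    using \<open>real n \<le> 2 * (- ln y)\<close> B_nonneg by (intro mult_right_mono) auto
  finally show ?thesis
    by (simp add: mult.commute)
qed

lemma abs_D_le:
  assumes y: "0 < y" "y \<le> 1"
  shows "\<bar>D y\<bar> \<le> \<bar>D 1\<bar> + B * (1 + 2 * (- ln y))"
proof -
  have "D 1 \<le> D y"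
    using y by (intro monotone_onD[OF anti]) auto
  moreover have "0 \<le> B * (1 + 2 * (- ln y))"
  proof -
    have "ln y \<le> 0"
      using y by simp
    then have "0 \<le> 1 + 2 * (- ln y)"
      by linarith
    then show ?thesis
      using B_nonneg by (intro mult_nonneg_nonneg)
  qed
  ultimately show ?thesis
    using D_le_log[OF y] by (auto simp: abs_le_iff)
qed

lemma dual_D_int:
  assumes r: "0 < r" "r \<le> 1"
  shows "set_integrable lborel {0<..<1} (\<lambda>x. log_dual0 p x * D (r * x))"
proof (rule set_integrable_Ioo_bound)
  let ?a = "\<bar>D 1\<bar> + B * (1 + 2 * (- ln r))" and ?b = "2 * B"
  show "set_integrable lborel {0<..<1} (\<lambda>x. \<bar>log_dual0 p x * (?a + ?b * (- ln x) + 0 * (- ln x) ^ 2)\<bar>)"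
    by (intro set_integrable_abs log_dual_times_integrable p)
  fix x :: real assume "x \<in> {0<..<1}"
  then have x: "0 < x" "x < 1"
    by auto
  have rx: "0 < r * x" "r * x \<le> 1"
    using x r by (auto simp: mult_le_one)
  have "\<bar>D (r * x)\<bar> \<le> ?a + ?b * (- ln x)"
    using abs_D_le[OF rx] x r by (simp add: ln_mult algebra_simps)
  then show "\<bar>log_dual0 p x * D (r * x)\<bar> \<le> \<bar>log_dual0 p x * (?a + ?b * (- ln x) + 0 * (- ln x) ^ 2)\<bar>"
    unfolding abs_mult by (intro mult_left_mono) auto
qed simp

definition V :: "real \<Rightarrow> real" where
  "V r = (LINT x:{0<..<1}|lborel. log_dual0 p x * D (r * x))"

text \<open>Integrating the tangent inequality at \<open>\<kappa> * (- ln x - 1)\<close> bounds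
  \<open>\<kappa> powr p * log_osc p + p * \<kappa> powr (p - 1) * (V r - \<kappa> * log_osc
  p)\<close> by the oscillation of \<open>D\<close>, which is at most the first summand. So the last
  bracket is nonpositive.\<close>

lemma V_le:
  assumes r: "0 < r" "r \<le> 1"
  shows "V r \<le> \<kappa> * log_osc p"
proof -
  let ?U = "{0<..<1::real}"
  define m where "m = (LINT x:?U|lborel. log_dual p x)"
  let ?w = "\<lambda>x. log_dual0 p x * D (r * x)" and ?u = "\<lambda>x. log_dual0 p x * (- ln x)"
  let ?d = "\<lambda>x. D (r * x) - T r" and ?l = "\<lambda>x. - ln x - 1"
  let ?P = "p * \<kappa> powr (p - 1)"
  have iw: "set_integrable lborel ?U ?w"
    by (rule dual_D_int[OF r])
  have il: "set_integrable lborel ?U (\<lambda>x. \<bar>?l x\<bar> powr p)"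
    using p by (intro log_osc_integrable) auto
  have id: "set_integrable lborel ?U ?d"
    by (intro set_integral_diff(1) D_scale_int r set_integrable_const_Ioo)
  have id0: "(LINT x:?U|lborel. ?d x) = 0"
    by (subst set_integral_diff(2)[OF D_scale_int[OF r] set_integrable_const_Ioo]) (simp add: set_integral_const T_def)
  let ?R = "\<lambda>x. \<kappa> powr p * \<bar>?l x\<bar> powr p + ?P * (?w x - T r * log_dual0 p x + m * ?d x - \<kappa> * \<bar>?l x\<bar> powr p)"
  have a1: "set_integrable lborel ?U (\<lambda>x. T r * log_dual0 p x)"
    using log_dual0_integrable[OF p] by (rule set_integrable_mult_right)
  have a2: "set_integrable lborel ?U (\<lambda>x. m * ?d x)"
    using id by (rule set_integrable_mult_right)
  have a3: "set_integrable lborel ?U (\<lambda>x. k * \<bar>?l x\<bar> powr p)" for k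
    using il by (rule set_integrable_mult_right)
  note b1 = set_integral_diff(1)[OF iw a1]
  note b2 = set_integral_add(1)[OF b1 a2]
  note b3 = set_integral_diff(1)[OF b2 a3[of \<kappa>]]
  have b4: "set_integrable lborel ?U (\<lambda>x. ?P * (?w x - T r * log_dual0 p x + m * ?d x - \<kappa> * \<bar>?l x\<bar> powr p))"
    using b3 by (rule set_integrable_mult_right)
  note iR = set_integral_add(1)[OF a3[of "\<kappa> powr p"] b4]
  have pt: "?R x \<le> \<bar>?d x\<bar> powr p" for x
  proof -
    have tangent: "\<bar>\<kappa> * ?l x\<bar> powr p + p * sgn (\<kappa> * ?l x) * \<bar>\<kappa> * ?l x\<bar> powr (p - 1) * (?d x - \<kappa> * ?l x) \<le> \<bar>?d x\<bar> powr p"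
      by (rule powr_tangent_le[OF p(1)])
    have e1: "\<bar>\<kappa> * ?l x\<bar> powr p = \<kappa> powr p * \<bar>?l x\<bar> powr p"
      using \<kappa> by (simp add: abs_mult powr_mult)
    have e2: "p * sgn (\<kappa> * ?l x) * \<bar>\<kappa> * ?l x\<bar> powr (p - 1) = ?P * log_dual p x"
      using \<kappa> by (simp add: abs_mult powr_mult log_dual_def sgn_mult)
    have dual: "log_dual p x * ?l x = \<bar>?l x\<bar> powr p"
    proof -
      have "sgn z * \<bar>z\<bar> powr (p - 1) * z = \<bar>z\<bar> powr p" for z :: real
        by (cases "z = 0") (auto simp: powr_diff sgn_if)
      from this[of "?l x"] show ?thesis
        by (simp add: log_dual_def)
    qed
    have e3: "log_dual p x * (?d x - \<kappa> * ?l x) = ?w x - T r * log_dual0 p x + m * ?d x - \<kappa> * \<bar>?l x\<bar> powr p"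
    proof -
      have "log_dual p x * (?d x - \<kappa> * ?l x) = log_dual p x * ?d x - \<kappa> * (log_dual p x * ?l x)"
        by (simp only: right_diff_distrib mult.left_commute)
      also have "log_dual p x * ?d x = ?w x - T r * log_dual0 p x + m * ?d x"
        by (simp add: log_dual0_def m_def algebra_simps)
      finally show ?thesis
        unfolding dual .
    qed
    from tangent show ?thesis
      unfolding e1 e2 mult.assoc[of ?P "log_dual p x"] e3 .
  qed
  have "(LINT x:?U|lborel. ?R x) \<le> (LINT x:?U|lborel. \<bar>?d x\<bar> powr p)"
    by (rule set_integral_mono[OF iR osc_int[OF r] pt])
  also have "\<dots> \<le> \<kappa> powr p * log_osc p"
    by (rule osc[OF r])
  also have "(LINT x:?U|lborel. ?R x) = \<kappa> powr p * log_osc p + ?P * (V r - \<kappa> * log_osc p)"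
  proof -
    have "(LINT x:?U|lborel. ?w x - T r * log_dual0 p x) = V r"
      using log_dual0_integral[OF p] by (subst set_integral_diff(2)[OF iw a1]) (simp add: V_def)
    then have "(LINT x:?U|lborel. ?w x - T r * log_dual0 p x + m * ?d x) = V r"
      using id0 by (subst set_integral_add(2)[OF b1 a2]) simp
    then have "(LINT x:?U|lborel. ?w x - T r * log_dual0 p x + m * ?d x - \<kappa> * \<bar>?l x\<bar> powr p) = V r - \<kappa> * log_osc p"
      by (subst set_integral_diff(2)[OF b2 a3]) (simp add: log_osc_def)
    then show ?thesis
      by (subst set_integral_add(2)[OF a3 b4]) (simp add: log_osc_def)
  qed
  finally have "?P * (V r - \<kappa> * log_osc p) \<le> 0"
    by simp
  moreover have "0 < ?P"
    using p \<kappa> by simp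
  ultimately show ?thesis
    by (metis diff_gt_0_iff_gt mult_pos_pos not_le)
qed

text \<open>Integrating \<open>V r\<close> against \<open>dr / r\<close> over \<open>(q,1)\<close> pairs \<open>log_dual0\<close> with \<open>N q\<close>.\<close>

definition N :: "real \<Rightarrow> real \<Rightarrow> real" where
  "N q x = (LINT r:{q<..<1}|lborel. D (r * x) / r)"

lemma dual_N:
  assumes q: "0 < q" "q < 1"
  shows "set_integrable lborel {q<..<1} (\<lambda>r. V r / r)"
    and "set_integrable lborel {0<..<1} (\<lambda>x. log_dual0 p x * N q x)"
    and "(LINT r:{q<..<1}|lborel. V r / r) = (LINT x:{0<..<1}|lborel. log_dual0 p x * N q x)"
proof -
  let ?U = "{0<..<1::real}" and ?Q = "{q<..<1}"
  define G where "G = (\<lambda>r x. indicat_real ?Q r * indicat_real ?U x * (log_dual0 p x * D (r * x) / r))"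
  \<comment> \<open>\<open>a r * b x\<close> is an integrable majorant of \<open>G\<close>: for
    \<open>r > q\<close> the term \<open>- ln r\<close> is at most \<open>- ln q\<close>, and
    \<open>D\<close> grows at most linearly in the logarithm.\<close>
  define a where "a = (\<lambda>r. indicat_real ?Q r *\<^sub>R (1 / q))"
  let ?c = "\<bar>D 1\<bar> + B * (1 + 2 * (- ln q))"
  define b where "b = (\<lambda>x. indicat_real ?U x *\<^sub>R \<bar>log_dual0 p x * (?c + (2 * B) * (- ln x) + 0 * (- ln x) ^ 2)\<bar>)"
  have [measurable]: "a \<in> borel_measurable borel" "b \<in> borel_measurable borel"
    unfolding a_def b_def by measurable
  have ai: "integrable lborel a"
    using set_integrable_const_Ioo[of q 1 "1 / q"] by (simp add: a_def set_integrable_def)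
  have bi: "integrable lborel b"
    unfolding b_def by (rule set_integrable_abs[OF log_dual_times_integrable[OF p], unfolded set_integrable_def])
  have ab: "integrable (lborel \<Otimes>\<^sub>M lborel) (\<lambda>(r, x). a r * b x)"
  proof (rule lborel_pair.Fubini_integrable)
    show "integrable lborel (\<lambda>r. LINT x|lborel. norm (case (r, x) of (r, x) \<Rightarrow> a r * b x))"
      using ai by (simp add: abs_mult)
    show "AE r in lborel. integrable lborel (\<lambda>x. case (r, x) of (r, x) \<Rightarrow> a r * b x)"
      using bi by simp
  qed measurable
  have Gi: "integrable (lborel \<Otimes>\<^sub>M lborel) (case_prod G)"
  proof (rule Bochner_Integration.integrable_bound[OF ab])
    show "case_prod G \<in> borel_measurable (lborel \<Otimes>\<^sub>M lborel)"
      unfolding G_def by measurable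
    have "\<bar>G r x\<bar> \<le> \<bar>a r * b x\<bar>" for r x
    proof (cases "r \<in> ?Q \<and> x \<in> ?U")
      case True
      then have rx: "q < r" "r < 1" "0 < x" "x < 1"
        by auto
      then have r: "0 < r" "0 < r * x" "r * x \<le> 1"
        using q by (auto simp: mult_le_one)
      have "ln q \<le> ln r"
        using rx q by simp
      then have "B * (- ln r) \<le> B * (- ln q)"
        using B_nonneg by (intro mult_left_mono) auto
      then have "\<bar>D (r * x)\<bar> \<le> ?c + (2 * B) * (- ln x)"
        using abs_D_le[OF r(2,3)] rx r by (simp add: ln_mult algebra_simps)
      also have "\<dots> \<le> \<bar>?c + (2 * B) * (- ln x)\<bar>"
        by simp
      finally have "\<bar>log_dual0 p x\<bar> * \<bar>D (r * x)\<bar> * (1 / r) \<le> \<bar>log_dual0 p x\<bar> * \<bar>?c + (2 * B) * (- ln x)\<bar> * (1 / q)"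
        using rx q by (intro mult_mono) (auto simp: frac_le)
      then show ?thesis
        using True r q by (simp add: G_def a_def b_def abs_mult)
    qed (auto simp: G_def)
    then show "AE z in lborel \<Otimes>\<^sub>M lborel. norm (case_prod G z) \<le> norm (case z of (r, x) \<Rightarrow> a r * b x)"
      by (intro AE_I2) (auto split: prod.split)
  qed
  have G1: "(LINT x|lborel. G r x) = indicat_real ?Q r *\<^sub>R (V r / r)" for r
  proof -
    have "(LINT x|lborel. G r x) = (LINT x|lborel. (indicat_real ?Q r / r) * (indicat_real ?U x *\<^sub>R (log_dual0 p x * D (r * x))))"
      by (intro Bochner_Integration.integral_cong) (auto simp: G_def)
    then show ?thesis
      by (simp add: V_def set_lebesgue_integral_def)
  qed
  have G2: "(LINT r|lborel. G r x) = indicat_real ?U x *\<^sub>R (log_dual0 p x * N q x)" for x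
  proof -
    have "(LINT r|lborel. G r x) = (LINT r|lborel. (indicat_real ?U x * log_dual0 p x) * (indicat_real ?Q r *\<^sub>R (D (r * x) / r)))"
      by (intro Bochner_Integration.integral_cong) (auto simp: G_def)
    also have "\<dots> = (indicat_real ?U x * log_dual0 p x) * N q x"
      unfolding N_def set_lebesgue_integral_def by (rule integral_mult_right_zero)
    finally show ?thesis
      by simp
  qed
  show "set_integrable lborel ?Q (\<lambda>r. V r / r)"
    using lborel_pair.integrable_fst[OF Gi] unfolding G1 set_integrable_def .
  show "set_integrable lborel ?U (\<lambda>x. log_dual0 p x * N q x)"
    using lborel_pair.integrable_snd[OF Gi] unfolding G2 set_integrable_def .
  show "(LINT r:?Q|lborel. V r / r) = (LINT x:?U|lborel. log_dual0 p x * N q x)"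
    using lborel_pair.Fubini_integral[OF Gi] unfolding G1 G2 set_lebesgue_integral_def by simp
qed

lemma dual_N_le:
  assumes q: "0 < q" "q < 1"
  shows "(LINT x:{0<..<1}|lborel. log_dual0 p x * N q x) \<le> \<kappa> * log_osc p * (- ln q)"
proof -
  note i = set_integral_inverse[OF q]
  have "(LINT r:{q<..<1}|lborel. V r / r) \<le> (LINT r:{q<..<1}|lborel. \<kappa> * log_osc p * (1 / r))"
  proof (rule set_integral_mono[OF dual_N(1)[OF q]])
    show "set_integrable lborel {q<..<1} (\<lambda>r. \<kappa> * log_osc p * (1 / r))"
      by (rule set_integrable_mult_right) (rule i(1))
    show "V r / r \<le> \<kappa> * log_osc p * (1 / r)" if "r \<in> {q<..<1}" for r
      using V_le[of r] that q by (auto simp: divide_simps)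
  qed
  also have "\<dots> = \<kappa> * log_osc p * (LINT r:{q<..<1}|lborel. 1 / r)"
    by (rule set_integral_mult_right)
  finally show ?thesis
    unfolding dual_N(3)[OF q] i(2) by simp
qed

lemma D_over_id_int:
  assumes "0 < a" "b \<le> 1"
  shows "set_integrable lborel {a<..<b} (\<lambda>y. D y / y)"
proof (cases "a < b")
  case True
  let ?c = "\<bar>D 1\<bar> + B * (1 + 2 * (- ln a))"
  show ?thesis
  proof (rule set_integrable_Ioo_bound)
    show "set_integrable lborel {a<..<b} (\<lambda>y. ?c * (1 / y))"
      by (rule set_integrable_mult_right) (rule set_integral_inverse(1)[OF assms(1) True])
    fix y assume "y \<in> {a<..<b}"
    then have y: "a < y" "y < b"
      by auto
    then have "ln a \<le> ln y"
      using assms by simp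
    then have "B * (- ln y) \<le> B * (- ln a)"
      using B_nonneg by (intro mult_left_mono) auto
    then have "\<bar>D y\<bar> \<le> ?c"
      using abs_D_le[of y] y assms by (simp add: algebra_simps)
    then show "\<bar>D y / y\<bar> \<le> ?c * (1 / y)"
      using y assms by (simp add: abs_divide divide_right_mono)
  qed simp
qed (simp add: set_integrable_def)

text \<open>The measure dr / r is invariant under dilations. In the new form x occurs only in the
  limits, which makes monotonicity in x accessible.\<close>

lemma N_eq:
  assumes "x \<in> {0<..<1}"
  shows "N q x = (LINT y:{q * x<..<x}|lborel. D y / y)"
proof -
  have "(LINT y:{x * q<..<x * 1}|lborel. D y / y) = x * (LINT r:{q<..<1}|lborel. D (x * r) / (x * r))"
    by (rule set_integral_scale_lborel) (use assms in simp)
  also have "\<dots> = (LINT r:{q<..<1}|lborel. x * (D (x * r) / (x * r)))"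
    by (rule set_integral_mult_right[symmetric])
  also have "\<dots> = N q x"
    unfolding N_def using assms by (intro set_lebesgue_integral_cong) (auto simp: mult.commute)
  finally show ?thesis
    by (simp add: mult.commute)
qed

text \<open>It does not involve \<open>q\<close>, so its pairing with \<open>log_dual0\<close> is a
  bounded error as \<open>q\<close> tends to 0.\<close>

definition H :: "real \<Rightarrow> real" where
  "H x = (LINT y:{x<..<1}|lborel. max 0 (D y) / y)"

lemma H_measurable [measurable]: "H \<in> borel_measurable borel"
proof -
  have eq: "indicat_real {x<..<1} y *\<^sub>R (max 0 (D y) / y) = (if x < y \<and> y < 1 then max 0 (D y) / y else 0)" for x y
    by (simp add: indicator_def)
  have "(\<lambda>(x, y). if x < y \<and> y < 1 then max 0 (D y) / y else 0) \<in> borel_measurable (lborel \<Otimes>\<^sub>M lborel)"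
    by measurable
  then have "H \<in> borel_measurable lborel"
    unfolding H_def set_lebesgue_integral_def eq by (rule lborel.borel_measurable_lebesgue_integral)
  then show ?thesis
    by simp
qed

lemma pos_D_over_id_int:
  assumes "0 < a" "b \<le> 1"
  shows "set_integrable lborel {a<..<b} (\<lambda>y. max 0 (D y) / y)"
proof (rule set_integrable_Ioo_bound[OF set_integrable_abs[OF D_over_id_int[OF assms]]])
  show "\<bar>max 0 (D y) / y\<bar> \<le> \<bar>D y / y\<bar>" for y
    unfolding abs_divide by (intro divide_right_mono) auto
qed simp

lemma H_bounds:
  assumes "x \<in> {0<..<1}"
  shows "0 \<le> H x" "H x \<le> B * (- ln x) + (2 * B) * (- ln x) ^ 2"
proof -
  have x: "0 < x" "x < 1"
    using assms by auto
  show "0 \<le> H x"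
    unfolding H_def by (rule set_integral_nonneg_real) (use x in auto)
  let ?c = "B * (1 + 2 * (- ln x))"
  have "H x \<le> (LINT y:{x<..<1}|lborel. ?c * (1 / y))"
    unfolding H_def
  proof (rule set_integral_mono)
    show "set_integrable lborel {x<..<1} (\<lambda>y. max 0 (D y) / y)"
      by (rule pos_D_over_id_int) (use x in auto)
    show "set_integrable lborel {x<..<1} (\<lambda>y. ?c * (1 / y))"
      by (rule set_integrable_mult_right) (rule set_integral_inverse(1)[OF x])
    fix y assume "y \<in> {x<..<1}"
    then have y: "x < y" "y < 1" "0 < y"
      using x by auto
    have ly: "ln x \<le> ln y" "ln y < 0"
      using x y by auto
    have "B * (1 + 2 * (- ln y)) \<le> ?c"
      using B_nonneg ly by (intro mult_left_mono) auto
    moreover have "0 \<le> B * (1 + 2 * (- ln y))"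
      using B_nonneg ly by (intro mult_nonneg_nonneg) linarith+
    ultimately have "max 0 (D y) \<le> ?c"
      using D_le_log[of y] y by (auto simp: max_def)
    then show "max 0 (D y) / y \<le> ?c * (1 / y)"
      using y by (simp add: divide_right_mono)
  qed
  also have "\<dots> = ?c * (- ln x)"
    by (simp only: set_integral_mult_right set_integral_inverse(2)[OF x]) simp
  finally show "H x \<le> B * (- ln x) + (2 * B) * (- ln x) ^ 2"
    by (simp add: algebra_simps power2_eq_square)
qed

text \<open>
  Since \<open>log_dual0\<close> is decreasing with mean zero, a decreasing error term contributes with the right
  sign; \<open>H\<close> compensates the part of \<open>N\<close> that is not decreasing.
\<close>

lemma N_corrected_antimono:
  assumes q: "0 < q" "q < 1"
  shows "antimono_on {0<..<1} (\<lambda>x. N q x - D q * (- ln x) + H x)"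
proof (rule monotone_onI)
  fix x x' :: real assume "x \<in> {0<..<1}" "x' \<in> {0<..<1}" "x \<le> x'"
  then have x: "0 < x" "x \<le> x'" "x' < 1" and xU: "x \<in> {0<..<1}" "x' \<in> {0<..<1}"
    by auto
  define \<Phi> where "\<Phi> = (\<lambda>a b. LINT y:{a<..<b}|lborel. D y / y)"
  show "N q x' - D q * (- ln x') + H x' \<le> N q x - D q * (- ln x) + H x"
  proof (cases "x = x'")
    case False
    then have lt: "x < x'"
      using x by simp
    have qx: "0 < q * x" "q * x < x" "q * x < q * x'" "q * x' < x'" "q * x' < q"
      using q x lt by auto
    have split: "\<Phi> a c = \<Phi> a b + \<Phi> b c" if "0 < a" "a < b" "b < c" "c \<le> 1" for a b c
      unfolding \<Phi>_def by (rule set_integral_Ioo_split[OF that(2,3) D_over_id_int]) (use that in auto)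
    \<comment> \<open>Moving x to x' shifts both limits. The shift of the upper limit is absorbed by
      the change of \<open>H\<close>; that of the lower one takes place below \<open>q\<close>,
      where \<open>D y \<ge> D q\<close>, and so yields at least
      \<open>D q * (ln x' - ln x)\<close>.\<close>
    have "\<Phi> (q * x) x + \<Phi> x x' = \<Phi> (q * x) x'"
      using split[of "q * x" x x'] qx lt x by simp
    also have "\<dots> = \<Phi> (q * x) (q * x') + \<Phi> (q * x') x'"
      using split[of "q * x" "q * x'" x'] qx lt x by simp
    finally have "N q x - N q x' = \<Phi> (q * x) (q * x') - \<Phi> x x'"
      using N_eq[OF xU(1)] N_eq[OF xU(2)] by (simp add: \<Phi>_def)
    moreover have "H x = (LINT y:{x<..<x'}|lborel. max 0 (D y) / y) + H x'"
      unfolding H_def by (rule set_integral_Ioo_split[OF lt x(3) pos_D_over_id_int]) (use x in auto)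
    moreover have "\<Phi> x x' \<le> (LINT y:{x<..<x'}|lborel. max 0 (D y) / y)"
      unfolding \<Phi>_def
      by (intro set_integral_mono D_over_id_int pos_D_over_id_int) (use x in \<open>auto intro: divide_right_mono\<close>)
    moreover have "D q * (ln x' - ln x) \<le> \<Phi> (q * x) (q * x')"
    proof -
      have "(LINT y:{q * x<..<q * x'}|lborel. D q * (1 / y)) \<le> \<Phi> (q * x) (q * x')"
        unfolding \<Phi>_def
      proof (intro set_integral_mono D_over_id_int set_integrable_mult_right set_integral_inverse(1) qx)
        show "q * x' \<le> 1"
          using qx q by linarith
        fix y assume "y \<in> {q * x<..<q * x'}"
        then have "q * x < y" "y < q * x'"
          by auto
        then have y: "0 < y" "y \<le> q" "y \<le> 1"
          using qx q by linarith+
        have "D q \<le> D y"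
          by (rule monotone_onD[OF anti]) (use y q in auto)
        then show "D q * (1 / y) \<le> D y / y"
          using y by (simp add: divide_right_mono)
      qed
      moreover have "(LINT y:{q * x<..<q * x'}|lborel. D q * (1 / y)) = D q * (ln (q * x') - ln (q * x))"
        by (simp only: set_integral_mult_right set_integral_inverse(2)[OF qx(1,3)])
      ultimately show ?thesis
        using q x lt by (simp add: ln_mult)
    qed
    ultimately show ?thesis
      by (simp add: algebra_simps)
  qed simp
qed

text \<open>Chebyshev's inequality for the corrected \<open>N\<close>: the pairing is nonnegative,
  the \<open>N\<close> term is at most \<open>\<kappa> * log_osc p * (- ln q)\<close> by averaging
  \<open>V\<close>, the logarithm contributes exactly \<open>D q * log_osc p\<close>, and the
  \<open>H\<close> term is bounded by a number that depends on p and \<kappa> only.\<close>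

lemma D_growth:
  assumes q: "0 < q" "q < 1"
  shows "log_osc p * D q \<le> log_osc p * (\<kappa> * (- ln q)) +
    (LINT x:{0<..<1}|lborel. \<bar>log_dual0 p x * (0 + B * (- ln x) + (2 * B) * (- ln x) ^ 2)\<bar>)"
proof -
  let ?U = "{0<..<1::real}" and ?g = "log_dual0 p"
  let ?b = "\<lambda>x. \<bar>?g x * (0 + B * (- ln x) + (2 * B) * (- ln x) ^ 2)\<bar>"
  have bi: "set_integrable lborel ?U ?b"
    by (intro set_integrable_abs log_dual_times_integrable p)
  have bd: "\<bar>?g x * H x\<bar> \<le> ?b x" if "x \<in> ?U" for x
    unfolding abs_mult using H_bounds[OF that] by (intro mult_left_mono) auto
  have gN: "set_integrable lborel ?U (\<lambda>x. ?g x * N q x)"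
    by (rule dual_N(2)[OF q])
  have gl: "set_integrable lborel ?U (\<lambda>x. D q * (?g x * (- ln x)))"
    using log_dual_times_integrable[OF p, of 0 1 0] by (intro set_integrable_mult_right) simp
  have gH: "set_integrable lborel ?U (\<lambda>x. ?g x * H x)"
    by (rule set_integrable_Ioo_bound[OF bi _ bd]) measurable
  note d = set_integral_diff(1)[OF gN gl]
  have eq: "?g x * (N q x - D q * (- ln x) + H x) = ?g x * N q x - D q * (?g x * (- ln x)) + ?g x * H x" for x
    by (simp add: algebra_simps)
  have "0 \<le> (LINT x:?U|lborel. ?g x * (N q x - D q * (- ln x) + H x))"
  proof (rule chebyshev_integral_nonneg)
    show "set_integrable lborel ?U (\<lambda>x. ?g x * (N q x - D q * (- ln x) + H x))"
      unfolding eq by (rule set_integral_add(1)[OF d gH])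
  qed (rule log_dual0_antimono[OF p] N_corrected_antimono[OF q] log_dual0_integrable[OF p] log_dual0_integral[OF p])+
  also have "\<dots> = (LINT x:?U|lborel. ?g x * N q x) - (LINT x:?U|lborel. D q * (?g x * (- ln x))) + (LINT x:?U|lborel. ?g x * H x)"
    unfolding eq by (simp only: set_integral_add(2)[OF d gH] set_integral_diff(2)[OF gN gl])
  also have "(LINT x:?U|lborel. D q * (?g x * (- ln x))) = D q * log_osc p"
    by (simp only: set_integral_mult_right log_dual0_ln_integral[OF p])
  also have "(LINT x:?U|lborel. ?g x * H x) \<le> (LINT x:?U|lborel. ?b x)"
    by (rule set_integral_mono[OF gH bi]) (use bd in force)
  finally show ?thesis
    using dual_N_le[OF q] by (simp add: algebra_simps)
qed

end

section \<open>The John--Nirenberg constant and sharpness\<close>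

lemma log_osc_exp_bound:
  assumes p: "1 \<le> p" "p \<le> 2" and \<kappa>: "0 < \<kappa>" "\<kappa> < 1" and L: "0 < log_osc p"
    and e: "0 \<le> \<epsilon>" "\<epsilon> powr p \<le> \<kappa> powr p * log_osc p"
  obtains C where "0 \<le> C"
    "\<And>\<phi>. \<phi> \<in> BMO {0<..<1} \<Longrightarrow> bmo_norm p {0<..<1} \<phi> \<le> ennreal \<epsilon> \<Longrightarrow>
      nn_avg {0<..<1} (\<lambda>x. exp (\<phi> x)) \<le> ennreal C * ennreal (exp (avg {0<..<1} \<phi>))"
proof -
  let ?U = "{0<..<1::real}"
  define K where "K = \<kappa> powr p * log_osc p"
  have K: "0 \<le> K"
    using L by (simp add: K_def)
  \<comment> \<open>\<open>\<beta>\<close> is the halving constant \<open>B\<close> of the locale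
    and \<open>C0\<close> the error term of \<open>D_growth\<close> divided by
    \<open>log_osc p\<close>. Both are fixed before \<phi>, as the bound must be uniform in
    \<phi>.\<close>
  define \<beta> where "\<beta> = 2 * (1 + K)"
  define C0 where "C0 = (LINT x:?U|lborel. \<bar>log_dual0 p x * (0 + \<beta> * (- ln x) + (2 * \<beta>) * (- ln x) ^ 2)\<bar>) / log_osc p"
  define I where "I = (LINT x:?U|lborel. x powr (- \<kappa>))"
  have Iint: "set_integrable lborel ?U (\<lambda>x. x powr (- \<kappa>))"
    using \<kappa> by (intro set_integrable_powr) simp
  have I0: "0 \<le> I"
    unfolding I_def by (rule set_integral_nonneg_real) simp
  show ?thesis
  proof (rule that)
    show "0 \<le> exp (\<beta> + C0) * I"
      using I0 by simp
    fix \<phi> assume \<phi>: "\<phi> \<in> BMO ?U" "bmo_norm p ?U \<phi> \<le> ennreal \<epsilon>"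
    have int: "set_integrable lebesgue ?U \<phi>"
      using \<phi>(1) loc_integrableD[of ?U \<phi> 0 1] by (simp add: BMO_def)
    have \<phi>_osc: "(\<integral>\<^sup>+x\<in>{a<..<b}. ennreal (\<bar>\<phi> x - (LINT x:{a<..<b}|lebesgue. \<phi> x) / (b - a)\<bar> powr p) \<partial>lebesgue)
        \<le> ennreal K * ennreal (b - a)" if ab: "0 \<le> a" "a < b" "b \<le> 1" for a b
    proof -
      let ?J = "{a<..<b}"
      have J: "?J \<in> subintervals ?U"
        using ab bounded_interval_open[OF ab(2)] by (auto simp: subintervals_def)
      have av: "avg ?J \<phi> = (LINT x:?J|lebesgue. \<phi> x) / (b - a)"
        using ab by (simp add: avg_def)
      have "nn_avg ?J (\<lambda>x. \<bar>\<phi> x - avg ?J \<phi>\<bar> powr p) \<le> ennreal (\<epsilon> powr p)"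
        using \<phi>(2) J p e(1) bmo_norm_le_iff[of p \<epsilon> ?U \<phi>] by auto
      also have "\<dots> \<le> ennreal K"
        using e(2) by (simp add: K_def ennreal_leI)
      finally have le: "nn_avg ?J (\<lambda>x. \<bar>\<phi> x - avg ?J \<phi>\<bar> powr p) \<le> ennreal K" .
      have "(\<integral>\<^sup>+x\<in>?J. ennreal (\<bar>\<phi> x - avg ?J \<phi>\<bar> powr p) \<partial>lebesgue) = nn_avg ?J (\<lambda>x. \<bar>\<phi> x - avg ?J \<phi>\<bar> powr p) * ennreal (b - a)"
        using ab unfolding nn_avg_def
        by (simp add: ennreal_divide_times ennreal_times_divide[symmetric] mult_divide_eq_ennreal)
      also have "\<dots> \<le> ennreal K * ennreal (b - a)"
        by (rule mult_right_mono[OF le]) simp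
      finally show ?thesis
        unfolding av .
    qed
    have \<phi>m: "\<phi> \<in> borel_measurable (lebesgue_on ?U)"
      using set_integrable_measurable[OF int] by (simp add: set_borel_measurable_iff_lebesgue_on)
    obtain g where g: "g \<in> borel_measurable borel" "antimono_on ?U g"
      "distr (restrict_space lborel ?U) borel g = distr (lebesgue_on ?U) borel \<phi>"
      using exists_decreasing_rearrangement[OF \<phi>m] .
    note [measurable] = g(1)
    define m where "m = avg ?U \<phi>"
    have m: "m = (LINT x:?U|lebesgue. \<phi> x)"
      by (simp add: m_def avg_def)
    have gU: "set_integrable lborel ?U g"
      using equimeasurable_integrable[OF \<phi>m g(1,3), of "\<lambda>y. y"] int by simp
    define \<tau> where "\<tau> = (LINT x:?U|lborel. g (1/2 * x))"
    \<comment> \<open>Halving the argument makes 1 correspond to the interior point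
      \<open>1/2\<close>, so that \<open>D\<close> is monotone up to 1 and the rearrangement bound,
      which needs \<open>t < 1\<close>, covers \<open>r = 1\<close>. Subtracting
      \<open>\<tau>\<close> gives \<open>T 1 = 0\<close>.\<close>
    define D where "D = (\<lambda>x. g (1/2 * x) - \<tau>)"
    define T where "T = (\<lambda>r. LINT x:?U|lborel. D (r * x))"
    have g_scale: "set_integrable lborel ?U (\<lambda>x. g (r * x))" if "0 < r" "r \<le> 1" for r
      by (rule set_integrable_unit_scale[OF gU that])
    have osc_D: "set_integrable lborel ?U (\<lambda>x. \<bar>D (r * x) - T r\<bar> powr p) \<and>
      (LINT x:?U|lborel. \<bar>D (r * x) - T r\<bar> powr p) \<le> K" if r: "0 < r" "r \<le> 1" for r
    proof -
      define t where "t = 1/2 * r"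
      have t: "0 < t" "t < 1"
        using r by (auto simp: t_def)
      define c where "c = (LINT x:{0<..<t}|lborel. g x) / t"
      have "(LINT x:{t * 0<..<t * 1}|lborel. g x) = t * (LINT x:?U|lborel. g (t * x))"
        by (rule set_integral_scale_lborel[OF t(1)])
      then have c: "c = (LINT x:?U|lborel. g (t * x))"
        using t by (simp add: c_def)
      have "T r = (LINT x:?U|lborel. g (t * x) - \<tau>)"
        by (simp add: T_def D_def t_def mult.assoc)
      also have "\<dots> = c - \<tau>"
        using t by (subst set_integral_diff(2)[OF g_scale set_integrable_const_Ioo]) (auto simp: c set_integral_const)
      finally have eq: "D (r * x) - T r = g (t * x) - c" for x
        by (simp add: D_def t_def mult.assoc)
      note ro = rearrangement_oscillation[OF p(1) K int \<phi>_osc g t c_def]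
      have "set_integrable lborel {t * 0<..<t * 1} (\<lambda>x. \<bar>g x - c\<bar> powr p)"
        using ro(1) by simp
      then have 1: "set_integrable lborel ?U (\<lambda>x. \<bar>g (t * x) - c\<bar> powr p)"
        unfolding set_integrable_scale_lborel[OF t(1)] .
      have "(LINT x:{t * 0<..<t * 1}|lborel. \<bar>g x - c\<bar> powr p) = t * (LINT x:?U|lborel. \<bar>g (t * x) - c\<bar> powr p)"
        by (rule set_integral_scale_lborel[OF t(1)])
      then have "t * (LINT x:?U|lborel. \<bar>g (t * x) - c\<bar> powr p) \<le> t * K"
        using ro(2) by (simp add: mult.commute)
      then show ?thesis
        unfolding eq using 1 t by simp
    qed
    interpret log_growth p \<kappa> D T
    proof
      show "D \<in> borel_measurable borel"
        unfolding D_def by measurable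
      show "antimono_on {0<..1} D"
        using g(2) by (auto simp: monotone_on_def D_def)
      show "set_integrable lborel ?U D"
        unfolding D_def by (intro set_integral_diff(1) g_scale set_integrable_const_Ioo) auto
      show "T 1 = 0"
        unfolding T_def D_def
        by (simp, subst set_integral_diff(2)[OF _ set_integrable_const_Ioo])
          (use g_scale[of "1/2"] in \<open>auto simp: \<tau>_def set_integral_const\<close>)
    qed (use p \<kappa> osc_D in \<open>auto simp: T_def K_def\<close>)
    have growth: "D q \<le> \<kappa> * (- ln q) + C0" if q: "q \<in> ?U" for q
    proof -
      have B_eq: "B = \<beta>"
        by (simp add: B_def \<beta>_def K_def)
      have "log_osc p * D q \<le> log_osc p * (\<kappa> * (- ln q)) + log_osc p * C0"
        using D_growth[of q] q L unfolding B_eq by (simp add: C0_def)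
      then have "log_osc p * D q \<le> log_osc p * (\<kappa> * (- ln q) + C0)"
        by (simp only: distrib_left)
      then show ?thesis
        using L by (simp only: mult_le_cancel_left_pos)
    qed
    \<comment> \<open>\<open>\<tau>\<close> is the mean of \<open>g\<close> over (0,1/2). Its excess
      over \<open>m\<close> is at most twice the mean deviation of \<phi>, which is bounded by
      \<open>1 + K\<close>.\<close>
    have \<tau>_le: "\<tau> \<le> m + \<beta>"
    proof -
      let ?y = "\<lambda>x. \<bar>\<phi> x - m\<bar>"
      have yi: "set_integrable lebesgue ?U (\<lambda>x. \<bar>\<phi> x - m\<bar>)"
        by (intro set_integrable_abs set_integral_diff(1) int set_integrable_const_interval)
      have yi': "integrable lebesgue (\<lambda>x. indicat_real ?U x *\<^sub>R ?y x)"
        using yi by (simp add: set_integrable_def)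
      have "ennreal (LINT x:?U|lebesgue. ?y x) = (\<integral>\<^sup>+x. ennreal (indicat_real ?U x *\<^sub>R ?y x) \<partial>lebesgue)"
        unfolding set_lebesgue_integral_def by (rule nn_integral_eq_integral[OF yi', symmetric]) simp
      also have "\<dots> \<le> (\<integral>\<^sup>+x. indicator ?U x + ennreal (?y x powr p) * indicator ?U x \<partial>lebesgue)"
      proof (rule nn_integral_mono)
        fix x :: real
        have "?y x \<le> 1 + ?y x powr p"
        proof (cases "?y x \<le> 1")
          case False
          then have "?y x powr 1 \<le> ?y x powr p"
            using p by (intro powr_mono) auto
          then show ?thesis
            using False by simp
        qed (simp add: add_increasing2)
        then have "ennreal (?y x) \<le> 1 + ennreal (?y x powr p)"
          by (metis ennreal_1 ennreal_leI ennreal_plus powr_ge_zero zero_le_one)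
        then show "ennreal (indicat_real ?U x *\<^sub>R ?y x) \<le> indicator ?U x + ennreal (?y x powr p) * indicator ?U x"
          by (auto simp: indicator_def)
      qed
      also have "\<dots> = (\<integral>\<^sup>+x. indicator ?U x \<partial>lebesgue) + (\<integral>\<^sup>+x\<in>?U. ennreal (?y x powr p) \<partial>lebesgue)"
      proof (rule nn_integral_add)
        have "set_borel_measurable lebesgue ?U (\<lambda>x. ?y x powr p)"
          by (intro set_borel_measurable_compose[where h="\<lambda>y. \<bar>y - m\<bar> powr p"] set_integrable_measurable int) auto
        then show "(\<lambda>x. ennreal (?y x powr p) * indicator ?U x) \<in> borel_measurable lebesgue"
          unfolding set_borel_measurable_def
          by (subst measurable_cong[where g="\<lambda>x. ennreal (indicator ?U x *\<^sub>R ?y x powr p)"]) (auto simp: indicator_def)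
      qed (rule borel_measurable_indicator, simp)
      also have "\<dots> \<le> 1 + ennreal K"
        using \<phi>_osc[of 0 1] m by (intro add_mono) auto
      also have "\<dots> = ennreal (1 + K)"
        using K by simp
      finally have yK: "(LINT x:?U|lebesgue. ?y x) \<le> 1 + K"
        using K by (subst (asm) ennreal_le_iff) auto
      have gy: "set_integrable lborel ?U (\<lambda>x. \<bar>g x - m\<bar>)"
        by (intro set_integrable_abs set_integral_diff(1) gU set_integrable_const_Ioo)
      have "(LINT x:{1/2 * 0<..<1/2 * 1}|lborel. g x - m) = 1/2 * (LINT x:?U|lborel. g (1/2 * x) - m)"
        by (rule set_integral_scale_lborel) simp
      also have "(LINT x:?U|lborel. g (1/2 * x) - m) = \<tau> - m"
        by (subst set_integral_diff(2)[OF g_scale set_integrable_const_Ioo]) (auto simp: \<tau>_def set_integral_const)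
      finally have "\<tau> - m = 2 * (LINT x:{0<..<1/2}|lborel. g x - m)"
        by simp
      also have "(LINT x:{0<..<1/2}|lborel. g x - m) \<le> (LINT x:?U|lborel. \<bar>g x - m\<bar>)"
        unfolding set_lebesgue_integral_def
      proof (rule integral_mono)
        have "set_integrable lborel ?U (\<lambda>x. g x - m)"
          by (intro set_integral_diff(1) gU set_integrable_const_Ioo)
        then have "set_integrable lborel {0<..<1/2} (\<lambda>x. g x - m)"
          by (rule set_integrable_subset) auto
        then show "integrable lborel (\<lambda>x. indicat_real {0<..<1/2} x *\<^sub>R (g x - m))"
          by (simp add: set_integrable_def)
        show "integrable lborel (\<lambda>x. indicat_real ?U x *\<^sub>R \<bar>g x - m\<bar>)"
          using gy by (simp add: set_integrable_def)
      qed (auto simp: indicator_def)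
      also have "\<dots> = (LINT x:?U|lebesgue. ?y x)"
        using equimeasurable_integral[OF \<phi>m g(1,3), of "\<lambda>y. \<bar>y - m\<bar>"] by simp
      finally show ?thesis
        using yK by (simp add: \<beta>_def)
    qed
    have "nn_avg ?U (\<lambda>x. exp (\<phi> x)) = (\<integral>\<^sup>+x\<in>?U. ennreal (exp (\<phi> x)) \<partial>lebesgue)"
      by (simp add: nn_avg_def divide_ennreal_def)
    also have "\<dots> = (\<integral>\<^sup>+x\<in>?U. ennreal (exp (g x)) \<partial>lborel)"
      by (rule equimeasurable_nn_integral[OF \<phi>m g(1,3), symmetric]) measurable
    also have "\<dots> \<le> (\<integral>\<^sup>+x. ennreal (exp (m + \<beta> + C0)) * ennreal (indicat_real ?U x *\<^sub>R x powr (- \<kappa>)) \<partial>lborel)"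
    proof (rule nn_integral_mono)
      fix x :: real
      show "ennreal (exp (g x)) * indicator ?U x \<le> ennreal (exp (m + \<beta> + C0)) * ennreal (indicat_real ?U x *\<^sub>R x powr (- \<kappa>))"
      proof (cases "x \<in> ?U")
        case True
        \<comment> \<open>As \<open>g\<close> decreases, halving the argument only enlarges it and
          makes the growth bound for \<open>D\<close> applicable.\<close>
        have "g x \<le> g (1/2 * x)"
          using True by (intro monotone_onD[OF g(2)]) auto
        also have "\<dots> = D x + \<tau>"
          by (simp add: D_def)
        also have "\<dots> \<le> (m + \<beta> + C0) + (- \<kappa>) * ln x"
          using growth[OF True] \<tau>_le by simp
        finally have "exp (g x) \<le> exp (m + \<beta> + C0) * exp ((- \<kappa>) * ln x)"
          by (simp only: exp_add[symmetric] exp_le_cancel_iff)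
        also have "\<dots> = exp (m + \<beta> + C0) * x powr (- \<kappa>)"
          using True by (simp add: powr_def)
        finally show ?thesis
          using True by (simp add: ennreal_mult[symmetric] ennreal_leI)
      qed simp
    qed
    also have "\<dots> = ennreal (exp (m + \<beta> + C0)) * (\<integral>\<^sup>+x. ennreal (indicat_real ?U x *\<^sub>R x powr (- \<kappa>)) \<partial>lborel)"
      by (rule nn_integral_cmult) measurable
    also have "(\<integral>\<^sup>+x. ennreal (indicat_real ?U x *\<^sub>R x powr (- \<kappa>)) \<partial>lborel) = ennreal I"
      unfolding I_def set_lebesgue_integral_def
      by (rule nn_integral_eq_integral) (use Iint in \<open>auto simp: set_integrable_def\<close>)
    also have "ennreal (exp (m + \<beta> + C0)) * ennreal I = ennreal (exp (\<beta> + C0) * I) * ennreal (exp m)"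
      using I0 by (simp add: ennreal_mult[symmetric] exp_add algebra_simps)
    finally show "nn_avg ?U (\<lambda>x. exp (\<phi> x)) \<le> ennreal (exp (\<beta> + C0) * I) * ennreal (exp (avg ?U \<phi>))"
      by (simp add: m_def)
  qed
qed

text \<open>Every \<epsilon> below the oscillation of the logarithm leaves a factor \<kappa> < 1,
  for which \<open>log_osc_exp_bound\<close> controls the unit interval; rescaling extends the bound
  to all subintervals.\<close>

theorem JN_const_ge_log_osc:
  assumes p: "1 \<le> p" "p \<le> 2"
  shows "ennreal (log_osc p powr (1 / p)) \<le> JN_const p"
  unfolding JN_const_def
proof (intro Sup_upper CollectI allI impI)
  fix \<epsilon> :: real assume e: "0 \<le> \<epsilon>" "ennreal \<epsilon> < ennreal (log_osc p powr (1 / p))"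
  define M where "M = log_osc p powr (1 / p)"
  have eM: "\<epsilon> < M"
    using e by (simp add: M_def ennreal_less_iff)
  \<comment> \<open>The existence of an \<epsilon> strictly below \<open>M\<close> yields positivity
    of \<open>log_osc p\<close> without computing it.\<close>
  then have M: "0 < M"
    using e by simp
  then have L: "0 < log_osc p"
    using log_osc_nonneg[of p] by (cases "log_osc p = 0") (auto simp: M_def)
  \<comment> \<open>The maximum with \<open>1 / 2\<close> keeps \<open>\<kappa>\<close> positive
    when \<open>\<epsilon> = 0\<close>.\<close>
  define \<kappa> where "\<kappa> = max (\<epsilon> / M) (1 / 2)"
  have \<kappa>: "0 < \<kappa>" "\<kappa> < 1"
    using eM M by (auto simp: \<kappa>_def)
  have "\<epsilon> = \<epsilon> / M * M"
    using M by simp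
  also have "\<dots> \<le> \<kappa> * M"
    using M by (intro mult_right_mono) (auto simp: \<kappa>_def)
  finally have "\<epsilon> powr p \<le> (\<kappa> * M) powr p"
    using e p by (intro powr_mono2) auto
  also have "\<dots> = \<kappa> powr p * log_osc p"
    using \<kappa> M p L by (simp add: powr_mult M_def powr_powr)
  finally have le: "\<epsilon> powr p \<le> \<kappa> powr p * log_osc p" .
  obtain C where C: "0 \<le> C" "\<And>\<phi>. \<phi> \<in> BMO {0<..<1} \<Longrightarrow> bmo_norm p {0<..<1} \<phi> \<le> ennreal \<epsilon> \<Longrightarrow>
      nn_avg {0<..<1} (\<lambda>x. exp (\<phi> x)) \<le> ennreal C * ennreal (exp (avg {0<..<1} \<phi>))"
    using log_osc_exp_bound[OF p \<kappa> L e(1) le] by blast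
  have "JN_C \<epsilon> p \<le> ennreal C"
    unfolding JN_C_def by (intro Inf_lower CollectI ballI impI exp_bound_rescale[OF C(2)])
  then show "JN_C \<epsilon> p < \<infinity>"
    by (auto intro: order_le_less_trans)
qed

theorem corollary1p5:
  fixes p :: real
  assumes "1 \<le> p" and "p \<le> 2"
  shows "(\<forall>Q. bounded_interval Q \<longrightarrow>
            (\<forall>\<phi>\<in>BMO Q. (INF f\<in>Linf Q. bmo_norm p Q (\<lambda>x. \<phi> x - f x)) \<ge>
               JN_const p / min (eps_Ainf Q \<phi>) (eps_Ainf Q (\<lambda>x. - \<phi> x)))) \<and>
         (\<forall>\<phi>\<in>BMO UNIV. (INF f\<in>Linf UNIV. bmo_norm p UNIV (\<lambda>x. \<phi> x - f x)) \<ge>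
               JN_const p / min (eps_Ainf UNIV \<phi>) (eps_Ainf UNIV (\<lambda>x. - \<phi> x))) \<and>
         (\<forall>Q. bounded_interval Q \<longrightarrow>
            (\<forall>c>JN_const p. \<not> (\<forall>\<phi>\<in>BMO Q. (INF f\<in>Linf Q. bmo_norm p Q (\<lambda>x. \<phi> x - f x)) \<ge>
               c / min (eps_Ainf Q \<phi>) (eps_Ainf Q (\<lambda>x. - \<phi> x)))))"
proof (intro conjI allI impI ballI notI)
  have lower: "JN_const p / min (eps_Ainf X \<phi>) (eps_Ainf X (\<lambda>x. - \<phi> x))
      \<le> (INF f\<in>Linf X. bmo_norm p X (\<lambda>x. \<phi> x - f x))" if "\<phi> \<in> BMO X" for X \<phi>
    using assms that by (intro INF_greatest distance_to_Linf_ge) auto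
  show "JN_const p / min (eps_Ainf Q \<phi>) (eps_Ainf Q (\<lambda>x. - \<phi> x))
      \<le> (INF f\<in>Linf Q. bmo_norm p Q (\<lambda>x. \<phi> x - f x))" if "\<phi> \<in> BMO Q" for Q \<phi>
    by (rule lower[OF that])
  show "JN_const p / min (eps_Ainf UNIV \<phi>) (eps_Ainf UNIV (\<lambda>x. - \<phi> x))
      \<le> (INF f\<in>Linf UNIV. bmo_norm p UNIV (\<lambda>x. \<phi> x - f x))" if "\<phi> \<in> BMO UNIV" for \<phi>
    by (rule lower[OF that])
  fix Q :: "real set" and c
  assume Q: "bounded_interval Q" and c: "JN_const p < c"
    and sharp: "\<forall>\<phi>\<in>BMO Q. c / min (eps_Ainf Q \<phi>) (eps_Ainf Q (\<lambda>x. - \<phi> x))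
      \<le> (INF f\<in>Linf Q. bmo_norm p Q (\<lambda>x. \<phi> x - f x))"
  obtain a b where ab: "a < b" "{a<..<b} \<subseteq> Q" "Q \<subseteq> {a..b}"
    using bounded_interval_endpoints[OF Q] .
  then have Qa: "Q \<subseteq> {a..}"
    by auto
  define \<phi> where "\<phi> = (\<lambda>x. - ln (x - a))"
  let ?m = "min (eps_Ainf Q \<phi>) (eps_Ainf Q (\<lambda>x. - \<phi> x))"
  \<comment> \<open>An upper bound is enough: a smaller minimum makes the quotient larger, and for
    minimum \<open>0\<close> the quotient is infinite since \<open>c\<close> is positive.\<close>
  have m: "?m \<le> 1"
    using eps_Ainf_minus_ln_le_1[OF Q ab(2,1)] by (auto simp: \<phi>_def min_le_iff_disj)
  have "c \<le> c / ?m"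
  proof (cases "?m = 0")
    case False
    moreover have "?m < \<infinity>"
      using m by (auto intro: order_le_less_trans)
    ultimately have "c = c / ?m * ?m"
      by (simp add: ennreal_divide_times ennreal_divide_self)
    also have "\<dots> \<le> c / ?m * 1"
      by (rule mult_left_mono[OF m]) simp
    finally show ?thesis
      by simp
  qed simp
  also have "\<dots> \<le> (INF f\<in>Linf Q. bmo_norm p Q (\<lambda>x. \<phi> x - f x))"
    using sharp minus_ln_in_BMO[OF Qa] unfolding \<phi>_def by blast
  \<comment> \<open>The competitor \<open>f = 0\<close> bounds the infimum by the norm of the
    logarithm, which is at most \<open>JN_const p\<close>; this contradicts the choice of
    \<open>c\<close>.\<close>
  also have "\<dots> \<le> bmo_norm p Q (\<lambda>x. \<phi> x - 0)"
    by (rule INF_lower2[of "\<lambda>_. 0"]) (auto simp: Linf_def set_borel_measurable_def)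
  also have "\<dots> \<le> ennreal (log_osc p powr (1 / p))"
    using bmo_norm_minus_ln_le[OF assms Qa] by (simp add: \<phi>_def)
  also have "\<dots> \<le> JN_const p"
    by (rule JN_const_ge_log_osc[OF assms])
  finally show False
    using c by simp
qed

end
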